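(* Each of the following three properties $\mathbf{P}$ of schemes satisfies $(\dagger)$: (1) $\mathbf{P}$ = "locally connected"; (2) $\mathbf{P}$ = "has locally finitely many irreducible components"; (3) $\mathbf{P}$ = "locally topologically Noetherian".
   Context: A property $\mathbf{P}$ of schemes is said to satisfy $(\dagger)$ if all four of the following conditions hold: (i) Let $f\colon X\to Y$ be an integral surjective morphism of affine schemes, and let $G$ be the constant $Y$-group scheme of a finite group, acting on the $Y$-scheme $X$ via $\rho\colon G\times_Y X\to X$, such that the morphism $(\rho,p_X)\colon G\times_Y X\to X\times_Y X$ is surjective, where $p_X\colon G\times_Y X\to X$ is the projection. Then, if $Y$ has $\mathbf{P}$, so does $X$. (ii) Let $A,B$ be rings (commutative with unit). If $\operatorname{Spec}(B)\to\operatorname{Spec}(A)$ is a surjective morphism of schemes and $\operatorname{Spec}(B)$ has $\mathbf{P}$, then so does $\operatorname{Spec}(A)$. (iii) If a scheme $X$ has $\mathbf{P}$, then so does every open subscheme $U\subseteq X$. (iv) If a scheme $X$ has an open covering $(X_i)_{i\in I}$ such that each $X_i$ has $\mathbf{P}$, then $X$ has $\mathbf{P}$. Definitions (applied to a scheme via its underlying topological space): A topological space is locally connected if every point has a fundamental system of connected neighborhoods (equivalently, the connected components of every open subset are open). A topological space $X$ has locally finitely many irreducible components if every point of $X$ has an open neighborhood which meets only finitely many irreducible components of $X$. A topological space is Noetherian if every descending chain of closed subsets becomes stationary, and locally Noetherian if every point has an open neighborhood which is Noetherian. A scheme is locally topologically Noetherian if its underlying topological space is locally Noetherian. *)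

theory Defs
  imports "HOL-Analysis.Analysis" "HOL-Algebra.QuotRing" "HOL-Library.Poly_Mapping"
begin

section \<open>Ringed spaces and sheaves of rings\<close>

text \<open>
  The fields are the underlying space, the ring of sections over an open set, and the
  restriction maps (\<open>res X U V\<close> goes from sections over \<open>U\<close> to sections over \<open>V \<subseteq> U\<close>).
  The values of the last two are only meaningful at open sets, resp. on carriers.
\<close>

record ('p, 's) ringed_space =
  top_of :: "'p topology"
  sec :: "'p set \<Rightarrow> 's ring"
  res :: "'p set \<Rightarrow> 'p set \<Rightarrow> 's \<Rightarrow> 's"

abbreviation points :: "('p, 's) ringed_space \<Rightarrow> 'p set" where
  "points X \<equiv> topspace (top_of X)"

abbreviation open_of :: "('p, 's) ringed_space \<Rightarrow> 'p set \<Rightarrow> bool" where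
  "open_of X U \<equiv> openin (top_of X) U"

definition presheaf_of_rings :: "('p, 's) ringed_space \<Rightarrow> bool" where
  "presheaf_of_rings X \<longleftrightarrow>
     (\<forall>U. open_of X U \<longrightarrow> cring (sec X U)) \<and>
     (\<forall>U V. open_of X U \<and> open_of X V \<and> V \<subseteq> U \<longrightarrow>
        res X U V \<in> ring_hom (sec X U) (sec X V)) \<and>
     (\<forall>U. open_of X U \<longrightarrow> (\<forall>s \<in> carrier (sec X U). res X U U s = s)) \<and>
     (\<forall>U V W. open_of X U \<and> open_of X V \<and> open_of X W \<and> W \<subseteq> V \<and> V \<subseteq> U \<longrightarrow>
        (\<forall>s \<in> carrier (sec X U). res X V W (res X U V s) = res X U W s))"

definition sheaf_of_rings :: "('p, 's) ringed_space \<Rightarrow> bool" where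
  "sheaf_of_rings X \<longleftrightarrow> presheaf_of_rings X \<and>
     (\<forall>\<C>. (\<forall>U \<in> \<C>. open_of X U) \<longrightarrow>
        (\<forall>s \<in> carrier (sec X (\<Union>\<C>)). \<forall>t \<in> carrier (sec X (\<Union>\<C>)).
           (\<forall>U \<in> \<C>. res X (\<Union>\<C>) U s = res X (\<Union>\<C>) U t) \<longrightarrow> s = t) \<and>
        (\<forall>\<sigma>. (\<forall>U \<in> \<C>. \<sigma> U \<in> carrier (sec X U)) \<and>
             (\<forall>U \<in> \<C>. \<forall>V \<in> \<C>. res X U (U \<inter> V) (\<sigma> U) = res X V (U \<inter> V) (\<sigma> V)) \<longrightarrow>
           (\<exists>s \<in> carrier (sec X (\<Union>\<C>)). \<forall>U \<in> \<C>. res X (\<Union>\<C>) U s = \<sigma> U)))"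

definition germ :: "('p, 's) ringed_space \<Rightarrow> 'p \<Rightarrow> 'p set \<Rightarrow> 's \<Rightarrow> ('p set \<times> 's) set" where
  "germ X x U s = {(V, t). open_of X V \<and> x \<in> V \<and> t \<in> carrier (sec X V) \<and>
     (\<exists>W. open_of X W \<and> x \<in> W \<and> W \<subseteq> U \<inter> V \<and> res X U W s = res X V W t)}"

text \<open>Any two germs at a point are represented by sections over a common neighbourhood, and
  the result of a ring operation does not depend on the representatives.\<close>

definition germ_op ::
  "(('p set \<Rightarrow> 's \<Rightarrow> 's \<Rightarrow> 's)) \<Rightarrow> ('p, 's) ringed_space \<Rightarrow> 'p \<Rightarrow>
   ('p set \<times> 's) set \<Rightarrow> ('p set \<times> 's) set \<Rightarrow> ('p set \<times> 's) set" where
  "germ_op opn X x a b = (THE c. \<exists>U s t. open_of X U \<and> x \<in> U \<and>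
     s \<in> carrier (sec X U) \<and> t \<in> carrier (sec X U) \<and>
     a = germ X x U s \<and> b = germ X x U t \<and> c = germ X x U (opn U s t))"

definition stalk :: "('p, 's) ringed_space \<Rightarrow> 'p \<Rightarrow> ('p set \<times> 's) set ring" where
  "stalk X x =
    \<lparr>carrier = {germ X x U s | U s. open_of X U \<and> x \<in> U \<and> s \<in> carrier (sec X U)},
     mult = germ_op (\<lambda>U. mult (sec X U)) X x,
     one = germ X x (points X) (one (sec X (points X))),
     zero = germ X x (points X) (zero (sec X (points X))),
     add = germ_op (\<lambda>U. add (sec X U)) X x\<rparr>"

definition local_ring :: "'a ring \<Rightarrow> bool" where
  "local_ring R \<longleftrightarrow> cring R \<and> (\<exists>!M. maximalideal M R)"

definition locally_ringed_space :: "('p, 's) ringed_space \<Rightarrow> bool" where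
  "locally_ringed_space X \<longleftrightarrow> sheaf_of_rings X \<and> (\<forall>x \<in> points X. local_ring (stalk X x))"

definition open_sub :: "('p, 's) ringed_space \<Rightarrow> 'p set \<Rightarrow> ('p, 's) ringed_space" where
  "open_sub X U = X\<lparr>top_of := subtopology (top_of X) U\<rparr>"


section \<open>Morphisms of locally ringed spaces\<close>

text \<open>A morphism \<open>X \<rightarrow> Y\<close> is a map on points together with maps
  \<open>com f V\<close> from the sections of \<open>Y\<close> over \<open>V\<close> to the sections of \<open>X\<close> over the preimage of \<open>V\<close>.\<close>

record ('p, 's, 'q, 't) mor =
  pt :: "'p \<Rightarrow> 'q"
  com :: "'q set \<Rightarrow> 't \<Rightarrow> 's"

definition preim :: "('p, 's) ringed_space \<Rightarrow> ('p, 's, 'q, 't) mor \<Rightarrow> 'q set \<Rightarrow> 'p set" where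
  "preim X f V = {x \<in> points X. pt f x \<in> V}"

definition stalk_map ::
  "('p, 's) ringed_space \<Rightarrow> ('q, 't) ringed_space \<Rightarrow> ('p, 's, 'q, 't) mor \<Rightarrow> 'p \<Rightarrow>
   ('q set \<times> 't) set \<Rightarrow> ('p set \<times> 's) set" where
  "stalk_map X Y f x a = (THE c. \<exists>V s. open_of Y V \<and> pt f x \<in> V \<and> s \<in> carrier (sec Y V) \<and>
     a = germ Y (pt f x) V s \<and> c = germ X x (preim X f V) (com f V s))"

definition local_hom :: "'a ring \<Rightarrow> 'b ring \<Rightarrow> ('a \<Rightarrow> 'b) \<Rightarrow> bool" where
  "local_hom R S \<phi> \<longleftrightarrow> \<phi> \<in> ring_hom R S \<and> (\<forall>a \<in> carrier R. \<phi> a \<in> Units S \<longrightarrow> a \<in> Units R)"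

definition morphism ::
  "('p, 's) ringed_space \<Rightarrow> ('q, 't) ringed_space \<Rightarrow> ('p, 's, 'q, 't) mor \<Rightarrow> bool" where
  "morphism X Y f \<longleftrightarrow>
     continuous_map (top_of X) (top_of Y) (pt f) \<and>
     (\<forall>V. open_of Y V \<longrightarrow> com f V \<in> ring_hom (sec Y V) (sec X (preim X f V))) \<and>
     (\<forall>V W. open_of Y V \<and> open_of Y W \<and> W \<subseteq> V \<longrightarrow>
        (\<forall>s \<in> carrier (sec Y V).
           com f W (res Y V W s) = res X (preim X f V) (preim X f W) (com f V s))) \<and>
     (\<forall>x \<in> points X. local_hom (stalk Y (pt f x)) (stalk X x) (stalk_map X Y f x))"

text \<open>Equality of morphisms: values off the points and off the carriers are irrelevant.\<close>

definition mor_eq ::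
  "('p, 's) ringed_space \<Rightarrow> ('q, 't) ringed_space \<Rightarrow>
   ('p, 's, 'q, 't) mor \<Rightarrow> ('p, 's, 'q, 't) mor \<Rightarrow> bool" where
  "mor_eq X Y f g \<longleftrightarrow> (\<forall>x \<in> points X. pt f x = pt g x) \<and>
     (\<forall>V. open_of Y V \<longrightarrow> (\<forall>s \<in> carrier (sec Y V). com f V s = com g V s))"

definition id_mor :: "('p, 's, 'p, 's) mor" where
  "id_mor = \<lparr>pt = (\<lambda>x. x), com = (\<lambda>V s. s)\<rparr>"

text \<open>\<open>comp_mor Y g f\<close> is the composite of \<open>f\<close> from \<open>X\<close> to \<open>Y\<close> and \<open>g\<close> from \<open>Y\<close> to \<open>Z\<close>.\<close>

definition comp_mor ::
  "('q, 't) ringed_space \<Rightarrow> ('q, 't, 'r, 'u) mor \<Rightarrow> ('p, 's, 'q, 't) mor \<Rightarrow>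
   ('p, 's, 'r, 'u) mor" where
  "comp_mor Y g f = \<lparr>pt = pt g \<circ> pt f, com = (\<lambda>W s. com f (preim Y g W) (com g W s))\<rparr>"

definition iso_mor ::
  "('p, 's) ringed_space \<Rightarrow> ('q, 't) ringed_space \<Rightarrow> ('p, 's, 'q, 't) mor \<Rightarrow> bool" where
  "iso_mor X Y f \<longleftrightarrow> morphism X Y f \<and>
     (\<exists>g. morphism Y X g \<and> mor_eq X X (comp_mor Y g f) id_mor \<and>
          mor_eq Y Y (comp_mor X f g) id_mor)"

definition surjective_mor ::
  "('p, 's) ringed_space \<Rightarrow> ('q, 't) ringed_space \<Rightarrow> ('p, 's, 'q, 't) mor \<Rightarrow> bool" where
  "surjective_mor X Y f \<longleftrightarrow> pt f ` points X = points Y"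


section \<open>Spectra and schemes\<close>

text \<open>\<open>fraction R P a s\<close> is the fraction \<open>a/s\<close> in the localization of \<open>R\<close> at the prime \<open>P\<close>.\<close>

definition fraction :: "('a, 'm) ring_scheme \<Rightarrow> 'a set \<Rightarrow> 'a \<Rightarrow> 'a \<Rightarrow> ('a \<times> 'a) set" where
  "fraction R P a s = {(b, t). b \<in> carrier R \<and> t \<in> carrier R - P \<and>
     (\<exists>u \<in> carrier R - P. u \<otimes>\<^bsub>R\<^esub> (t \<otimes>\<^bsub>R\<^esub> a) = u \<otimes>\<^bsub>R\<^esub> (s \<otimes>\<^bsub>R\<^esub> b))}"

definition fraction_op ::
  "('a \<Rightarrow> 'a \<Rightarrow> 'a \<Rightarrow> 'a \<Rightarrow> 'a) \<Rightarrow> ('a, 'm) ring_scheme \<Rightarrow> 'a set \<Rightarrow>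
   ('a \<times> 'a) set \<Rightarrow> ('a \<times> 'a) set \<Rightarrow> ('a \<times> 'a) set" where
  "fraction_op num R P x y = (THE z. \<exists>a \<in> carrier R. \<exists>s \<in> carrier R - P.
     \<exists>b \<in> carrier R. \<exists>t \<in> carrier R - P.
       x = fraction R P a s \<and> y = fraction R P b t \<and> z = fraction R P (num a s b t) (s \<otimes>\<^bsub>R\<^esub> t))"

definition localization :: "('a, 'm) ring_scheme \<Rightarrow> 'a set \<Rightarrow> ('a \<times> 'a) set ring" where
  "localization R P =
    \<lparr>carrier = {fraction R P a s | a s. a \<in> carrier R \<and> s \<in> carrier R - P},
     mult = fraction_op (\<lambda>a s b t. a \<otimes>\<^bsub>R\<^esub> b) R P,
     one = fraction R P \<one>\<^bsub>R\<^esub> \<one>\<^bsub>R\<^esub>,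
     zero = fraction R P \<zero>\<^bsub>R\<^esub> \<one>\<^bsub>R\<^esub>,
     add = fraction_op (\<lambda>a s b t. (a \<otimes>\<^bsub>R\<^esub> t) \<oplus>\<^bsub>R\<^esub> (b \<otimes>\<^bsub>R\<^esub> s)) R P\<rparr>"

definition primes :: "('a, 'm) ring_scheme \<Rightarrow> 'a set set" where
  "primes R = {P. primeideal P R}"

definition zariski :: "('a, 'm) ring_scheme \<Rightarrow> 'a set topology" where
  "zariski R = topology (\<lambda>U. \<exists>E \<subseteq> carrier R. U = {P \<in> primes R. \<not> E \<subseteq> P})"

lemma openin_zariski:
  "openin (zariski R) U \<longleftrightarrow> (\<exists>E \<subseteq> carrier R. U = {P \<in> primes R. \<not> E \<subseteq> P})"
proof -
  have inter: "\<exists>G \<subseteq> carrier R. {P \<in> primes R. \<not> E \<subseteq> P} \<inter> {P \<in> primes R. \<not> F \<subseteq> P} =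
      {P \<in> primes R. \<not> G \<subseteq> P}"
    if E: "E \<subseteq> carrier R" and F: "F \<subseteq> carrier R" for E F
  proof (cases "cring R")
    case True
    then interpret cring R .
    have iff: "e \<otimes>\<^bsub>R\<^esub> f \<in> P \<longleftrightarrow> e \<in> P \<or> f \<in> P"
      if "P \<in> primes R" "e \<in> E" "f \<in> F" for P e f
    proof -
      from that(1) interpret P: primeideal P R by (simp add: primes_def)
      have "e \<in> carrier R" "f \<in> carrier R"
        using that E F by auto
      then show ?thesis
        using P.I_prime P.I_l_closed P.I_r_closed by metis
    qed
    let ?G = "{e \<otimes>\<^bsub>R\<^esub> f | e f. e \<in> E \<and> f \<in> F}"
    have "?G \<subseteq> carrier R"
      using E F by auto
    moreover have "(\<not> E \<subseteq> P \<and> \<not> F \<subseteq> P) = (\<not> ?G \<subseteq> P)" if P: "P \<in> primes R" for P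
    proof
      assume "\<not> E \<subseteq> P \<and> \<not> F \<subseteq> P"
      then obtain e f where "e \<in> E" "f \<in> F" "e \<notin> P" "f \<notin> P"
        by (auto simp: subset_iff)
      then have "e \<otimes>\<^bsub>R\<^esub> f \<in> ?G" "e \<otimes>\<^bsub>R\<^esub> f \<notin> P"
        using iff[OF P] by auto
      then show "\<not> ?G \<subseteq> P" by (rule_tac notI) (drule (1) subsetD, simp)
    next
      assume "\<not> ?G \<subseteq> P"
      then obtain e f where "e \<in> E" "f \<in> F" "e \<otimes>\<^bsub>R\<^esub> f \<notin> P"
        by (auto simp: subset_iff)
      then show "\<not> E \<subseteq> P \<and> \<not> F \<subseteq> P"
        using iff[OF P] by (auto simp: subset_iff)
    qed
    then have "{P \<in> primes R. \<not> E \<subseteq> P} \<inter> {P \<in> primes R. \<not> F \<subseteq> P} = {P \<in> primes R. \<not> ?G \<subseteq> P}"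
      by (simp only: Collect_conj_eq[symmetric] conj_assoc conj_left_commute simp_thms
          cong: conj_cong)
    ultimately show ?thesis
      by (intro exI[of _ ?G] conjI)
  next
    case False
    then have "primes R = {}"
      by (auto simp: primes_def primeideal_def)
    then show ?thesis by auto
  qed
  have union: "\<exists>G \<subseteq> carrier R. \<Union>\<K> = {P \<in> primes R. \<not> G \<subseteq> P}"
    if K: "\<forall>K \<in> \<K>. \<exists>E \<subseteq> carrier R. K = {P \<in> primes R. \<not> E \<subseteq> P}" for \<K>
  proof -
    from K obtain E where E: "\<And>K. K \<in> \<K> \<Longrightarrow> E K \<subseteq> carrier R"
      "\<And>K. K \<in> \<K> \<Longrightarrow> K = {P \<in> primes R. \<not> E K \<subseteq> P}" by metis
    have K_iff: "P \<in> K \<longleftrightarrow> P \<in> primes R \<and> \<not> E K \<subseteq> P" if "K \<in> \<K>" for P K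
      by (subst E(2)[OF that]) simp
    have "\<Union>\<K> = {P \<in> primes R. \<not> \<Union>(E ` \<K>) \<subseteq> P}"
    proof (rule Set.set_eqI)
      fix P
      have "P \<in> \<Union>\<K> \<longleftrightarrow> (\<exists>K \<in> \<K>. P \<in> primes R \<and> \<not> E K \<subseteq> P)"
        using K_iff by (simp cong: bex_cong)
      also have "\<dots> \<longleftrightarrow> P \<in> {P \<in> primes R. \<not> \<Union>(E ` \<K>) \<subseteq> P}"
        by (auto simp: UN_subset_iff)
      finally show "P \<in> \<Union>\<K> \<longleftrightarrow> P \<in> {P \<in> primes R. \<not> \<Union>(E ` \<K>) \<subseteq> P}" .
    qed
    moreover have "\<Union>(E ` \<K>) \<subseteq> carrier R" using E(1) by (intro UN_least)
    ultimately show ?thesis by (intro exI[of _ "\<Union>(E ` \<K>)"] conjI)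
  qed
  have "istopology (\<lambda>U. \<exists>E \<subseteq> carrier R. U = {P \<in> primes R. \<not> E \<subseteq> P})"
    unfolding istopology_def
  proof (intro conjI allI impI)
    fix S T
    assume "\<exists>E \<subseteq> carrier R. S = {P \<in> primes R. \<not> E \<subseteq> P}"
      and "\<exists>E \<subseteq> carrier R. T = {P \<in> primes R. \<not> E \<subseteq> P}"
    then show "\<exists>E \<subseteq> carrier R. S \<inter> T = {P \<in> primes R. \<not> E \<subseteq> P}"
      using inter by (elim exE conjE) (simp only:)
  qed (rule union)
  then show ?thesis
    by (simp add: zariski_def)
qed

definition prod_ring :: "'i set \<Rightarrow> ('i \<Rightarrow> ('a, 'm) ring_scheme) \<Rightarrow> ('i \<Rightarrow> 'a) ring" where
  "prod_ring I R =
    \<lparr>carrier = (\<Pi>\<^sub>E i\<in>I. carrier (R i)),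
     mult = (\<lambda>f g. \<lambda>i\<in>I. f i \<otimes>\<^bsub>R i\<^esub> g i),
     one = (\<lambda>i\<in>I. \<one>\<^bsub>R i\<^esub>),
     zero = (\<lambda>i\<in>I. \<zero>\<^bsub>R i\<^esub>),
     add = (\<lambda>f g. \<lambda>i\<in>I. f i \<oplus>\<^bsub>R i\<^esub> g i)\<rparr>"

text \<open>A section over \<open>U\<close> is a family of elements of the localizations at the
  points of \<open>U\<close> that is locally given by fractions.\<close>

definition Spec ::
  "('a, 'm) ring_scheme \<Rightarrow> ('a set, 'a set \<Rightarrow> ('a \<times> 'a) set) ringed_space" where
  "Spec R =
    \<lparr>top_of = zariski R,
     sec = (\<lambda>U. (prod_ring U (localization R))
       \<lparr>carrier := {\<sigma> \<in> (\<Pi>\<^sub>E P\<in>U. carrier (localization R P)).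
          \<forall>P \<in> U. \<exists>V a s. openin (zariski R) V \<and> P \<in> V \<and> V \<subseteq> U \<and>
            a \<in> carrier R \<and> s \<in> carrier R \<and> (\<forall>Q \<in> V. s \<notin> Q \<and> \<sigma> Q = fraction R Q a s)}\<rparr>),
     res = (\<lambda>U V \<sigma>. restrict \<sigma> V)\<rparr>"

text \<open>The morphism from \<open>Spec B\<close> to \<open>Spec A\<close> induced by a ring homomorphism \<open>\<phi>\<close> from \<open>A\<close> to \<open>B\<close>.\<close>

definition contract :: "('a, 'm) ring_scheme \<Rightarrow> ('a \<Rightarrow> 'b) \<Rightarrow> 'b set \<Rightarrow> 'a set" where
  "contract A \<phi> Q = {a \<in> carrier A. \<phi> a \<in> Q}"

definition localization_map ::
  "('a, 'm) ring_scheme \<Rightarrow> ('b, 'n) ring_scheme \<Rightarrow> ('a \<Rightarrow> 'b) \<Rightarrow> 'b set \<Rightarrow>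
   ('a \<times> 'a) set \<Rightarrow> ('b \<times> 'b) set" where
  "localization_map A B \<phi> Q x = (THE y. \<exists>a \<in> carrier A. \<exists>s \<in> carrier A - contract A \<phi> Q.
     x = fraction A (contract A \<phi> Q) a s \<and> y = fraction B Q (\<phi> a) (\<phi> s))"

definition Spec_map ::
  "('a, 'm) ring_scheme \<Rightarrow> ('b, 'n) ring_scheme \<Rightarrow> ('a \<Rightarrow> 'b) \<Rightarrow>
   ('b set, 'b set \<Rightarrow> ('b \<times> 'b) set, 'a set, 'a set \<Rightarrow> ('a \<times> 'a) set) mor" where
  "Spec_map A B \<phi> =
    \<lparr>pt = contract A \<phi>,
     com = (\<lambda>V \<sigma>. \<lambda>Q \<in> {Q \<in> primes B. contract A \<phi> Q \<in> V}.
       localization_map A B \<phi> Q (\<sigma> (contract A \<phi> Q)))\<rparr>"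

text \<open>An affine scheme is isomorphic to the spectrum of its ring of global sections, so
  letting the ring range over the type of the sections of \<open>X\<close> is no restriction.\<close>

definition affine_scheme :: "('p, 's) ringed_space \<Rightarrow> bool" where
  "affine_scheme X \<longleftrightarrow> locally_ringed_space X \<and>
     (\<exists>(R :: 's ring) f. cring R \<and> iso_mor X (Spec R) f)"

definition scheme :: "('p, 's) ringed_space \<Rightarrow> bool" where
  "scheme X \<longleftrightarrow> locally_ringed_space X \<and>
     (\<forall>x \<in> points X. \<exists>U. open_of X U \<and> x \<in> U \<and> affine_scheme (open_sub X U))"


section \<open>Integral morphisms\<close>

definition integral_hom ::
  "('a, 'm) ring_scheme \<Rightarrow> ('b, 'n) ring_scheme \<Rightarrow> ('a \<Rightarrow> 'b) \<Rightarrow> bool" where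
  "integral_hom A B \<phi> \<longleftrightarrow> \<phi> \<in> ring_hom A B \<and>
     (\<forall>b \<in> carrier B. \<exists>(n :: nat) c. (\<forall>i<n. c i \<in> carrier A) \<and>
        b [^]\<^bsub>B\<^esub> n \<oplus>\<^bsub>B\<^esub> (\<Oplus>\<^bsub>B\<^esub> i \<in> {..<n}. \<phi> (c i) \<otimes>\<^bsub>B\<^esub> b [^]\<^bsub>B\<^esub> i) = \<zero>\<^bsub>B\<^esub>)"

definition integral_mor ::
  "('p, 's) ringed_space \<Rightarrow> ('q, 't) ringed_space \<Rightarrow> ('p, 's, 'q, 't) mor \<Rightarrow> bool" where
  "integral_mor X Y f \<longleftrightarrow>
     (\<forall>V. open_of Y V \<and> affine_scheme (open_sub Y V) \<longrightarrow>
        affine_scheme (open_sub X (preim X f V)) \<and>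
        integral_hom (sec Y V) (sec X (preim X f V)) (com f V))"


section \<open>Actions of constant group schemes\<close>

text \<open>\<open>copies I X\<close> is the disjoint union of copies of \<open>X\<close> indexed by \<open>I\<close>, with its inclusions
  and the morphisms out of it given by families of morphisms.\<close>

definition copies :: "'i set \<Rightarrow> ('p, 's) ringed_space \<Rightarrow> ('i \<times> 'p, 'i \<Rightarrow> 's) ringed_space" where
  "copies I X =
    \<lparr>top_of = sum_topology (\<lambda>i. top_of X) I,
     sec = (\<lambda>U. prod_ring I (\<lambda>i. sec X (Pair i -` U))),
     res = (\<lambda>U V s. \<lambda>i\<in>I. res X (Pair i -` U) (Pair i -` V) (s i))\<rparr>"

definition incl_mor :: "'i \<Rightarrow> ('p, 's, 'i \<times> 'p, 'i \<Rightarrow> 's) mor" where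
  "incl_mor i = \<lparr>pt = Pair i, com = (\<lambda>U s. s i)\<rparr>"

definition copair ::
  "'i set \<Rightarrow> ('i \<Rightarrow> ('p, 's, 'q, 't) mor) \<Rightarrow> ('i \<times> 'p, 'i \<Rightarrow> 's, 'q, 't) mor" where
  "copair I f = \<lparr>pt = (\<lambda>(i, x). pt (f i) x), com = (\<lambda>V s. \<lambda>i\<in>I. com (f i) V s)\<rparr>"

text \<open>
  The constant \<open>Y\<close>-group scheme \<open>G\<close> of a finite group \<open>\<Gamma>\<close> is the disjoint union of copies of
  \<open>Y\<close> indexed by \<open>\<Gamma>\<close>, with multiplication and unit given by those of \<open>\<Gamma>\<close> on the index sets.
  For a \<open>Y\<close>-scheme \<open>Z\<close> the fibre product \<open>G \<times>\<^sub>Y Z\<close> is the disjoint union of copies of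
  \<open>Z\<close> indexed by \<open>\<Gamma>\<close>; hence \<open>G \<times>\<^sub>Y X\<close> is \<open>copies \<Gamma> X\<close> and \<open>G \<times>\<^sub>Y G \<times>\<^sub>Y X\<close>
  is \<open>copies \<Gamma> (copies \<Gamma> X)\<close>.
\<close>

abbreviation times_const ::
  "('g, 'm) monoid_scheme \<Rightarrow> ('p, 's) ringed_space \<Rightarrow> ('g \<times> 'p, 'g \<Rightarrow> 's) ringed_space" where
  "times_const \<Gamma> X \<equiv> copies (carrier \<Gamma>) X"

definition proj_X :: "('g, 'm) monoid_scheme \<Rightarrow> ('g \<times> 'p, 'g \<Rightarrow> 's, 'p, 's) mor" where
  "proj_X \<Gamma> = copair (carrier \<Gamma>) (\<lambda>g. id_mor)"

definition unit_times_X :: "('g, 'm) monoid_scheme \<Rightarrow> ('p, 's, 'g \<times> 'p, 'g \<Rightarrow> 's) mor" where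
  "unit_times_X \<Gamma> = incl_mor \<one>\<^bsub>\<Gamma>\<^esub>"

definition id_times_act ::
  "('g, 'm) monoid_scheme \<Rightarrow> ('p, 's) ringed_space \<Rightarrow> ('g \<times> 'p, 'g \<Rightarrow> 's, 'p, 's) mor \<Rightarrow>
   ('g \<times> 'g \<times> 'p, 'g \<Rightarrow> 'g \<Rightarrow> 's, 'g \<times> 'p, 'g \<Rightarrow> 's) mor" where
  "id_times_act \<Gamma> X \<rho> = copair (carrier \<Gamma>) (\<lambda>g. comp_mor X (incl_mor g) \<rho>)"

definition mult_times_X ::
  "('g, 'm) monoid_scheme \<Rightarrow> ('g \<times> 'g \<times> 'p, 'g \<Rightarrow> 'g \<Rightarrow> 's, 'g \<times> 'p, 'g \<Rightarrow> 's) mor" where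
  "mult_times_X \<Gamma> =
     copair (carrier \<Gamma>) (\<lambda>g. copair (carrier \<Gamma>) (\<lambda>h. incl_mor (g \<otimes>\<^bsub>\<Gamma>\<^esub> h)))"

definition const_group_action ::
  "('g, 'm) monoid_scheme \<Rightarrow> ('p, 's) ringed_space \<Rightarrow> ('q, 't) ringed_space \<Rightarrow>
   ('p, 's, 'q, 't) mor \<Rightarrow> ('g \<times> 'p, 'g \<Rightarrow> 's, 'p, 's) mor \<Rightarrow> bool" where
  "const_group_action \<Gamma> X Y f \<rho> \<longleftrightarrow>
     morphism (times_const \<Gamma> X) X \<rho> \<and>
     mor_eq (times_const \<Gamma> X) Y (comp_mor X f \<rho>) (comp_mor X f (proj_X \<Gamma>)) \<and>
     mor_eq X X (comp_mor (times_const \<Gamma> X) \<rho> (unit_times_X \<Gamma>)) id_mor \<and>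
     mor_eq (times_const \<Gamma> (times_const \<Gamma> X)) X
       (comp_mor (times_const \<Gamma> X) \<rho> (id_times_act \<Gamma> X \<rho>))
       (comp_mor (times_const \<Gamma> X) \<rho> (mult_times_X \<Gamma>))"


section \<open>Tensor products and fibre products of affine schemes\<close>

text \<open>The monoid ring over the integers of the product of the multiplicative monoids
  of \<open>B\<close> and \<open>C\<close>: formal integer combinations of pairs, multiplied bilinearly.\<close>

definition pair_ring ::
  "('b, 'm) ring_scheme \<Rightarrow> ('c, 'n) ring_scheme \<Rightarrow> ('b \<times> 'c \<Rightarrow>\<^sub>0 int) ring" where
  "pair_ring B C =
    \<lparr>carrier = {z. Poly_Mapping.keys z \<subseteq> carrier B \<times> carrier C},
     mult = (\<lambda>z w. frag_extend (\<lambda>(b, c).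
        frag_extend (\<lambda>(b', c'). frag_of (b \<otimes>\<^bsub>B\<^esub> b', c \<otimes>\<^bsub>C\<^esub> c')) w) z),
     one = frag_of (\<one>\<^bsub>B\<^esub>, \<one>\<^bsub>C\<^esub>),
     zero = 0,
     add = (+)\<rparr>"

text \<open>The tensor product over \<open>A\<close> of the \<open>A\<close>-algebras \<open>\<phi>\<close> from \<open>A\<close> to \<open>B\<close> and \<open>\<psi>\<close> from \<open>A\<close> to \<open>C\<close>.
  The additive subgroup generated by the relations is already an ideal.\<close>

definition tensor_ideal ::
  "('a, 'k) ring_scheme \<Rightarrow> ('b, 'm) ring_scheme \<Rightarrow> ('c, 'n) ring_scheme \<Rightarrow>
   ('a \<Rightarrow> 'b) \<Rightarrow> ('a \<Rightarrow> 'c) \<Rightarrow> ('b \<times> 'c \<Rightarrow>\<^sub>0 int) set" where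
  "tensor_ideal A B C \<phi> \<psi> = genideal (pair_ring B C)
    ({frag_of (b \<oplus>\<^bsub>B\<^esub> b', c) - frag_of (b, c) - frag_of (b', c) | b b' c.
        b \<in> carrier B \<and> b' \<in> carrier B \<and> c \<in> carrier C} \<union>
     {frag_of (b, c \<oplus>\<^bsub>C\<^esub> c') - frag_of (b, c) - frag_of (b, c') | b c c'.
        b \<in> carrier B \<and> c \<in> carrier C \<and> c' \<in> carrier C} \<union>
     {frag_of (\<phi> a \<otimes>\<^bsub>B\<^esub> b, c) - frag_of (b, \<psi> a \<otimes>\<^bsub>C\<^esub> c) | a b c.
        a \<in> carrier A \<and> b \<in> carrier B \<and> c \<in> carrier C})"

definition tensor_ring ::
  "('a, 'k) ring_scheme \<Rightarrow> ('b, 'm) ring_scheme \<Rightarrow> ('c, 'n) ring_scheme \<Rightarrow>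
   ('a \<Rightarrow> 'b) \<Rightarrow> ('a \<Rightarrow> 'c) \<Rightarrow> ('b \<times> 'c \<Rightarrow>\<^sub>0 int) set ring" where
  "tensor_ring A B C \<phi> \<psi> = pair_ring B C Quot tensor_ideal A B C \<phi> \<psi>"

definition tensor_elt ::
  "('a, 'k) ring_scheme \<Rightarrow> ('b, 'm) ring_scheme \<Rightarrow> ('c, 'n) ring_scheme \<Rightarrow>
   ('a \<Rightarrow> 'b) \<Rightarrow> ('a \<Rightarrow> 'c) \<Rightarrow> 'b \<Rightarrow> 'c \<Rightarrow> ('b \<times> 'c \<Rightarrow>\<^sub>0 int) set" where
  "tensor_elt A B C \<phi> \<psi> b c = tensor_ideal A B C \<phi> \<psi> +>\<^bsub>pair_ring B C\<^esub> frag_of (b, c)"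

text \<open>
  For affine \<open>X\<close> and \<open>Y\<close>, the morphism \<open>f\<close> is identified, via isomorphisms \<open>\<beta>\<close> from \<open>X\<close> to
  \<open>Spec B\<close> and \<open>\<alpha>\<close> from \<open>Y\<close> to \<open>Spec A\<close>, with the one induced by a ring homomorphism \<open>\<phi>\<close>; then
  \<open>X \<times>\<^sub>Y X\<close> is the spectrum of the tensor product of \<open>B\<close> with itself over \<open>A\<close>, and \<open>(\<rho>, p\<^sub>X)\<close> is
  the unique morphism \<open>h\<close> whose composites with the two projections are \<open>\<rho>\<close> and \<open>p\<^sub>X\<close>.
  Such data always exist, and surjectivity of \<open>h\<close> does not depend on their choice.
\<close>

definition act_proj_surjective ::
  "('g, 'm) monoid_scheme \<Rightarrow> ('p, 's) ringed_space \<Rightarrow> ('q, 't) ringed_space \<Rightarrow>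
   ('p, 's, 'q, 't) mor \<Rightarrow> ('g \<times> 'p, 'g \<Rightarrow> 's, 'p, 's) mor \<Rightarrow> bool" where
  "act_proj_surjective \<Gamma> X Y f \<rho> \<longleftrightarrow>
     (\<exists>(A :: 't ring) (B :: 's ring) \<phi> \<alpha> \<beta> h.
        cring A \<and> cring B \<and> \<phi> \<in> ring_hom A B \<and>
        iso_mor Y (Spec A) \<alpha> \<and> iso_mor X (Spec B) \<beta> \<and>
        mor_eq X (Spec A) (comp_mor Y \<alpha> f) (comp_mor (Spec B) (Spec_map A B \<phi>) \<beta>) \<and>
        (let T = tensor_ring A B B \<phi> \<phi>;
             pr\<^sub>1 = Spec_map B T (\<lambda>b. tensor_elt A B B \<phi> \<phi> b \<one>\<^bsub>B\<^esub>);
             pr\<^sub>2 = Spec_map B T (\<lambda>b. tensor_elt A B B \<phi> \<phi> \<one>\<^bsub>B\<^esub> b)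
         in morphism (times_const \<Gamma> X) (Spec T) h \<and>
            mor_eq (times_const \<Gamma> X) (Spec B) (comp_mor (Spec T) pr\<^sub>1 h) (comp_mor X \<beta> \<rho>) \<and>
            mor_eq (times_const \<Gamma> X) (Spec B) (comp_mor (Spec T) pr\<^sub>2 h)
              (comp_mor X \<beta> (proj_X \<Gamma>)) \<and>
            surjective_mor (times_const \<Gamma> X) (Spec T) h))"


section \<open>The property dagger\<close>

text \<open>
  A variable standing for a property of schemes has a single type in HOL, so it cannot be applied
  to schemes with points and sections of different types.  The following predicates therefore take
  the property at each of the types at which it is needed; they are meant to be applied to
  instances of one and the same polymorphic property.  The argument of type \<open>'g itself\<close> is the
  type of the elements of the finite groups.
\<close>

definition dagger_i ::
  "'g itself \<Rightarrow> (('p, 's) ringed_space \<Rightarrow> bool) \<Rightarrow> (('q, 't) ringed_space \<Rightarrow> bool) \<Rightarrow> bool" where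
  "dagger_i _ P\<^sub>X P\<^sub>Y \<longleftrightarrow>
     (\<forall>X Y f (\<Gamma> :: 'g monoid) \<rho>.
        affine_scheme X \<and> affine_scheme Y \<and> morphism X Y f \<and>
        integral_mor X Y f \<and> surjective_mor X Y f \<and>
        group \<Gamma> \<and> finite (carrier \<Gamma>) \<and> const_group_action \<Gamma> X Y f \<rho> \<and>
        act_proj_surjective \<Gamma> X Y f \<rho> \<and> P\<^sub>Y Y \<longrightarrow> P\<^sub>X X)"

definition dagger_ii ::
  "(('a set, 'a set \<Rightarrow> ('a \<times> 'a) set) ringed_space \<Rightarrow> bool) \<Rightarrow>
   (('b set, 'b set \<Rightarrow> ('b \<times> 'b) set) ringed_space \<Rightarrow> bool) \<Rightarrow> bool" where
  "dagger_ii P\<^sub>A P\<^sub>B \<longleftrightarrow>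
     (\<forall>(A :: 'a ring) (B :: 'b ring) f.
        cring A \<and> cring B \<and> morphism (Spec B) (Spec A) f \<and>
        surjective_mor (Spec B) (Spec A) f \<and> P\<^sub>B (Spec B) \<longrightarrow> P\<^sub>A (Spec A))"

definition dagger_iii :: "(('p, 's) ringed_space \<Rightarrow> bool) \<Rightarrow> bool" where
  "dagger_iii P \<longleftrightarrow> (\<forall>X U. scheme X \<and> P X \<and> open_of X U \<longrightarrow> P (open_sub X U))"

definition dagger_iv :: "(('p, 's) ringed_space \<Rightarrow> bool) \<Rightarrow> bool" where
  "dagger_iv P \<longleftrightarrow>
     (\<forall>X \<U>. scheme X \<and> (\<forall>U \<in> \<U>. open_of X U \<and> P (open_sub X U)) \<and> \<Union>\<U> = points X \<longrightarrow> P X)"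

definition satisfies_dagger ::
  "'g itself \<Rightarrow>
   (('p, 's) ringed_space \<Rightarrow> bool) \<Rightarrow> (('q, 't) ringed_space \<Rightarrow> bool) \<Rightarrow>
   (('a set, 'a set \<Rightarrow> ('a \<times> 'a) set) ringed_space \<Rightarrow> bool) \<Rightarrow>
   (('b set, 'b set \<Rightarrow> ('b \<times> 'b) set) ringed_space \<Rightarrow> bool) \<Rightarrow> bool" where
  "satisfies_dagger G P\<^sub>X P\<^sub>Y P\<^sub>A P\<^sub>B \<longleftrightarrow>
     dagger_i G P\<^sub>X P\<^sub>Y \<and> dagger_ii P\<^sub>A P\<^sub>B \<and> dagger_iii P\<^sub>X \<and> dagger_iv P\<^sub>X"


section \<open>The three properties\<close>

definition irreducible_in :: "'p topology \<Rightarrow> 'p set \<Rightarrow> bool" where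
  "irreducible_in T Z \<longleftrightarrow> Z \<subseteq> topspace T \<and> Z \<noteq> {} \<and>
     (\<forall>C D. closedin T C \<and> closedin T D \<and> Z \<subseteq> C \<union> D \<longrightarrow> Z \<subseteq> C \<or> Z \<subseteq> D)"

definition irreducible_component_of :: "'p topology \<Rightarrow> 'p set \<Rightarrow> bool" where
  "irreducible_component_of T Z \<longleftrightarrow>
     irreducible_in T Z \<and> (\<forall>Z'. irreducible_in T Z' \<and> Z \<subseteq> Z' \<longrightarrow> Z' = Z)"

definition loc_fin_many_irred_components :: "'p topology \<Rightarrow> bool" where
  "loc_fin_many_irred_components T \<longleftrightarrow>
     (\<forall>x \<in> topspace T. \<exists>U. openin T U \<and> x \<in> U \<and>
        finite {Z. irreducible_component_of T Z \<and> Z \<inter> U \<noteq> {}})"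

definition noetherian_top :: "'p topology \<Rightarrow> bool" where
  "noetherian_top T \<longleftrightarrow>
     (\<forall>C :: nat \<Rightarrow> 'p set. (\<forall>n. closedin T (C n)) \<and> (\<forall>n. C (Suc n) \<subseteq> C n) \<longrightarrow>
        (\<exists>N. \<forall>n \<ge> N. C n = C N))"

definition locally_noetherian_top :: "'p topology \<Rightarrow> bool" where
  "locally_noetherian_top T \<longleftrightarrow>
     (\<forall>x \<in> topspace T. \<exists>U. openin T U \<and> x \<in> U \<and> noetherian_top (subtopology T U))"

definition locally_connected_scheme :: "('p, 's) ringed_space \<Rightarrow> bool" where
  "locally_connected_scheme X \<longleftrightarrow> locally_connected_space (top_of X)"

definition loc_fin_many_irred_components_scheme :: "('p, 's) ringed_space \<Rightarrow> bool" where
  "loc_fin_many_irred_components_scheme X \<longleftrightarrow> loc_fin_many_irred_components (top_of X)"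

definition locally_top_noetherian_scheme :: "('p, 's) ringed_space \<Rightarrow> bool" where
  "locally_top_noetherian_scheme X \<longleftrightarrow> locally_noetherian_top (top_of X)"

end

(* Points of Spec B over a common point of Spec A are conjugate because the tensor product of their
   residue fields over a common subfield is nonzero, so the surjection from the constant group scheme
   times X onto the fibre product hits a point above them; and Spec B -> Spec A is closed by lying
   over. Thus Y is topologically the quotient of X by a finite group, with an open and closed quotient
   map, and the rest of (i) is topology. For irreducible components, an irreducible closed set of Y
   is the image of a minimal, hence irreducible, closed set of X, whose translates are all the
   components above it. For the Noetherian property, a descending chain in X is controlled by the
   saturated sets of points with at least k translates in its members.

   Local connectedness is reduced to bounding the size of partitions of quasi-compact open sets into
   open pieces: this is enough since such sets form a base, and the bound passes to images, which
   gives (ii), where a surjection of spectra need not be a quotient map. In (i), it holds for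
   preimages of connected open sets of Y, and it is propagated to every quasi-compact open set U of X
   by downward induction over the intersections of translates of U. *)

theory Submission
  imports Defs "HOL-Algebra.Ring_Divisibility" "HOL-Algebra.Free_Abelian_Groups"
begin

section \<open>Commutative algebra: primes, fractions, integral extensions\<close>

section \<open>Prime ideals and localization\<close>

text \<open>Two obstacles shape the algebra. \<open>Spec R\<close> is made of local fractions, and
  the identification of R with its global sections is never established; integrality of sections is
  therefore turned into relations in B that hold only modulo a prime and whose leading coefficient
  is some \<open>u\<close> outside P instead of 1. Lying over still works for such relations. And
  the morphism in (ii) is not known to come from a ring homomorphism, so quasi-compactness of
  preimages of basic open sets has to be extracted from the locality of the maps on stalks. For the
  other two properties, (ii) takes no more than a continuous surjection from a quasi-compact space.
  In (i), local connectedness and the Noetherian property both rest on counting translates: the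
  number of g with gx in a given set depends only on the orbit of x up to which g occur, because
  moving x in its orbit shifts the index set by right multiplication. Sets given by a lower bound on
  this number are thus saturated and can be compared with their images in Y.\<close>

lemma (in cring) ideal_add_principal:
  assumes P: "ideal P R" and a: "a \<in> carrier R"
  shows "ideal (P <+>\<^bsub>R\<^esub> PIdl a) R" "P \<subseteq> P <+>\<^bsub>R\<^esub> PIdl a" "a \<in> P <+>\<^bsub>R\<^esub> PIdl a"
proof -
  interpret P: ideal P R by (rule P)
  show "ideal (P <+>\<^bsub>R\<^esub> PIdl a) R" by (rule add_ideals[OF P cgenideal_ideal[OF a]])
  show "P \<subseteq> P <+>\<^bsub>R\<^esub> PIdl a"
  proof
    fix p assume p: "p \<in> P"
    then have "p = p \<oplus> \<zero>" using P.Icarr by simp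
    moreover have "\<zero> \<in> PIdl a"
      by (simp add: additive_subgroup.zero_closed ideal.axioms(1) cgenideal_ideal[OF a])
    ultimately show "p \<in> P <+>\<^bsub>R\<^esub> PIdl a" using p unfolding set_add_def' by blast
  qed
  have "a = \<zero> \<oplus> a" using a by simp
  then show "a \<in> P <+>\<^bsub>R\<^esub> PIdl a"
    using P.zero_closed cgenideal_self[OF a] unfolding set_add_def' by blast
qed

text \<open>An ideal P maximal among those that contain I and avoid S is prime: for a and b outside
  P, both P + (a) and P + (b) meet S. Maximality is part of the conclusion because lying over
  exploits it again.\<close>

lemma (in cring) prime_avoiding_mult_closed:
  assumes I: "ideal I R" and S: "\<one> \<in> S" "\<And>s t. s \<in> S \<Longrightarrow> t \<in> S \<Longrightarrow> s \<otimes> t \<in> S"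
    and IS: "I \<inter> S = {}"
  obtains P where "primeideal P R" "I \<subseteq> P" "P \<inter> S = {}"
    "\<And>J. ideal J R \<Longrightarrow> P \<subseteq> J \<Longrightarrow> J \<inter> S = {} \<Longrightarrow> J = P"
proof -
  let ?\<I> = "{J. ideal J R \<and> I \<subseteq> J \<and> J \<inter> S = {}}"
  have "\<exists>M\<in>?\<I>. \<forall>J\<in>?\<I>. M \<subseteq> J \<longrightarrow> J = M"
  proof (rule subset_Zorn_nonempty)
    show "?\<I> \<noteq> {}" using I IS by blast
    fix \<C> assume ne: "\<C> \<noteq> {}" and ch: "subset.chain ?\<I> \<C>"
    then have sub: "\<C> \<subseteq> ?\<I>" and "subset.chain {J. ideal J R} \<C>"
      unfolding subset_chain_def by blast+
    then have "ideal (if \<C> = {} then {\<zero>} else \<Union>\<C>) R" by (intro chain_Union_is_ideal)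
    then have "ideal (\<Union>\<C>) R" using ne by simp
    then show "\<Union>\<C> \<in> ?\<I>" using ne sub by blast
  qed
  then obtain P where P: "P \<in> ?\<I>" and max: "\<forall>J \<in> ?\<I>. P \<subseteq> J \<longrightarrow> J = P" by (rule bexE)
  then interpret P: ideal P R by simp
  have max': "J = P" if "ideal J R" "P \<subseteq> J" "J \<inter> S = {}" for J
    using max P that by blast
  have meets: "\<exists>p \<in> P. \<exists>r \<in> carrier R. p \<oplus> r \<otimes> a \<in> S" if a: "a \<in> carrier R" "a \<notin> P" for a
  proof -
    let ?J = "P <+>\<^bsub>R\<^esub> PIdl a"
    have "?J \<inter> S \<noteq> {}"
      using max'[OF ideal_add_principal(1,2)[OF P.is_ideal a(1)]]
        ideal_add_principal(3)[OF P.is_ideal a(1)] a(2) by blast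
    then show ?thesis unfolding set_add_def' cgenideal_def by blast
  qed
  have "primeideal P R"
  proof (rule primeidealI[OF P.is_ideal is_cring])
    show "carrier R \<noteq> P"
      using P S(1) by auto
    fix a b assume ab: "a \<in> carrier R" "b \<in> carrier R" "a \<otimes> b \<in> P"
    show "a \<in> P \<or> b \<in> P"
    proof (rule ccontr)
      assume "\<not> ?thesis"
      then obtain p r q t where pr: "p \<in> P" "r \<in> carrier R" "p \<oplus> r \<otimes> a \<in> S"
        and qt: "q \<in> P" "t \<in> carrier R" "q \<oplus> t \<otimes> b \<in> S"
        using meets ab by meson
      have c: "p \<in> carrier R" "q \<in> carrier R" using pr qt P.Icarr by auto
      \<comment> \<open>Every summand on the right has a factor p, q or ab, so the product of two
        elements of S falls into P.\<close>
      have "(p \<oplus> r \<otimes> a) \<otimes> (q \<oplus> t \<otimes> b) =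
          p \<otimes> (q \<oplus> t \<otimes> b) \<oplus> ((r \<otimes> a) \<otimes> q \<oplus> (r \<otimes> t) \<otimes> (a \<otimes> b))"
        using ab pr qt c by algebra
      moreover have "\<dots> \<in> P"
        using ab pr qt c by (simp add: P.a_closed P.I_r_closed P.I_l_closed)
      ultimately show False using S(2)[OF pr(3) qt(3)] P by auto
    qed
  qed
  then show thesis using that P max' by blast
qed

context primeideal
begin

abbreviation frac :: "'a \<Rightarrow> 'a \<Rightarrow> ('a \<times> 'a) set" where
  "frac \<equiv> fraction R I"

lemma nonmemb_mult: "s \<in> carrier R - I \<Longrightarrow> t \<in> carrier R - I \<Longrightarrow> s \<otimes> t \<in> carrier R - I"
  using I_prime by auto

lemma one_nonmemb: "\<one> \<in> carrier R - I"
  using I_notcarr one_imp_carrier by auto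

lemma frac_refl:
  assumes "a \<in> carrier R" "s \<in> carrier R - I"
  shows "(a, s) \<in> frac a s"
  using assms one_nonmemb by (auto simp: fraction_def)

text \<open>A fraction is encoded as the whole class of equivalent pairs. Equality gives the
  relation by reflexivity; the converse is transitivity, where the product of both multipliers with
  the middle denominator \<open>t'\<close> serves as the new multiplier.\<close>

lemma frac_eq_iff:
  assumes a: "a \<in> carrier R" "s \<in> carrier R - I" and b: "b \<in> carrier R" "t \<in> carrier R - I"
  shows "frac a s = frac b t \<longleftrightarrow> (\<exists>u \<in> carrier R - I. u \<otimes> (t \<otimes> a) = u \<otimes> (s \<otimes> b))"
proof
  assume "frac a s = frac b t"
  then have "(b, t) \<in> frac a s" using frac_refl[OF b] by simp
  then show "\<exists>u \<in> carrier R - I. u \<otimes> (t \<otimes> a) = u \<otimes> (s \<otimes> b)" by (simp add: fraction_def)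
next
  have *: "frac b' t' \<subseteq> frac a' s'"
    if a': "a' \<in> carrier R" "s' \<in> carrier R - I" and b': "b' \<in> carrier R" "t' \<in> carrier R - I"
      and u: "u \<in> carrier R - I" "u \<otimes> (t' \<otimes> a') = u \<otimes> (s' \<otimes> b')" for a' s' b' t' u
  proof
    fix z assume "z \<in> frac b' t'"
    then obtain c r v where z: "z = (c, r)" "c \<in> carrier R" "r \<in> carrier R - I" "v \<in> carrier R - I"
      and v: "v \<otimes> (r \<otimes> b') = v \<otimes> (t' \<otimes> c)" by (auto simp: fraction_def)
    have c: "a' \<in> carrier R" "s' \<in> carrier R" "b' \<in> carrier R" "t' \<in> carrier R" "u \<in> carrier R"
      "c \<in> carrier R" "r \<in> carrier R" "v \<in> carrier R" using a' b' u z by auto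
    have "(u \<otimes> v \<otimes> t') \<otimes> (r \<otimes> a') = v \<otimes> r \<otimes> (u \<otimes> (t' \<otimes> a'))" using c by algebra
    also have "\<dots> = u \<otimes> s' \<otimes> (v \<otimes> (r \<otimes> b'))" unfolding u(2) using c by algebra
    also have "\<dots> = (u \<otimes> v \<otimes> t') \<otimes> (s' \<otimes> c)" unfolding v using c by algebra
    finally have "(u \<otimes> v \<otimes> t') \<otimes> (r \<otimes> a') = (u \<otimes> v \<otimes> t') \<otimes> (s' \<otimes> c)" .
    moreover have "u \<otimes> v \<otimes> t' \<in> carrier R - I" using u z b' by (intro nonmemb_mult)
    ultimately show "z \<in> frac a' s'" using z by (auto simp: fraction_def)
  qed
  assume "\<exists>u \<in> carrier R - I. u \<otimes> (t \<otimes> a) = u \<otimes> (s \<otimes> b)"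
  then obtain u where u: "u \<in> carrier R - I" "u \<otimes> (t \<otimes> a) = u \<otimes> (s \<otimes> b)" by blast
  show "frac a s = frac b t"
    using *[OF a b u] *[OF b a u(1) u(2)[symmetric]] by blast
qed

lemma frac_eqI:
  assumes "a \<in> carrier R" "s \<in> carrier R - I" "b \<in> carrier R" "t \<in> carrier R - I" "t \<otimes> a = s \<otimes> b"
  shows "frac a s = frac b t"
  using assms one_nonmemb by (subst frac_eq_iff) auto

text \<open>\<open>fraction_op\<close> is a definite description over all representatives, so it has
  the expected value as soon as the result does not depend on them. \<open>cong\<close> isolates
  this independence, the only point at which sum and product differ.\<close>

lemma frac_op:
  assumes a: "a \<in> carrier R" "s \<in> carrier R - I" and b: "b \<in> carrier R" "t \<in> carrier R - I"
    and num: "\<And>a s b t. \<lbrakk>a \<in> carrier R; s \<in> carrier R; b \<in> carrier R; t \<in> carrier R\<rbrakk> \<Longrightarrow>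
        num a s b t \<in> carrier R"
    and cong: "\<And>a s b t a' s' b' t'. \<lbrakk>a \<in> carrier R; s \<in> carrier R - I; b \<in> carrier R; t \<in> carrier R - I;
        a' \<in> carrier R; s' \<in> carrier R - I; b' \<in> carrier R; t' \<in> carrier R - I;
        frac a s = frac a' s'; frac b t = frac b' t'\<rbrakk> \<Longrightarrow>
        frac (num a s b t) (s \<otimes> t) = frac (num a' s' b' t') (s' \<otimes> t')"
  shows "fraction_op num R I (frac a s) (frac b t) = frac (num a s b t) (s \<otimes> t)"
  unfolding fraction_op_def
proof (rule the_equality)
  show "\<exists>a'\<in>carrier R. \<exists>s'\<in>carrier R - I. \<exists>b'\<in>carrier R. \<exists>t'\<in>carrier R - I.
      frac a s = frac a' s' \<and> frac b t = frac b' t' \<and>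
      frac (num a s b t) (s \<otimes> t) = frac (num a' s' b' t') (s' \<otimes> t')"
    using a b by blast
  fix z assume "\<exists>a'\<in>carrier R. \<exists>s'\<in>carrier R - I. \<exists>b'\<in>carrier R. \<exists>t'\<in>carrier R - I.
      frac a s = frac a' s' \<and> frac b t = frac b' t' \<and> z = frac (num a' s' b' t') (s' \<otimes> t')"
  then obtain a' s' b' t' where p: "a' \<in> carrier R" "s' \<in> carrier R - I" "b' \<in> carrier R" "t' \<in> carrier R - I"
    "frac a s = frac a' s'" "frac b t = frac b' t'" and z: "z = frac (num a' s' b' t') (s' \<otimes> t')"
    by blast
  show "z = frac (num a s b t) (s \<otimes> t)"
    unfolding z by (rule cong[OF a b p, symmetric])
qed

lemma frac_mult:
  assumes a: "a \<in> carrier R" "s \<in> carrier R - I" and b: "b \<in> carrier R" "t \<in> carrier R - I"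
  shows "frac a s \<otimes>\<^bsub>localization R I\<^esub> frac b t = frac (a \<otimes> b) (s \<otimes> t)"
proof -
  have "fraction_op (\<lambda>a s b t. a \<otimes> b) R I (frac a s) (frac b t) = frac (a \<otimes> b) (s \<otimes> t)"
  proof (rule frac_op[OF a b])
    fix a s b t a' s' b' t'
    assume in_R: "a \<in> carrier R" "s \<in> carrier R - I" "b \<in> carrier R" "t \<in> carrier R - I"
        "a' \<in> carrier R" "s' \<in> carrier R - I" "b' \<in> carrier R" "t' \<in> carrier R - I"
      and eq: "frac a s = frac a' s'" "frac b t = frac b' t'"
    from iffD1[OF frac_eq_iff[OF in_R(1,2,5,6)] eq(1)] obtain u
      where u: "u \<in> carrier R - I" "u \<otimes> (s' \<otimes> a) = u \<otimes> (s \<otimes> a')" by (rule bexE)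
    from iffD1[OF frac_eq_iff[OF in_R(3,4,7,8)] eq(2)] obtain v
      where v: "v \<in> carrier R - I" "v \<otimes> (t' \<otimes> b) = v \<otimes> (t \<otimes> b')" by (rule bexE)
    have c: "s \<in> carrier R" "s' \<in> carrier R" "t \<in> carrier R" "t' \<in> carrier R" "u \<in> carrier R"
      "v \<in> carrier R" using in_R u v by auto
    have "(u \<otimes> v) \<otimes> ((s' \<otimes> t') \<otimes> (a \<otimes> b)) = (u \<otimes> (s' \<otimes> a)) \<otimes> (v \<otimes> (t' \<otimes> b))"
      using c in_R(1,3) by algebra
    also have "\<dots> = (u \<otimes> v) \<otimes> ((s \<otimes> t) \<otimes> (a' \<otimes> b'))"
      unfolding u(2) v(2) using c in_R(5,7) by algebra
    finally show "frac (a \<otimes> b) (s \<otimes> t) = frac (a' \<otimes> b') (s' \<otimes> t')"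
      using in_R nonmemb_mult[OF u(1) v(1)] nonmemb_mult by (subst frac_eq_iff) auto
  qed auto
  then show ?thesis by (simp add: localization_def)
qed

lemma frac_add:
  assumes a: "a \<in> carrier R" "s \<in> carrier R - I" and b: "b \<in> carrier R" "t \<in> carrier R - I"
  shows "frac a s \<oplus>\<^bsub>localization R I\<^esub> frac b t = frac (a \<otimes> t \<oplus> b \<otimes> s) (s \<otimes> t)"
proof -
  have "fraction_op (\<lambda>a s b t. a \<otimes> t \<oplus> b \<otimes> s) R I (frac a s) (frac b t) =
      frac (a \<otimes> t \<oplus> b \<otimes> s) (s \<otimes> t)"
  proof (rule frac_op[OF a b])
    fix a s b t a' s' b' t'
    assume in_R: "a \<in> carrier R" "s \<in> carrier R - I" "b \<in> carrier R" "t \<in> carrier R - I"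
        "a' \<in> carrier R" "s' \<in> carrier R - I" "b' \<in> carrier R" "t' \<in> carrier R - I"
      and eq: "frac a s = frac a' s'" "frac b t = frac b' t'"
    from iffD1[OF frac_eq_iff[OF in_R(1,2,5,6)] eq(1)] obtain u
      where u: "u \<in> carrier R - I" "u \<otimes> (s' \<otimes> a) = u \<otimes> (s \<otimes> a')" by (rule bexE)
    from iffD1[OF frac_eq_iff[OF in_R(3,4,7,8)] eq(2)] obtain v
      where v: "v \<in> carrier R - I" "v \<otimes> (t' \<otimes> b) = v \<otimes> (t \<otimes> b')" by (rule bexE)
    have c: "s \<in> carrier R" "s' \<in> carrier R" "t \<in> carrier R" "t' \<in> carrier R" "u \<in> carrier R"
      "v \<in> carrier R" using in_R u v by auto
    have "(u \<otimes> v) \<otimes> ((s' \<otimes> t') \<otimes> (a \<otimes> t \<oplus> b \<otimes> s)) =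
        (u \<otimes> (s' \<otimes> a)) \<otimes> (v \<otimes> t \<otimes> t') \<oplus> (v \<otimes> (t' \<otimes> b)) \<otimes> (u \<otimes> s \<otimes> s')"
      using c in_R(1,3) by algebra
    also have "\<dots> = (u \<otimes> v) \<otimes> ((s \<otimes> t) \<otimes> (a' \<otimes> t' \<oplus> b' \<otimes> s'))"
      unfolding u(2) v(2) using c in_R(5,7) by algebra
    finally show "frac (a \<otimes> t \<oplus> b \<otimes> s) (s \<otimes> t) = frac (a' \<otimes> t' \<oplus> b' \<otimes> s') (s' \<otimes> t')"
      using in_R c nonmemb_mult[OF u(1) v(1)] nonmemb_mult by (subst frac_eq_iff) auto
  qed auto
  then show ?thesis by (simp add: localization_def)
qed

lemma localization_carrier:
  "carrier (localization R I) = {frac a s | a s. a \<in> carrier R \<and> s \<in> carrier R - I}"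
  by (simp add: localization_def)

lemma localization_one: "\<one>\<^bsub>localization R I\<^esub> = frac \<one> \<one>"
  by (simp add: localization_def)

lemma localization_zero: "\<zero>\<^bsub>localization R I\<^esub> = frac \<zero> \<one>"
  by (simp add: localization_def)

lemma frac_closed:
  "a \<in> carrier R \<Longrightarrow> s \<in> carrier R - I \<Longrightarrow> frac a s \<in> carrier (localization R I)"
  unfolding localization_carrier by blast

lemma localizationE:
  assumes "x \<in> carrier (localization R I)"
  obtains a s where "a \<in> carrier R" "s \<in> carrier R - I" "x = frac a s"
  using assms unfolding localization_carrier by blast

lemma frac_same_denominator:
  assumes "a \<in> carrier R" "b \<in> carrier R" "s \<in> carrier R - I"
  shows "frac a s \<oplus>\<^bsub>localization R I\<^esub> frac b s = frac (a \<oplus> b) s"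
  unfolding frac_add[OF assms(1,3,2,3)]
proof (rule frac_eqI)
  have s: "s \<in> carrier R" using assms(3) by simp
  show "s \<otimes> (a \<otimes> s \<oplus> b \<otimes> s) = s \<otimes> s \<otimes> (a \<oplus> b)" using assms(1,2) s by algebra
qed (use assms nonmemb_mult in auto)

text \<open>On representatives, each axiom either holds for numerators and denominators separately
  or becomes a polynomial identity after cross multiplication, so that no extra multiplier has to be
  found.\<close>

lemma localization_is_cring: "cring (localization R I)"
proof (rule cringI)
  let ?L = "localization R I"
  show "abelian_group ?L"
  proof (rule abelian_groupI)
    fix x y assume "x \<in> carrier ?L" "y \<in> carrier ?L"
    then obtain a s b t where [simp]: "x = frac a s" "y = frac b t"
      and R: "a \<in> carrier R" "s \<in> carrier R - I" "b \<in> carrier R" "t \<in> carrier R - I"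
      by (metis localizationE)
    then have c: "s \<in> carrier R" "t \<in> carrier R" by auto
    show "x \<oplus>\<^bsub>?L\<^esub> y \<in> carrier ?L"
      using R c nonmemb_mult by (simp add: frac_add frac_closed)
    have "(t \<otimes> s) \<otimes> (a \<otimes> t \<oplus> b \<otimes> s) = (s \<otimes> t) \<otimes> (b \<otimes> s \<oplus> a \<otimes> t)"
      using R(1,3) c by algebra
    then show "x \<oplus>\<^bsub>?L\<^esub> y = y \<oplus>\<^bsub>?L\<^esub> x"
      using R c nonmemb_mult by (simp add: frac_add) (rule frac_eqI; simp)
    fix z assume "z \<in> carrier ?L"
    then obtain d r where [simp]: "z = frac d r" and R': "d \<in> carrier R" "r \<in> carrier R - I"
      by (rule localizationE)
    then have c': "r \<in> carrier R" by auto
    have "(s \<otimes> (t \<otimes> r)) \<otimes> ((a \<otimes> t \<oplus> b \<otimes> s) \<otimes> r \<oplus> d \<otimes> (s \<otimes> t)) =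
        ((s \<otimes> t) \<otimes> r) \<otimes> (a \<otimes> (t \<otimes> r) \<oplus> (b \<otimes> r \<oplus> d \<otimes> t) \<otimes> s)"
      using R(1,3) c R'(1) c' by algebra
    then show "x \<oplus>\<^bsub>?L\<^esub> y \<oplus>\<^bsub>?L\<^esub> z = x \<oplus>\<^bsub>?L\<^esub> (y \<oplus>\<^bsub>?L\<^esub> z)"
      using R c R' c' nonmemb_mult by (simp add: frac_add) (rule frac_eqI; simp)
  next
    show "\<zero>\<^bsub>?L\<^esub> \<in> carrier ?L" using one_nonmemb by (simp add: localization_zero frac_closed)
  next
    fix x assume "x \<in> carrier ?L"
    then obtain a s where [simp]: "x = frac a s" and R: "a \<in> carrier R" "s \<in> carrier R - I"
      by (rule localizationE)
    show "\<zero>\<^bsub>?L\<^esub> \<oplus>\<^bsub>?L\<^esub> x = x"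
      using R one_nonmemb by (simp add: localization_zero frac_add)
    have "frac (\<ominus> a) s \<oplus>\<^bsub>?L\<^esub> x = frac \<zero> s"
      using R by (simp add: frac_same_denominator l_neg)
    also have "\<dots> = \<zero>\<^bsub>?L\<^esub>"
      unfolding localization_zero using R one_nonmemb by (intro frac_eqI) auto
    finally show "\<exists>y \<in> carrier ?L. y \<oplus>\<^bsub>?L\<^esub> x = \<zero>\<^bsub>?L\<^esub>"
      using R by (intro bexI[of _ "frac (\<ominus> a) s"] frac_closed) auto
  qed
  show "comm_monoid ?L"
  proof (rule comm_monoidI)
    show "\<one>\<^bsub>?L\<^esub> \<in> carrier ?L" using one_nonmemb by (simp add: localization_one frac_closed)
    fix x assume "x \<in> carrier ?L"
    then obtain a s where x[simp]: "x = frac a s" and R: "a \<in> carrier R" "s \<in> carrier R - I"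
      by (rule localizationE)
    then have c: "s \<in> carrier R" by auto
    show "\<one>\<^bsub>?L\<^esub> \<otimes>\<^bsub>?L\<^esub> x = x"
      using R one_nonmemb by (simp add: localization_one frac_mult)
    fix y assume "y \<in> carrier ?L"
    then obtain b t where y[simp]: "y = frac b t" and R': "b \<in> carrier R" "t \<in> carrier R - I"
      by (rule localizationE)
    then have c': "t \<in> carrier R" by auto
    show "x \<otimes>\<^bsub>?L\<^esub> y \<in> carrier ?L"
      using R R' nonmemb_mult by (simp add: frac_mult frac_closed)
    show "x \<otimes>\<^bsub>?L\<^esub> y = y \<otimes>\<^bsub>?L\<^esub> x"
      using R R' c c' by (simp add: frac_mult m_comm)
    fix z assume "z \<in> carrier ?L"
    then obtain d r where [simp]: "z = frac d r" and R'': "d \<in> carrier R" "r \<in> carrier R - I"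
      by (rule localizationE)
    then show "x \<otimes>\<^bsub>?L\<^esub> y \<otimes>\<^bsub>?L\<^esub> z = x \<otimes>\<^bsub>?L\<^esub> (y \<otimes>\<^bsub>?L\<^esub> z)"
      using R R' c c' nonmemb_mult by (simp add: frac_mult m_assoc)
  qed
  fix x y z assume "x \<in> carrier ?L" "y \<in> carrier ?L" "z \<in> carrier ?L"
  then obtain a s b t d r where [simp]: "x = frac a s" "y = frac b t" "z = frac d r"
    and R: "a \<in> carrier R" "s \<in> carrier R - I" "b \<in> carrier R" "t \<in> carrier R - I"
      "d \<in> carrier R" "r \<in> carrier R - I"
    by (metis localizationE)
  then have c: "s \<in> carrier R" "t \<in> carrier R" "r \<in> carrier R" by auto
  have "((s \<otimes> r) \<otimes> (t \<otimes> r)) \<otimes> ((a \<otimes> t \<oplus> b \<otimes> s) \<otimes> d) =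
      ((s \<otimes> t) \<otimes> r) \<otimes> ((a \<otimes> d) \<otimes> (t \<otimes> r) \<oplus> (b \<otimes> d) \<otimes> (s \<otimes> r))"
    using R(1,3,5) c by algebra
  then show "(x \<oplus>\<^bsub>?L\<^esub> y) \<otimes>\<^bsub>?L\<^esub> z = x \<otimes>\<^bsub>?L\<^esub> z \<oplus>\<^bsub>?L\<^esub> y \<otimes>\<^bsub>?L\<^esub> z"
    using R c nonmemb_mult by (simp add: frac_add frac_mult) (rule frac_eqI; simp)
qed

lemma localization_hom: "(\<lambda>a. frac a \<one>) \<in> ring_hom R (localization R I)"
  using one_nonmemb
  by (intro ring_hom_memI) (simp_all add: frac_closed frac_mult frac_same_denominator localization_one)

lemma frac_one_eq_zero_iff:
  assumes "a \<in> carrier R"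
  shows "frac a \<one> = \<zero>\<^bsub>localization R I\<^esub> \<longleftrightarrow> (\<exists>u \<in> carrier R - I. u \<otimes> a = \<zero>)"
  unfolding localization_zero using assms one_nonmemb by (subst frac_eq_iff) auto

text \<open>A vanishing fraction is killed by some u outside I, and primality of I cancels
  u.\<close>

lemma frac_one_zero_imp_mem:
  assumes "a \<in> carrier R" "frac a \<one> = \<zero>\<^bsub>localization R I\<^esub>"
  shows "a \<in> I"
proof -
  obtain u where "u \<in> carrier R - I" "u \<otimes> a = \<zero>" using assms frac_one_eq_zero_iff by blast
  then show ?thesis using I_prime[of u a] assms(1) zero_closed by auto
qed

lemma frac_inverse:
  assumes "s \<in> carrier R - I"
  shows "frac s \<one> \<otimes>\<^bsub>localization R I\<^esub> frac \<one> s = \<one>\<^bsub>localization R I\<^esub>"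
  unfolding localization_one using assms one_nonmemb
  by (simp add: frac_mult) (rule frac_eqI; simp)

end

section \<open>Lying over\<close>

lemma (in ideal) finsum_closed:
  assumes "finite A" "\<And>i. i \<in> A \<Longrightarrow> f i \<in> I"
  shows "(\<Oplus>i\<in>A. f i) \<in> I"
  using assms
proof (induction A rule: finite_induct)
  case empty
  then show ?case by simp
next
  case (insert x F)
  then have "f \<in> F \<rightarrow> carrier R" "f x \<in> carrier R" using Icarr by auto
  then show ?case using insert by (simp add: a_closed)
qed

lemma (in primeideal) nonmemb_pow: "s \<in> carrier R - I \<Longrightarrow> s [^] (n :: nat) \<in> carrier R - I"
  by (induction n) (use one_nonmemb nonmemb_mult in auto)

text \<open>Multiply the relation by the n-th power of h a and replace each product of x and h a by
  h s: the i-th term keeps n - i factors h a, the leading term keeps none. A relation for x thereby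
  becomes the image of an element of R.\<close>

lemma (in ring_hom_cring) hom_clear_denominators:
  fixes n :: nat
  assumes R: "u \<in> carrier R" "a \<in> carrier R" "s \<in> carrier R" "\<And>i. i < n \<Longrightarrow> c i \<in> carrier R"
    and x: "x \<in> carrier S" "x \<otimes>\<^bsub>S\<^esub> h a = h s"
    and rel: "h u \<otimes>\<^bsub>S\<^esub> x [^]\<^bsub>S\<^esub> n \<oplus>\<^bsub>S\<^esub> (\<Oplus>\<^bsub>S\<^esub>i\<in>{..<n}. h (c i) \<otimes>\<^bsub>S\<^esub> x [^]\<^bsub>S\<^esub> i) = \<zero>\<^bsub>S\<^esub>"
  shows "h (u \<otimes> s [^] n \<oplus> (\<Oplus>i\<in>{..<n}. c i \<otimes> (a [^] (n - i) \<otimes> s [^] i))) = \<zero>\<^bsub>S\<^esub>"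
proof -
  let ?t = "\<lambda>i. h (c i) \<otimes>\<^bsub>S\<^esub> x [^]\<^bsub>S\<^esub> i"
  have pow: "x [^]\<^bsub>S\<^esub> i \<otimes>\<^bsub>S\<^esub> h a [^]\<^bsub>S\<^esub> i = h (s [^] i)" for i :: nat
    using S.nat_pow_distrib[of x "h a" i] x R by (simp add: ring.hom_nat_pow)
  have t: "h a [^]\<^bsub>S\<^esub> n \<otimes>\<^bsub>S\<^esub> ?t i = h (c i \<otimes> (a [^] (n - i) \<otimes> s [^] i))" if "i < n" for i
  proof -
    have "h a [^]\<^bsub>S\<^esub> n = h a [^]\<^bsub>S\<^esub> (n - i) \<otimes>\<^bsub>S\<^esub> h a [^]\<^bsub>S\<^esub> i"
      using S.nat_pow_mult[of "h a" "n - i" i] that R by simp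
    then have "h a [^]\<^bsub>S\<^esub> n \<otimes>\<^bsub>S\<^esub> ?t i =
        (h a [^]\<^bsub>S\<^esub> (n - i) \<otimes>\<^bsub>S\<^esub> h a [^]\<^bsub>S\<^esub> i) \<otimes>\<^bsub>S\<^esub> (h (c i) \<otimes>\<^bsub>S\<^esub> x [^]\<^bsub>S\<^esub> i)" by simp
    also have "\<dots> = h (c i) \<otimes>\<^bsub>S\<^esub> (h a [^]\<^bsub>S\<^esub> (n - i) \<otimes>\<^bsub>S\<^esub> (x [^]\<^bsub>S\<^esub> i \<otimes>\<^bsub>S\<^esub> h a [^]\<^bsub>S\<^esub> i))"
      using that R x by (simp add: S.m_ac)
    also have "\<dots> = h (c i \<otimes> (a [^] (n - i) \<otimes> s [^] i))"
      using that R by (simp add: pow ring.hom_nat_pow)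
    finally show ?thesis .
  qed
  have tS: "?t \<in> {..<n} \<rightarrow> carrier S" using R x by auto
  have "\<zero>\<^bsub>S\<^esub> = h a [^]\<^bsub>S\<^esub> n \<otimes>\<^bsub>S\<^esub> (h u \<otimes>\<^bsub>S\<^esub> x [^]\<^bsub>S\<^esub> n \<oplus>\<^bsub>S\<^esub> (\<Oplus>\<^bsub>S\<^esub>i\<in>{..<n}. ?t i))"
    unfolding rel using R by simp
  also have "\<dots> = h a [^]\<^bsub>S\<^esub> n \<otimes>\<^bsub>S\<^esub> (h u \<otimes>\<^bsub>S\<^esub> x [^]\<^bsub>S\<^esub> n) \<oplus>\<^bsub>S\<^esub>
      (\<Oplus>\<^bsub>S\<^esub>i\<in>{..<n}. h a [^]\<^bsub>S\<^esub> n \<otimes>\<^bsub>S\<^esub> ?t i)"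
    using R x tS by (simp add: S.r_distr S.finsum_rdistr)
  also have "h a [^]\<^bsub>S\<^esub> n \<otimes>\<^bsub>S\<^esub> (h u \<otimes>\<^bsub>S\<^esub> x [^]\<^bsub>S\<^esub> n) =
      h u \<otimes>\<^bsub>S\<^esub> (x [^]\<^bsub>S\<^esub> n \<otimes>\<^bsub>S\<^esub> h a [^]\<^bsub>S\<^esub> n)"
    using R x by (simp add: S.m_ac)
  also have "\<dots> = h (u \<otimes> s [^] n)" using R by (simp add: pow)
  also have "(\<Oplus>\<^bsub>S\<^esub>i\<in>{..<n}. h a [^]\<^bsub>S\<^esub> n \<otimes>\<^bsub>S\<^esub> ?t i) =
      (\<Oplus>\<^bsub>S\<^esub>i\<in>{..<n}. h (c i \<otimes> (a [^] (n - i) \<otimes> s [^] i)))"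
    using R by (intro S.finsum_cong') (auto simp: t)
  also have "\<dots> = h (\<Oplus>i\<in>{..<n}. c i \<otimes> (a [^] (n - i) \<otimes> s [^] i))"
    using R by (subst hom_finsum) (auto simp: o_def)
  also have "h (u \<otimes> s [^] n) \<oplus>\<^bsub>S\<^esub> \<dots> =
      h (u \<otimes> s [^] n \<oplus> (\<Oplus>i\<in>{..<n}. c i \<otimes> (a [^] (n - i) \<otimes> s [^] i)))"
    using R by (intro hom_add[symmetric] R.finsum_closed) auto
  finally show ?thesis by simp
qed

lemma (in ideal) rcos_eq_zero_iff:
  assumes "x \<in> carrier R"
  shows "I +> x = \<zero>\<^bsub>R Quot I\<^esub> \<longleftrightarrow> x \<in> I"
  using assms rcos_const_imp_mem a_rcos_zero[OF is_ideal] by (auto simp: FactRing_def)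

text \<open>The hypothesis \<open>integral\<close> is a form of integrality modulo primes that can be verified on
  sections of the structure sheaves.\<close>

lemma (in ring_hom_cring) lying_over:
  assumes I: "ideal I S" and P: "primeideal P R" and IP: "contract R h I \<subseteq> P"
    and integral: "\<And>Q b. \<lbrakk>primeideal Q S; contract R h Q \<subseteq> P; b \<in> carrier S\<rbrakk> \<Longrightarrow>
      \<exists>(n :: nat) u c. u \<in> carrier R - P \<and> (\<forall>i<n. c i \<in> carrier R) \<and>
        h u \<otimes>\<^bsub>S\<^esub> b [^]\<^bsub>S\<^esub> n \<oplus>\<^bsub>S\<^esub> (\<Oplus>\<^bsub>S\<^esub>i\<in>{..<n}. h (c i) \<otimes>\<^bsub>S\<^esub> b [^]\<^bsub>S\<^esub> i) \<in> Q"
  obtains Q where "primeideal Q S" "I \<subseteq> Q" "contract R h Q = P"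
proof -
  interpret P: primeideal P R by (rule P)
  \<comment> \<open>An ideal avoiding this multiplicative set contracts into P, so only the opposite
    inclusion is at stake; the maximality of Q provides it.\<close>
  let ?T = "h ` (carrier R - P)"
  have "\<one>\<^bsub>S\<^esub> \<in> ?T" using P.one_nonmemb hom_one by force
  moreover have "s \<otimes>\<^bsub>S\<^esub> t \<in> ?T" if "s \<in> ?T" "t \<in> ?T" for s t
  proof -
    from that obtain s' t' where "s' \<in> carrier R - P" "t' \<in> carrier R - P" "s = h s'" "t = h t'" by blast
    moreover from this have "s \<otimes>\<^bsub>S\<^esub> t = h (s' \<otimes> t')" by simp
    ultimately show ?thesis using P.nonmemb_mult[of s' t'] by (metis imageI)
  qed
  moreover have "I \<inter> ?T = {}" using IP by (auto simp: contract_def)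
  ultimately obtain Q where Q: "primeideal Q S" "I \<subseteq> Q" "Q \<inter> ?T = {}"
    and max: "\<And>J. ideal J S \<Longrightarrow> Q \<subseteq> J \<Longrightarrow> J \<inter> ?T = {} \<Longrightarrow> J = Q"
    using S.prime_avoiding_mult_closed[OF I, of ?T] by metis
  interpret Q: primeideal Q S by (rule Q)
  have QP: "contract R h Q \<subseteq> P" using Q(3) by (auto simp: contract_def)
  \<comment> \<open>Otherwise maximality puts h s, for some s outside P, into Q + (h a), so h s
    agrees with b h a modulo Q. Clearing denominators in the relation for b then forces the product
    of u and a power of s into P, although u and s are outside P.\<close>
  have "a \<in> contract R h Q" if a: "a \<in> P" for a
  proof (rule ccontr)
    assume aQ: "a \<notin> contract R h Q"
    have aR: "a \<in> carrier R" using a P.Icarr by simp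
    then have ha: "h a \<in> carrier S" "h a \<notin> Q" using aQ by (auto simp: contract_def)
    let ?J = "Q <+>\<^bsub>S\<^esub> PIdl\<^bsub>S\<^esub> (h a)"
    have "?J \<inter> ?T \<noteq> {}"
      using max[OF S.ideal_add_principal(1,2)[OF Q.is_ideal ha(1)]]
        S.ideal_add_principal(3)[OF Q.is_ideal ha(1)] ha(2) by blast
    then obtain s where s: "s \<in> carrier R - P" and "h s \<in> ?J" by blast
    then obtain q z where q: "q \<in> Q" and "z \<in> PIdl\<^bsub>S\<^esub> (h a)" "h s = q \<oplus>\<^bsub>S\<^esub> z"
      unfolding set_add_def' by blast
    then obtain b where b: "b \<in> carrier S" and eq: "h s = q \<oplus>\<^bsub>S\<^esub> b \<otimes>\<^bsub>S\<^esub> h a"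
      unfolding cgenideal_def by blast
    obtain n u c where u: "u \<in> carrier R - P" and c: "\<And>i. i < (n :: nat) \<Longrightarrow> c i \<in> carrier R"
      and rel: "h u \<otimes>\<^bsub>S\<^esub> b [^]\<^bsub>S\<^esub> n \<oplus>\<^bsub>S\<^esub> (\<Oplus>\<^bsub>S\<^esub>i\<in>{..<n}. h (c i) \<otimes>\<^bsub>S\<^esub> b [^]\<^bsub>S\<^esub> i) \<in> Q"
      using integral[OF Q(1) QP b] by blast
    let ?D = "S Quot Q"
    interpret D: ring_hom_cring S ?D "(+>\<^bsub>S\<^esub>) Q" by (rule Q.rcos_ring_hom_cring)
    interpret \<psi>: ring_hom_cring R ?D "\<lambda>a. Q +>\<^bsub>S\<^esub> h a"
      by unfold_locales (auto intro!: ring_hom_memI)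
    have uR: "u \<in> carrier R" "s \<in> carrier R" using u s by auto
    have "Q +>\<^bsub>S\<^esub> h s = (Q +>\<^bsub>S\<^esub> q) \<oplus>\<^bsub>?D\<^esub> (Q +>\<^bsub>S\<^esub> b) \<otimes>\<^bsub>?D\<^esub> (Q +>\<^bsub>S\<^esub> h a)"
      unfolding eq using q b ha Q.Icarr by simp
    also have "Q +>\<^bsub>S\<^esub> q = \<zero>\<^bsub>?D\<^esub>" using q Q.Icarr by (simp add: Q.rcos_eq_zero_iff)
    finally have xa: "(Q +>\<^bsub>S\<^esub> b) \<otimes>\<^bsub>?D\<^esub> (Q +>\<^bsub>S\<^esub> h a) = Q +>\<^bsub>S\<^esub> h s"
      using b ha by simp
    have fS: "(\<lambda>i. h (c i) \<otimes>\<^bsub>S\<^esub> b [^]\<^bsub>S\<^esub> i) \<in> {..<n} \<rightarrow> carrier S" using c b by auto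
    have "\<zero>\<^bsub>?D\<^esub> = Q +>\<^bsub>S\<^esub> (h u \<otimes>\<^bsub>S\<^esub> b [^]\<^bsub>S\<^esub> n \<oplus>\<^bsub>S\<^esub> (\<Oplus>\<^bsub>S\<^esub>i\<in>{..<n}. h (c i) \<otimes>\<^bsub>S\<^esub> b [^]\<^bsub>S\<^esub> i))"
      by (rule Q.rcos_eq_zero_iff[OF Q.Icarr[OF rel], THEN iffD2, OF rel, symmetric])
    also have "\<dots> = (Q +>\<^bsub>S\<^esub> h u) \<otimes>\<^bsub>?D\<^esub> (Q +>\<^bsub>S\<^esub> b) [^]\<^bsub>?D\<^esub> n \<oplus>\<^bsub>?D\<^esub>
        (Q +>\<^bsub>S\<^esub> (\<Oplus>\<^bsub>S\<^esub>i\<in>{..<n}. h (c i) \<otimes>\<^bsub>S\<^esub> b [^]\<^bsub>S\<^esub> i))"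
      using uR b fS by (simp add: D.ring.hom_nat_pow)
    also have "Q +>\<^bsub>S\<^esub> (\<Oplus>\<^bsub>S\<^esub>i\<in>{..<n}. h (c i) \<otimes>\<^bsub>S\<^esub> b [^]\<^bsub>S\<^esub> i) =
        (\<Oplus>\<^bsub>?D\<^esub>i\<in>{..<n}. (Q +>\<^bsub>S\<^esub> h (c i)) \<otimes>\<^bsub>?D\<^esub> (Q +>\<^bsub>S\<^esub> b) [^]\<^bsub>?D\<^esub> i)"
      unfolding D.hom_finsum[OF fS]
      using c b by (intro D.S.finsum_cong') (auto simp: D.ring.hom_nat_pow)
    finally have "(Q +>\<^bsub>S\<^esub> h u) \<otimes>\<^bsub>?D\<^esub> (Q +>\<^bsub>S\<^esub> b) [^]\<^bsub>?D\<^esub> n \<oplus>\<^bsub>?D\<^esub>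
        (\<Oplus>\<^bsub>?D\<^esub>i\<in>{..<n}. (Q +>\<^bsub>S\<^esub> h (c i)) \<otimes>\<^bsub>?D\<^esub> (Q +>\<^bsub>S\<^esub> b) [^]\<^bsub>?D\<^esub> i) = \<zero>\<^bsub>?D\<^esub>" by simp
    from \<psi>.hom_clear_denominators[OF uR(1) aR uR(2) c D.hom_closed[OF b] xa this]
    have z: "Q +>\<^bsub>S\<^esub> h (u \<otimes> s [^] n \<oplus> (\<Oplus>i\<in>{..<n}. c i \<otimes> (a [^] (n - i) \<otimes> s [^] i))) = \<zero>\<^bsub>?D\<^esub>"
      (is "Q +>\<^bsub>S\<^esub> h (_ \<oplus> ?sum) = _") .
    \<comment> \<open>The exponent is positive because i < n, so every term below the leading one
      contains a factor a.\<close>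
    have aP: "a [^] (n - i) \<in> P" if "i < n" for i
    proof -
      have "n - i = Suc (n - i - 1)" using that by simp
      then have "a [^] (n - i) = a [^] (n - i - 1) \<otimes> a" using R.nat_pow_Suc by metis
      then show ?thesis using a aR by (simp add: P.I_l_closed)
    qed
    have sum: "?sum \<in> P"
      using c aP uR by (intro P.finsum_closed) (simp_all add: P.I_l_closed P.I_r_closed)
    have us: "u \<otimes> s [^] n \<in> carrier R - P"
      using u P.nonmemb_pow[OF s] by (intro P.nonmemb_mult) auto
    have eR: "u \<otimes> s [^] n \<oplus> ?sum \<in> carrier R" using us P.Icarr[OF sum] by simp
    have "u \<otimes> s [^] n \<oplus> ?sum \<in> contract R h Q"
      unfolding contract_def
      by (intro CollectI conjI eR iffD1[OF Q.rcos_eq_zero_iff[OF hom_closed[OF eR]] z])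
    then have inP: "u \<otimes> s [^] n \<oplus> ?sum \<in> P" using QP by blast
    have "u \<otimes> s [^] n = (u \<otimes> s [^] n \<oplus> ?sum) \<oplus> \<ominus> ?sum"
      using us sum P.Icarr by (simp add: R.a_assoc R.r_neg)
    also have "\<dots> \<in> P" by (rule P.a_closed[OF inP P.a_inv_closed[OF sum]])
    finally show False using us by simp
  qed
  then have "contract R h Q = P" using QP by blast
  then show thesis using that Q by blast
qed

section \<open>Primes of a tensor product with prescribed contractions\<close>

section \<open>Points of the fibre product\<close>

subsection \<open>Linear functionals\<close>

text \<open>A maximal saturated submodule \<open>M\<close> containing \<open>Q\<close> but not \<open>s\<close> is the kernel of the
  functional: modulo \<open>M\<close>, every \<open>b\<close> has a nonzero multiple in \<open>R s\<close>.\<close>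

lemma (in ring_hom_cring) linear_functional:
  fixes L :: "('l, 'k) ring_scheme"
  assumes Q: "primeideal Q S" and s: "s \<in> carrier S - Q"
    and L: "ring_hom_cring R L \<psi>"
    and unit: "\<And>a. a \<in> carrier R \<Longrightarrow> h a \<notin> Q \<Longrightarrow> \<psi> a \<in> Units L"
    and zero: "\<And>a. a \<in> carrier R \<Longrightarrow> h a \<in> Q \<Longrightarrow> \<psi> a = \<zero>\<^bsub>L\<^esub>"
  obtains l where "l \<in> carrier S \<rightarrow> carrier L"
    "\<And>x y. \<lbrakk>x \<in> carrier S; y \<in> carrier S\<rbrakk> \<Longrightarrow> l (x \<oplus>\<^bsub>S\<^esub> y) = l x \<oplus>\<^bsub>L\<^esub> l y"
    "\<And>a x. \<lbrakk>a \<in> carrier R; x \<in> carrier S\<rbrakk> \<Longrightarrow> l (h a \<otimes>\<^bsub>S\<^esub> x) = \<psi> a \<otimes>\<^bsub>L\<^esub> l x"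
    "\<And>x. x \<in> Q \<Longrightarrow> l x = \<zero>\<^bsub>L\<^esub>" "l s = \<one>\<^bsub>L\<^esub>"
proof -
  interpret Q: primeideal Q S by (rule Q)
  interpret \<psi>: ring_hom_cring R L \<psi> by (rule L)
  let ?N = "{a \<in> carrier R. h a \<notin> Q}"
  have N_mult: "a \<otimes> b \<in> ?N" if "a \<in> ?N" "b \<in> ?N" for a b
    using that Q.nonmemb_mult[of "h a" "h b"] by auto
  have N_one: "\<one> \<in> ?N" using Q.one_nonmemb by auto
  \<comment> \<open>Submodules containing Q and closed under division by \<open>?N\<close>
    correspond to subspaces of the vector space that S / Q generates over the residue field at the
    contraction of Q. Saturation makes it possible to argue in S without building that
    space.\<close>
  define sat where "sat M \<longleftrightarrow> Q \<subseteq> M \<and> M \<subseteq> carrier S \<and> (\<forall>x\<in>M. \<forall>y\<in>M. x \<oplus>\<^bsub>S\<^esub> y \<in> M) \<and>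
      (\<forall>a\<in>carrier R. \<forall>x\<in>M. h a \<otimes>\<^bsub>S\<^esub> x \<in> M) \<and>
      (\<forall>a\<in>?N. \<forall>x\<in>carrier S. h a \<otimes>\<^bsub>S\<^esub> x \<in> M \<longrightarrow> x \<in> M)" for M
  have satD: "Q \<subseteq> M" "M \<subseteq> carrier S" "\<And>x y. x \<in> M \<Longrightarrow> y \<in> M \<Longrightarrow> x \<oplus>\<^bsub>S\<^esub> y \<in> M"
      "\<And>a x. a \<in> carrier R \<Longrightarrow> x \<in> M \<Longrightarrow> h a \<otimes>\<^bsub>S\<^esub> x \<in> M"
      "\<And>a x. a \<in> ?N \<Longrightarrow> x \<in> carrier S \<Longrightarrow> h a \<otimes>\<^bsub>S\<^esub> x \<in> M \<Longrightarrow> x \<in> M" if M: "sat M" for M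
  proof -
    note c2 = M[unfolded sat_def, THEN conjunct2]
    show "Q \<subseteq> M" by (rule conjunct1[OF M[unfolded sat_def]])
    show "M \<subseteq> carrier S" by (rule conjunct1[OF c2])
    show "x \<oplus>\<^bsub>S\<^esub> y \<in> M" if "x \<in> M" "y \<in> M" for x y
      by (rule c2[THEN conjunct2, THEN conjunct1, rule_format, OF that])
    show "h a \<otimes>\<^bsub>S\<^esub> x \<in> M" if "a \<in> carrier R" "x \<in> M" for a x
      by (rule c2[THEN conjunct2, THEN conjunct2, THEN conjunct1, rule_format, OF that])
    show "x \<in> M" if "a \<in> ?N" "x \<in> carrier S" "h a \<otimes>\<^bsub>S\<^esub> x \<in> M" for a x
      by (rule c2[THEN conjunct2, THEN conjunct2, THEN conjunct2, THEN bspec, THEN bspec, THEN mp, OF that])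
  qed
  have satI: "sat M" if "Q \<subseteq> M" "M \<subseteq> carrier S" "\<And>x y. x \<in> M \<Longrightarrow> y \<in> M \<Longrightarrow> x \<oplus>\<^bsub>S\<^esub> y \<in> M"
      "\<And>a x. a \<in> carrier R \<Longrightarrow> x \<in> M \<Longrightarrow> h a \<otimes>\<^bsub>S\<^esub> x \<in> M"
      "\<And>a x. a \<in> ?N \<Longrightarrow> x \<in> carrier S \<Longrightarrow> h a \<otimes>\<^bsub>S\<^esub> x \<in> M \<Longrightarrow> x \<in> M" for M
    unfolding sat_def by (intro conjI ballI impI; (erule (2) that | erule (1) that | rule that))
  let ?\<M> = "{M. sat M \<and> s \<notin> M}"
  have "\<exists>M\<in>?\<M>. \<forall>X\<in>?\<M>. M \<subseteq> X \<longrightarrow> X = M"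
  proof (rule subset_Zorn_nonempty)
    have "sat Q"
    proof (rule satI)
      fix a x assume "a \<in> ?N" "x \<in> carrier S" "h a \<otimes>\<^bsub>S\<^esub> x \<in> Q"
      then show "x \<in> Q" using Q.I_prime[of "h a" x] by auto
    qed (auto intro: Q.a_closed Q.I_l_closed Q.Icarr)
    then show "?\<M> \<noteq> {}" using s by blast
    fix \<C> assume ne: "\<C> \<noteq> {}" and ch: "subset.chain ?\<M> \<C>"
    then have sub: "\<And>M. M \<in> \<C> \<Longrightarrow> sat M \<and> s \<notin> M"
      and lin: "\<And>A B. A \<in> \<C> \<Longrightarrow> B \<in> \<C> \<Longrightarrow> A \<subseteq> B \<or> B \<subseteq> A"
      unfolding subset_chain_def by blast+
    have "sat (\<Union>\<C>)"
    proof (rule satI)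
      show "Q \<subseteq> \<Union>\<C>" using ne sub satD(1) by blast
      show "\<Union>\<C> \<subseteq> carrier S" using sub satD(2) by blast
      fix x y assume "x \<in> \<Union>\<C>" "y \<in> \<Union>\<C>"
      then obtain A B where "A \<in> \<C>" "B \<in> \<C>" "x \<in> A" "y \<in> B" by blast
      then obtain C where "C \<in> \<C>" "x \<in> C" "y \<in> C" using lin[of A B] by blast
      then show "x \<oplus>\<^bsub>S\<^esub> y \<in> \<Union>\<C>" using sub[of C] satD(3)[of C] by blast
    next
      fix a x assume "a \<in> carrier R" "x \<in> \<Union>\<C>"
      then show "h a \<otimes>\<^bsub>S\<^esub> x \<in> \<Union>\<C>" using sub satD(4) by blast
    next
      fix a x assume ax: "a \<in> ?N" "x \<in> carrier S" "h a \<otimes>\<^bsub>S\<^esub> x \<in> \<Union>\<C>"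
      then obtain C where "C \<in> \<C>" "h a \<otimes>\<^bsub>S\<^esub> x \<in> C" by blast
      then show "x \<in> \<Union>\<C>" using sub[of C] satD(5)[of C a x] ax by blast
    qed
    then show "\<Union>\<C> \<in> ?\<M>" using sub by blast
  qed
  then obtain M where "M \<in> ?\<M>" and max: "\<forall>X\<in>?\<M>. M \<subseteq> X \<longrightarrow> X = M" by (rule bexE)
  then have M: "sat M" "s \<notin> M" by auto
  note MD = satD[OF M(1)]
  have M_neg: "\<ominus>\<^bsub>S\<^esub> x \<in> M" if "x \<in> M" for x
  proof -
    have "h (\<ominus> \<one>) \<otimes>\<^bsub>S\<^esub> x = \<ominus>\<^bsub>S\<^esub> x" using that MD(2) by (simp add: S.l_minus subset_iff)
    then show ?thesis using MD(4)[of "\<ominus> \<one>" x] that by simp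
  qed
  have M_minus: "x \<ominus>\<^bsub>S\<^esub> y \<in> M" if "x \<in> M" "y \<in> M" for x y
    using that MD(3) M_neg by (simp add: S.minus_eq)
  \<comment> \<open>Here z is the quotient of \<open>\<psi> a\<close> by \<open>\<psi> d\<close>,
    where modulo \<open>M\<close> the multiple of b by d equals the multiple of s by a;
    \<open>\<psi> d\<close> is a unit because d is in \<open>?N\<close>.\<close>
  define rel where "rel b z \<longleftrightarrow> z \<in> carrier L \<and> (\<exists>a\<in>carrier R. \<exists>d\<in>?N.
      h d \<otimes>\<^bsub>S\<^esub> b \<ominus>\<^bsub>S\<^esub> h a \<otimes>\<^bsub>S\<^esub> s \<in> M \<and> \<psi> d \<otimes>\<^bsub>L\<^esub> z = \<psi> a)" for b z
  have relI: "rel b z" if "z \<in> carrier L" "a \<in> carrier R" "d \<in> ?N"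
      "h d \<otimes>\<^bsub>S\<^esub> b \<ominus>\<^bsub>S\<^esub> h a \<otimes>\<^bsub>S\<^esub> s \<in> M" "\<psi> d \<otimes>\<^bsub>L\<^esub> z = \<psi> a" for a d b z
    using that unfolding rel_def by blast
  have sS: "s \<in> carrier S" using s by simp
  have cancel: "x = y" if "d \<in> ?N" "x \<in> carrier L" "y \<in> carrier L" "\<psi> d \<otimes>\<^bsub>L\<^esub> x = \<psi> d \<otimes>\<^bsub>L\<^esub> y" for d x y
  proof -
    have u: "\<psi> d \<in> Units L" using unit that by simp
    then show ?thesis using that by (simp add: \<psi>.S.Units_l_cancel)
  qed
  have ex: "\<exists>z. rel b z" if b: "b \<in> carrier S" for b
  proof -
    have "\<exists>a\<in>carrier R. \<exists>d\<in>?N. h d \<otimes>\<^bsub>S\<^esub> b \<ominus>\<^bsub>S\<^esub> h a \<otimes>\<^bsub>S\<^esub> s \<in> M"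
    proof (cases "b \<in> M")
      case True
      have "h \<one> \<otimes>\<^bsub>S\<^esub> b \<ominus>\<^bsub>S\<^esub> h \<zero> \<otimes>\<^bsub>S\<^esub> s = b" using b sS by (simp add: S.minus_eq)
      then show ?thesis using True N_one by (intro bexI[of _ \<zero>] bexI[of _ \<one>]) auto
    next
      case False
      \<comment> \<open>This is the saturation of M + Rb. It is strictly larger than M, so it
        contains s by maximality, which yields a relation between s and b. The coefficient of b in
        it cannot map into Q, since otherwise s would already lie in M.\<close>
      define M' where "M' = {x \<in> carrier S. \<exists>a\<in>carrier R. \<exists>d\<in>?N. h d \<otimes>\<^bsub>S\<^esub> x \<ominus>\<^bsub>S\<^esub> h a \<otimes>\<^bsub>S\<^esub> b \<in> M}"
      have MM': "M \<subseteq> M'"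
      proof
        fix x assume x: "x \<in> M"
        then have "h \<one> \<otimes>\<^bsub>S\<^esub> x \<ominus>\<^bsub>S\<^esub> h \<zero> \<otimes>\<^bsub>S\<^esub> b \<in> M" using b MD(2) by (simp add: S.minus_eq subset_iff)
        then show "x \<in> M'" using x MD(2) N_one unfolding M'_def by blast
      qed
      have "h \<one> \<otimes>\<^bsub>S\<^esub> b \<ominus>\<^bsub>S\<^esub> h \<one> \<otimes>\<^bsub>S\<^esub> b \<in> M"
        using b MD(1) Q.zero_closed by (simp add: S.minus_eq S.r_neg subset_iff)
      then have bM': "b \<in> M'" using b N_one unfolding M'_def by blast
      have "sat M'"
      proof (rule satI)
        show "Q \<subseteq> M'" using MD(1) MM' by blast
        show "M' \<subseteq> carrier S" unfolding M'_def by blast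
        fix x y assume "x \<in> M'" "y \<in> M'"
        then obtain a d a' d' where x: "x \<in> carrier S" "a \<in> carrier R" "d \<in> ?N" "h d \<otimes>\<^bsub>S\<^esub> x \<ominus>\<^bsub>S\<^esub> h a \<otimes>\<^bsub>S\<^esub> b \<in> M"
          and y: "y \<in> carrier S" "a' \<in> carrier R" "d' \<in> ?N" "h d' \<otimes>\<^bsub>S\<^esub> y \<ominus>\<^bsub>S\<^esub> h a' \<otimes>\<^bsub>S\<^esub> b \<in> M"
          unfolding M'_def by blast
        have dd: "h d \<in> carrier S" "h d' \<in> carrier S" "h a \<in> carrier S" "h a' \<in> carrier S"
          "d \<in> carrier R" "d' \<in> carrier R" using x y by auto
        have "h d' \<otimes>\<^bsub>S\<^esub> (h d \<otimes>\<^bsub>S\<^esub> x \<ominus>\<^bsub>S\<^esub> h a \<otimes>\<^bsub>S\<^esub> b) \<oplus>\<^bsub>S\<^esub> h d \<otimes>\<^bsub>S\<^esub> (h d' \<otimes>\<^bsub>S\<^esub> y \<ominus>\<^bsub>S\<^esub> h a' \<otimes>\<^bsub>S\<^esub> b) \<in> M"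
          using x y dd by (intro MD(3,4)) auto
        also have "h d' \<otimes>\<^bsub>S\<^esub> (h d \<otimes>\<^bsub>S\<^esub> x \<ominus>\<^bsub>S\<^esub> h a \<otimes>\<^bsub>S\<^esub> b) \<oplus>\<^bsub>S\<^esub> h d \<otimes>\<^bsub>S\<^esub> (h d' \<otimes>\<^bsub>S\<^esub> y \<ominus>\<^bsub>S\<^esub> h a' \<otimes>\<^bsub>S\<^esub> b) =
            (h d \<otimes>\<^bsub>S\<^esub> h d') \<otimes>\<^bsub>S\<^esub> (x \<oplus>\<^bsub>S\<^esub> y) \<ominus>\<^bsub>S\<^esub> (h a \<otimes>\<^bsub>S\<^esub> h d' \<oplus>\<^bsub>S\<^esub> h a' \<otimes>\<^bsub>S\<^esub> h d) \<otimes>\<^bsub>S\<^esub> b"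
          using x(1) y(1) dd(1-4) b by (simp only: S.minus_eq) algebra
        also have "\<dots> = h (d \<otimes> d') \<otimes>\<^bsub>S\<^esub> (x \<oplus>\<^bsub>S\<^esub> y) \<ominus>\<^bsub>S\<^esub> h (a \<otimes> d' \<oplus> a' \<otimes> d) \<otimes>\<^bsub>S\<^esub> b"
          using x y dd by simp
        finally show "x \<oplus>\<^bsub>S\<^esub> y \<in> M'"
          using x y dd N_mult[OF x(3) y(3)] unfolding M'_def by blast
      next
        fix r x assume r: "r \<in> carrier R" and "x \<in> M'"
        then obtain a d where x: "x \<in> carrier S" "a \<in> carrier R" "d \<in> ?N" "h d \<otimes>\<^bsub>S\<^esub> x \<ominus>\<^bsub>S\<^esub> h a \<otimes>\<^bsub>S\<^esub> b \<in> M"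
          unfolding M'_def by blast
        have dd: "h d \<in> carrier S" "h a \<in> carrier S" "h r \<in> carrier S" using x r by auto
        have "h r \<otimes>\<^bsub>S\<^esub> (h d \<otimes>\<^bsub>S\<^esub> x \<ominus>\<^bsub>S\<^esub> h a \<otimes>\<^bsub>S\<^esub> b) \<in> M" using x r by (intro MD(4))
        also have "h r \<otimes>\<^bsub>S\<^esub> (h d \<otimes>\<^bsub>S\<^esub> x \<ominus>\<^bsub>S\<^esub> h a \<otimes>\<^bsub>S\<^esub> b) = h d \<otimes>\<^bsub>S\<^esub> (h r \<otimes>\<^bsub>S\<^esub> x) \<ominus>\<^bsub>S\<^esub> (h r \<otimes>\<^bsub>S\<^esub> h a) \<otimes>\<^bsub>S\<^esub> b"
          using x(1) dd b by (simp only: S.minus_eq) algebra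
        also have "\<dots> = h d \<otimes>\<^bsub>S\<^esub> (h r \<otimes>\<^bsub>S\<^esub> x) \<ominus>\<^bsub>S\<^esub> h (r \<otimes> a) \<otimes>\<^bsub>S\<^esub> b" using x r by simp
        finally show "h r \<otimes>\<^bsub>S\<^esub> x \<in> M'" using x r dd unfolding M'_def by blast
      next
        fix r x assume r: "r \<in> ?N" and xS: "x \<in> carrier S" and "h r \<otimes>\<^bsub>S\<^esub> x \<in> M'"
        then obtain a d where x: "a \<in> carrier R" "d \<in> ?N" "h d \<otimes>\<^bsub>S\<^esub> (h r \<otimes>\<^bsub>S\<^esub> x) \<ominus>\<^bsub>S\<^esub> h a \<otimes>\<^bsub>S\<^esub> b \<in> M"
          unfolding M'_def by blast
        have "h d \<otimes>\<^bsub>S\<^esub> (h r \<otimes>\<^bsub>S\<^esub> x) = h (d \<otimes> r) \<otimes>\<^bsub>S\<^esub> x" using x r xS by (simp add: S.m_assoc)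
        then show "x \<in> M'" using x xS N_mult[OF x(2) r] unfolding M'_def by auto
      qed
      moreover have "M' \<noteq> M" using bM' False by blast
      ultimately have "s \<in> M'" using max MM' by blast
      then obtain a d where ad: "a \<in> carrier R" "d \<in> ?N" "h d \<otimes>\<^bsub>S\<^esub> s \<ominus>\<^bsub>S\<^esub> h a \<otimes>\<^bsub>S\<^esub> b \<in> M"
        unfolding M'_def by blast
      have dd: "h d \<in> carrier S" "h a \<in> carrier S" using ad by auto
      have aN: "a \<in> ?N"
      proof (rule ccontr)
        assume "a \<notin> ?N"
        then have "h a \<otimes>\<^bsub>S\<^esub> b \<in> M" using ad(1) b MD(1) Q.I_r_closed by blast
        then have "(h d \<otimes>\<^bsub>S\<^esub> s \<ominus>\<^bsub>S\<^esub> h a \<otimes>\<^bsub>S\<^esub> b) \<oplus>\<^bsub>S\<^esub> h a \<otimes>\<^bsub>S\<^esub> b \<in> M" using ad(3) by (intro MD(3))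
        also have "(h d \<otimes>\<^bsub>S\<^esub> s \<ominus>\<^bsub>S\<^esub> h a \<otimes>\<^bsub>S\<^esub> b) \<oplus>\<^bsub>S\<^esub> h a \<otimes>\<^bsub>S\<^esub> b = h d \<otimes>\<^bsub>S\<^esub> s"
          using dd b sS by (simp only: S.minus_eq) algebra
        finally show False using MD(5)[OF ad(2) sS] M(2) by blast
      qed
      have "\<ominus>\<^bsub>S\<^esub> (h d \<otimes>\<^bsub>S\<^esub> s \<ominus>\<^bsub>S\<^esub> h a \<otimes>\<^bsub>S\<^esub> b) \<in> M" by (rule M_neg[OF ad(3)])
      also have "\<ominus>\<^bsub>S\<^esub> (h d \<otimes>\<^bsub>S\<^esub> s \<ominus>\<^bsub>S\<^esub> h a \<otimes>\<^bsub>S\<^esub> b) = h a \<otimes>\<^bsub>S\<^esub> b \<ominus>\<^bsub>S\<^esub> h d \<otimes>\<^bsub>S\<^esub> s"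
        using dd b sS by (simp only: S.minus_eq) algebra
      finally show ?thesis using aN ad(2) by blast
    qed
    then obtain a d where ad: "a \<in> carrier R" "d \<in> ?N" "h d \<otimes>\<^bsub>S\<^esub> b \<ominus>\<^bsub>S\<^esub> h a \<otimes>\<^bsub>S\<^esub> s \<in> M" by blast
    have u: "\<psi> d \<in> Units L" using unit ad(2) by simp
    have "\<psi> d \<otimes>\<^bsub>L\<^esub> (inv\<^bsub>L\<^esub> \<psi> d \<otimes>\<^bsub>L\<^esub> \<psi> a) = \<psi> a"
      using u ad \<psi>.S.Units_inv_closed[OF u] by (simp add: \<psi>.S.m_assoc[symmetric])
    then have "rel b (inv\<^bsub>L\<^esub> \<psi> d \<otimes>\<^bsub>L\<^esub> \<psi> a)"
      using ad u by (intro relI[of _ a d]) auto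
    then show ?thesis by blast
  qed
  \<comment> \<open>Eliminating b from two such relations leaves a multiple of s in M. As M is
    saturated and misses s, the coefficient is mapped into Q by h, hence to zero by \<psi>, and the
    two quotients agree.\<close>
  have uniq: "z = z'" if zz: "rel b z" "rel b z'" and b: "b \<in> carrier S" for b z z'
  proof -
    obtain a d where ad: "z \<in> carrier L" "a \<in> carrier R" "d \<in> ?N" "h d \<otimes>\<^bsub>S\<^esub> b \<ominus>\<^bsub>S\<^esub> h a \<otimes>\<^bsub>S\<^esub> s \<in> M"
      "\<psi> d \<otimes>\<^bsub>L\<^esub> z = \<psi> a" using zz(1) unfolding rel_def by blast
    obtain a' d' where ad': "z' \<in> carrier L" "a' \<in> carrier R" "d' \<in> ?N" "h d' \<otimes>\<^bsub>S\<^esub> b \<ominus>\<^bsub>S\<^esub> h a' \<otimes>\<^bsub>S\<^esub> s \<in> M"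
      "\<psi> d' \<otimes>\<^bsub>L\<^esub> z' = \<psi> a'" using zz(2) unfolding rel_def by blast
    have dd: "h d \<in> carrier S" "h a \<in> carrier S" "h d' \<in> carrier S" "h a' \<in> carrier S"
      "d \<in> carrier R" "d' \<in> carrier R" using ad ad' by auto
    have "h d \<otimes>\<^bsub>S\<^esub> (h d' \<otimes>\<^bsub>S\<^esub> b \<ominus>\<^bsub>S\<^esub> h a' \<otimes>\<^bsub>S\<^esub> s) \<ominus>\<^bsub>S\<^esub> h d' \<otimes>\<^bsub>S\<^esub> (h d \<otimes>\<^bsub>S\<^esub> b \<ominus>\<^bsub>S\<^esub> h a \<otimes>\<^bsub>S\<^esub> s) \<in> M"
      by (rule M_minus[OF MD(4)[OF dd(5) ad'(4)] MD(4)[OF dd(6) ad(4)]])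
    also have "h d \<otimes>\<^bsub>S\<^esub> (h d' \<otimes>\<^bsub>S\<^esub> b \<ominus>\<^bsub>S\<^esub> h a' \<otimes>\<^bsub>S\<^esub> s) \<ominus>\<^bsub>S\<^esub> h d' \<otimes>\<^bsub>S\<^esub> (h d \<otimes>\<^bsub>S\<^esub> b \<ominus>\<^bsub>S\<^esub> h a \<otimes>\<^bsub>S\<^esub> s) =
        (h d' \<otimes>\<^bsub>S\<^esub> h a \<ominus>\<^bsub>S\<^esub> h d \<otimes>\<^bsub>S\<^esub> h a') \<otimes>\<^bsub>S\<^esub> s"
      using dd(1-4) b sS by (simp only: S.minus_eq) algebra
    also have "\<dots> = h (d' \<otimes> a \<ominus> d \<otimes> a') \<otimes>\<^bsub>S\<^esub> s" using ad ad' dd by (simp add: R.minus_eq S.minus_eq)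
    finally have "d' \<otimes> a \<ominus> d \<otimes> a' \<notin> ?N" using MD(5)[OF _ sS] M(2) by blast
    then have "\<psi> (d' \<otimes> a \<ominus> d \<otimes> a') = \<zero>\<^bsub>L\<^esub>" using zero[of "d' \<otimes> a \<ominus> d \<otimes> a'"] ad ad' dd by auto
    then have "\<psi> d' \<otimes>\<^bsub>L\<^esub> \<psi> a \<ominus>\<^bsub>L\<^esub> \<psi> d \<otimes>\<^bsub>L\<^esub> \<psi> a' = \<zero>\<^bsub>L\<^esub>"
      using ad(2) ad'(2) dd by (simp add: R.minus_eq \<psi>.S.minus_eq)
    then have eq: "\<psi> d' \<otimes>\<^bsub>L\<^esub> \<psi> a = \<psi> d \<otimes>\<^bsub>L\<^esub> \<psi> a'"
      using ad(2) ad'(2) dd by (simp add: \<psi>.S.r_right_minus_eq)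
    have \<psi>dd: "\<psi> d \<in> carrier L" "\<psi> d' \<in> carrier L" using dd by auto
    have "\<psi> d \<otimes>\<^bsub>L\<^esub> (\<psi> d' \<otimes>\<^bsub>L\<^esub> z) = \<psi> d' \<otimes>\<^bsub>L\<^esub> (\<psi> d \<otimes>\<^bsub>L\<^esub> z)"
      by (rule \<psi>.S.m_lcomm[OF \<psi>dd ad(1)])
    also have "\<dots> = \<psi> d \<otimes>\<^bsub>L\<^esub> (\<psi> d' \<otimes>\<^bsub>L\<^esub> z')" by (simp only: ad(5) ad'(5) eq)
    finally have *: "\<psi> d \<otimes>\<^bsub>L\<^esub> (\<psi> d' \<otimes>\<^bsub>L\<^esub> z) = \<psi> d \<otimes>\<^bsub>L\<^esub> (\<psi> d' \<otimes>\<^bsub>L\<^esub> z')" .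
    have "\<psi> d' \<otimes>\<^bsub>L\<^esub> z = \<psi> d' \<otimes>\<^bsub>L\<^esub> z'"
      using \<psi>dd(2) ad(1) ad'(1) by (intro cancel[OF ad(3) _ _ *] \<psi>.S.m_closed)
    then show ?thesis by (rule cancel[OF ad'(3) ad(1) ad'(1)])
  qed
  define l where "l b = (SOME z. rel b z)" for b
  have l: "rel b (l b)" if "b \<in> carrier S" for b
    unfolding l_def by (rule someI_ex[OF ex[OF that]])
  have l_eq: "l b = z" if "rel b z" "b \<in> carrier S" for b z
    using uniq l that by blast
  show thesis
  proof (rule that[of l])
    show "l \<in> carrier S \<rightarrow> carrier L" using l unfolding rel_def by blast
    show "l s = \<one>\<^bsub>L\<^esub>"
    proof (rule l_eq[OF _ sS])
      have "h \<one> \<otimes>\<^bsub>S\<^esub> s \<ominus>\<^bsub>S\<^esub> h \<one> \<otimes>\<^bsub>S\<^esub> s \<in> M"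
        using sS MD(1) Q.zero_closed by (simp add: S.minus_eq S.r_neg subset_iff)
      then show "rel s \<one>\<^bsub>L\<^esub>" using N_one by (intro relI[of _ \<one> \<one>]) auto
    qed
    show "l x = \<zero>\<^bsub>L\<^esub>" if x: "x \<in> Q" for x
    proof (rule l_eq)
      show xS: "x \<in> carrier S" using x Q.Icarr by simp
      have "h \<one> \<otimes>\<^bsub>S\<^esub> x \<ominus>\<^bsub>S\<^esub> h \<zero> \<otimes>\<^bsub>S\<^esub> s \<in> M"
        using xS sS MD(1) x by (simp add: S.minus_eq subset_iff)
      then show "rel x \<zero>\<^bsub>L\<^esub>" using N_one by (intro relI[of _ \<zero> \<one>]) auto
    qed
    show "l (x \<oplus>\<^bsub>S\<^esub> y) = l x \<oplus>\<^bsub>L\<^esub> l y" if x: "x \<in> carrier S" and y: "y \<in> carrier S" for x y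
    proof (rule l_eq)
      obtain a d where ad: "l x \<in> carrier L" "a \<in> carrier R" "d \<in> ?N" "h d \<otimes>\<^bsub>S\<^esub> x \<ominus>\<^bsub>S\<^esub> h a \<otimes>\<^bsub>S\<^esub> s \<in> M"
        "\<psi> d \<otimes>\<^bsub>L\<^esub> l x = \<psi> a" using l[OF x] unfolding rel_def by blast
      obtain a' d' where ad': "l y \<in> carrier L" "a' \<in> carrier R" "d' \<in> ?N" "h d' \<otimes>\<^bsub>S\<^esub> y \<ominus>\<^bsub>S\<^esub> h a' \<otimes>\<^bsub>S\<^esub> s \<in> M"
        "\<psi> d' \<otimes>\<^bsub>L\<^esub> l y = \<psi> a'" using l[OF y] unfolding rel_def by blast
      have dd: "h d \<in> carrier S" "h a \<in> carrier S" "h d' \<in> carrier S" "h a' \<in> carrier S"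
        "d \<in> carrier R" "d' \<in> carrier R" using ad ad' by auto
      have "h d' \<otimes>\<^bsub>S\<^esub> (h d \<otimes>\<^bsub>S\<^esub> x \<ominus>\<^bsub>S\<^esub> h a \<otimes>\<^bsub>S\<^esub> s) \<oplus>\<^bsub>S\<^esub> h d \<otimes>\<^bsub>S\<^esub> (h d' \<otimes>\<^bsub>S\<^esub> y \<ominus>\<^bsub>S\<^esub> h a' \<otimes>\<^bsub>S\<^esub> s) \<in> M"
        using ad ad' dd by (intro MD(3,4)) auto
      also have "h d' \<otimes>\<^bsub>S\<^esub> (h d \<otimes>\<^bsub>S\<^esub> x \<ominus>\<^bsub>S\<^esub> h a \<otimes>\<^bsub>S\<^esub> s) \<oplus>\<^bsub>S\<^esub> h d \<otimes>\<^bsub>S\<^esub> (h d' \<otimes>\<^bsub>S\<^esub> y \<ominus>\<^bsub>S\<^esub> h a' \<otimes>\<^bsub>S\<^esub> s) =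
          (h d \<otimes>\<^bsub>S\<^esub> h d') \<otimes>\<^bsub>S\<^esub> (x \<oplus>\<^bsub>S\<^esub> y) \<ominus>\<^bsub>S\<^esub> (h a \<otimes>\<^bsub>S\<^esub> h d' \<oplus>\<^bsub>S\<^esub> h a' \<otimes>\<^bsub>S\<^esub> h d) \<otimes>\<^bsub>S\<^esub> s"
        using x y dd(1-4) sS by (simp only: S.minus_eq) algebra
      also have "\<dots> = h (d \<otimes> d') \<otimes>\<^bsub>S\<^esub> (x \<oplus>\<^bsub>S\<^esub> y) \<ominus>\<^bsub>S\<^esub> h (a \<otimes> d' \<oplus> a' \<otimes> d) \<otimes>\<^bsub>S\<^esub> s"
        using ad ad' dd by simp
      finally have mem: "h (d \<otimes> d') \<otimes>\<^bsub>S\<^esub> (x \<oplus>\<^bsub>S\<^esub> y) \<ominus>\<^bsub>S\<^esub> h (a \<otimes> d' \<oplus> a' \<otimes> d) \<otimes>\<^bsub>S\<^esub> s \<in> M" .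
      have "\<psi> d \<in> carrier L" "\<psi> d' \<in> carrier L" using dd by auto
      then have "(\<psi> d \<otimes>\<^bsub>L\<^esub> \<psi> d') \<otimes>\<^bsub>L\<^esub> (l x \<oplus>\<^bsub>L\<^esub> l y) =
          (\<psi> d \<otimes>\<^bsub>L\<^esub> l x) \<otimes>\<^bsub>L\<^esub> \<psi> d' \<oplus>\<^bsub>L\<^esub> (\<psi> d' \<otimes>\<^bsub>L\<^esub> l y) \<otimes>\<^bsub>L\<^esub> \<psi> d"
        using ad(1) ad'(1) by algebra
      then have "\<psi> (d \<otimes> d') \<otimes>\<^bsub>L\<^esub> (l x \<oplus>\<^bsub>L\<^esub> l y) = \<psi> (a \<otimes> d' \<oplus> a' \<otimes> d)"
        using ad ad' dd by simp
      with mem show "rel (x \<oplus>\<^bsub>S\<^esub> y) (l x \<oplus>\<^bsub>L\<^esub> l y)"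
        using ad ad' dd N_mult[OF ad(3) ad'(3)] by (intro relI[of _ "a \<otimes> d' \<oplus> a' \<otimes> d" "d \<otimes> d'"]) auto
      show "x \<oplus>\<^bsub>S\<^esub> y \<in> carrier S" using x y by simp
    qed
    show "l (h r \<otimes>\<^bsub>S\<^esub> x) = \<psi> r \<otimes>\<^bsub>L\<^esub> l x" if r: "r \<in> carrier R" and x: "x \<in> carrier S" for r x
    proof (rule l_eq)
      obtain a d where ad: "l x \<in> carrier L" "a \<in> carrier R" "d \<in> ?N" "h d \<otimes>\<^bsub>S\<^esub> x \<ominus>\<^bsub>S\<^esub> h a \<otimes>\<^bsub>S\<^esub> s \<in> M"
        "\<psi> d \<otimes>\<^bsub>L\<^esub> l x = \<psi> a" using l[OF x] unfolding rel_def by blast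
      have dd: "h d \<in> carrier S" "h a \<in> carrier S" "h r \<in> carrier S" "d \<in> carrier R" using ad r by auto
      have "h r \<otimes>\<^bsub>S\<^esub> (h d \<otimes>\<^bsub>S\<^esub> x \<ominus>\<^bsub>S\<^esub> h a \<otimes>\<^bsub>S\<^esub> s) \<in> M" using ad r by (intro MD(4))
      also have "h r \<otimes>\<^bsub>S\<^esub> (h d \<otimes>\<^bsub>S\<^esub> x \<ominus>\<^bsub>S\<^esub> h a \<otimes>\<^bsub>S\<^esub> s) =
          h d \<otimes>\<^bsub>S\<^esub> (h r \<otimes>\<^bsub>S\<^esub> x) \<ominus>\<^bsub>S\<^esub> (h r \<otimes>\<^bsub>S\<^esub> h a) \<otimes>\<^bsub>S\<^esub> s"
        using x dd(1-3) sS by (simp only: S.minus_eq) algebra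
      also have "\<dots> = h d \<otimes>\<^bsub>S\<^esub> (h r \<otimes>\<^bsub>S\<^esub> x) \<ominus>\<^bsub>S\<^esub> h (r \<otimes> a) \<otimes>\<^bsub>S\<^esub> s" using ad r by simp
      finally have mem: "h d \<otimes>\<^bsub>S\<^esub> (h r \<otimes>\<^bsub>S\<^esub> x) \<ominus>\<^bsub>S\<^esub> h (r \<otimes> a) \<otimes>\<^bsub>S\<^esub> s \<in> M" .
      have "\<psi> d \<otimes>\<^bsub>L\<^esub> (\<psi> r \<otimes>\<^bsub>L\<^esub> l x) = \<psi> r \<otimes>\<^bsub>L\<^esub> (\<psi> d \<otimes>\<^bsub>L\<^esub> l x)"
        using ad(1) r dd(4) by (simp add: \<psi>.S.m_lcomm)
      then have "\<psi> d \<otimes>\<^bsub>L\<^esub> (\<psi> r \<otimes>\<^bsub>L\<^esub> l x) = \<psi> (r \<otimes> a)" using ad r by simp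
      with mem show "rel (h r \<otimes>\<^bsub>S\<^esub> x) (\<psi> r \<otimes>\<^bsub>L\<^esub> l x)"
        using ad r by (intro relI[of _ "r \<otimes> a" d]) auto
      show "h r \<otimes>\<^bsub>S\<^esub> x \<in> carrier S" using r x by simp
    qed
  qed
qed

subsection \<open>The monoid ring of pairs\<close>

text \<open>The product of the pair ring is a nested \<open>frag_extend\<close>, so its linearity in
  the right factor is linearity in the function argument.\<close>

lemma frag_extend_fun_diff:
  "frag_extend (\<lambda>p. f p - g p) z = frag_extend f z - frag_extend g z"
proof -
  have "frag_cmul c (a - b) = frag_cmul c a - frag_cmul c b" for c and a b :: "'a \<Rightarrow>\<^sub>0 int"
    using frag_cmul_distrib2[of c "a - b" b] by (simp add: algebra_simps)
  then show ?thesis by (simp add: frag_extend_def sum_subtractf)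
qed

locale pair_of_rings = B: cring B + C: cring C
  for B :: "('b, 'm) ring_scheme" and C :: "('c, 'n) ring_scheme"
begin

abbreviation "PR \<equiv> pair_ring B C"

abbreviation pairs where "pairs \<equiv> carrier B \<times> carrier C"

lemma carrier_pair_ring: "carrier PR = {z. Poly_Mapping.keys z \<subseteq> pairs}"
  by (simp add: pair_ring_def)

lemma add_pair_ring: "z \<oplus>\<^bsub>PR\<^esub> w = z + w"
  by (simp add: pair_ring_def)

lemma zero_pair_ring: "\<zero>\<^bsub>PR\<^esub> = 0"
  by (simp add: pair_ring_def)

lemma one_pair_ring: "\<one>\<^bsub>PR\<^esub> = frag_of (\<one>\<^bsub>B\<^esub>, \<one>\<^bsub>C\<^esub>)"
  by (simp add: pair_ring_def)

lemma mult_pair_ring: "z \<otimes>\<^bsub>PR\<^esub> w = frag_extend (\<lambda>(b, c).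
    frag_extend (\<lambda>(b', c'). frag_of (b \<otimes>\<^bsub>B\<^esub> b', c \<otimes>\<^bsub>C\<^esub> c')) w) z"
  by (simp add: pair_ring_def)

lemma mult_frag_of: "frag_of (b, c) \<otimes>\<^bsub>PR\<^esub> frag_of (b', c') = frag_of (b \<otimes>\<^bsub>B\<^esub> b', c \<otimes>\<^bsub>C\<^esub> c')"
  by (simp add: mult_pair_ring)

lemma mult_diff_left: "(z - z') \<otimes>\<^bsub>PR\<^esub> w = z \<otimes>\<^bsub>PR\<^esub> w - z' \<otimes>\<^bsub>PR\<^esub> w"
  by (simp add: mult_pair_ring frag_extend_diff)

lemma mult_diff_right: "z \<otimes>\<^bsub>PR\<^esub> (w - w') = z \<otimes>\<^bsub>PR\<^esub> w - z \<otimes>\<^bsub>PR\<^esub> w'"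
  unfolding mult_pair_ring frag_extend_fun_diff[symmetric]
  by (rule frag_extend_eq) (auto simp: frag_extend_diff)

lemma mult_0_left: "0 \<otimes>\<^bsub>PR\<^esub> w = 0"
  by (simp add: mult_pair_ring)

lemma mult_0_right: "z \<otimes>\<^bsub>PR\<^esub> 0 = 0"
  using mult_diff_right[of z 0 0] by simp

lemma mult_add_left: "(z + z') \<otimes>\<^bsub>PR\<^esub> w = z \<otimes>\<^bsub>PR\<^esub> w + z' \<otimes>\<^bsub>PR\<^esub> w"
  by (simp add: mult_pair_ring frag_extend_add)

lemma frag_of_closed: "b \<in> carrier B \<Longrightarrow> c \<in> carrier C \<Longrightarrow> frag_of (b, c) \<in> carrier PR"
  by (simp add: carrier_pair_ring)

lemma diff_closed: "z \<in> carrier PR \<Longrightarrow> w \<in> carrier PR \<Longrightarrow> z - w \<in> carrier PR"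
  using keys_diff[of z w] by (auto simp: carrier_pair_ring)

text \<open>Differences alone generate the additive group from the pairs, so the ring axioms only
  have to be checked on single pairs, where they are those of B and C.\<close>

lemma pair_ring_induct [consumes 1, case_names zero frag_of diff]:
  assumes "z \<in> carrier PR" "P 0"
    "\<And>b c. b \<in> carrier B \<Longrightarrow> c \<in> carrier C \<Longrightarrow> P (frag_of (b, c))"
    "\<And>z w. \<lbrakk>z \<in> carrier PR; w \<in> carrier PR; P z; P w\<rbrakk> \<Longrightarrow> P (z - w)"
  shows "P z"
proof -
  have "z \<in> carrier PR \<and> P z"
    using assms(1)[unfolded carrier_pair_ring mem_Collect_eq]
    by (induction z rule: frag_induction)
      (use assms(2-4) in \<open>auto simp: frag_of_closed intro: diff_closed, simp add: carrier_pair_ring\<close>)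
  then show ?thesis ..
qed

lemma mult_closed: "z \<in> carrier PR \<Longrightarrow> w \<in> carrier PR \<Longrightarrow> z \<otimes>\<^bsub>PR\<^esub> w \<in> carrier PR"
proof (induction z rule: pair_ring_induct)
  case zero
  then show ?case by (simp add: mult_0_left carrier_pair_ring)
next
  case (frag_of b c)
  from frag_of(3) show ?case
  proof (induction w rule: pair_ring_induct)
    case zero
    then show ?case by (simp add: mult_0_right carrier_pair_ring)
  qed (use frag_of in \<open>simp_all add: mult_frag_of frag_of_closed mult_diff_right diff_closed\<close>)
qed (simp add: mult_diff_left diff_closed)

lemma mult_commute: "z \<in> carrier PR \<Longrightarrow> w \<in> carrier PR \<Longrightarrow> z \<otimes>\<^bsub>PR\<^esub> w = w \<otimes>\<^bsub>PR\<^esub> z"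
proof (induction z rule: pair_ring_induct)
  case zero
  then show ?case by (simp add: mult_0_left mult_0_right)
next
  case (frag_of b c)
  from frag_of(3) show ?case
  proof (induction w rule: pair_ring_induct)
    case zero
    then show ?case by (simp add: mult_0_left mult_0_right)
  qed (use frag_of in \<open>simp_all add: mult_frag_of mult_diff_left mult_diff_right B.m_comm C.m_comm\<close>)
qed (simp add: mult_diff_left mult_diff_right)

lemma mult_assoc:
  "z \<in> carrier PR \<Longrightarrow> w \<in> carrier PR \<Longrightarrow> v \<in> carrier PR \<Longrightarrow>
    z \<otimes>\<^bsub>PR\<^esub> w \<otimes>\<^bsub>PR\<^esub> v = z \<otimes>\<^bsub>PR\<^esub> (w \<otimes>\<^bsub>PR\<^esub> v)"
proof (induction z rule: pair_ring_induct)
  case zero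
  then show ?case by (simp add: mult_0_left)
next
  case (frag_of b c)
  note bc = frag_of(1,2)
  from frag_of(3,4) show ?case
  proof (induction w rule: pair_ring_induct)
    case zero
    then show ?case by (simp add: mult_0_left mult_0_right)
  next
    case (frag_of b' c')
    note bc' = frag_of(1,2)
    from frag_of(3) show ?case
    proof (induction v rule: pair_ring_induct)
      case zero
      then show ?case by (simp add: mult_0_right)
    qed (use bc bc' in \<open>simp_all add: mult_frag_of mult_diff_right B.m_assoc C.m_assoc\<close>)
  qed (simp add: mult_diff_left mult_diff_right)
qed (simp add: mult_diff_left)

lemma one_mult: "z \<in> carrier PR \<Longrightarrow> \<one>\<^bsub>PR\<^esub> \<otimes>\<^bsub>PR\<^esub> z = z"
proof (induction z rule: pair_ring_induct)
  case zero
  then show ?case by (simp add: mult_0_right)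
qed (simp_all add: one_pair_ring mult_frag_of mult_diff_right)

lemma pair_ring_is_cring: "cring PR"
proof (rule cringI)
  show "abelian_group PR"
  proof (rule abelian_groupI)
    show "z \<oplus>\<^bsub>PR\<^esub> w \<in> carrier PR" if "z \<in> carrier PR" "w \<in> carrier PR" for z w
      using that keys_add[of z w] by (auto simp: carrier_pair_ring add_pair_ring)
    show "\<exists>w\<in>carrier PR. w \<oplus>\<^bsub>PR\<^esub> z = \<zero>\<^bsub>PR\<^esub>" if "z \<in> carrier PR" for z
      using that by (intro bexI[of _ "- z"]) (auto simp: carrier_pair_ring add_pair_ring zero_pair_ring)
  qed (auto simp: carrier_pair_ring add_pair_ring zero_pair_ring algebra_simps)
  show "comm_monoid PR"
  proof (rule comm_monoidI)
    show "\<one>\<^bsub>PR\<^esub> \<in> carrier PR" by (simp add: one_pair_ring frag_of_closed)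
    show "z \<otimes>\<^bsub>PR\<^esub> w \<otimes>\<^bsub>PR\<^esub> v = z \<otimes>\<^bsub>PR\<^esub> (w \<otimes>\<^bsub>PR\<^esub> v)"
      if "z \<in> carrier PR" "w \<in> carrier PR" "v \<in> carrier PR" for z w v
      by (rule mult_assoc[OF that])
    show "z \<otimes>\<^bsub>PR\<^esub> w = w \<otimes>\<^bsub>PR\<^esub> z" if "z \<in> carrier PR" "w \<in> carrier PR" for z w
      by (rule mult_commute[OF that])
  qed (simp_all add: mult_closed one_mult)
qed (simp add: add_pair_ring mult_add_left)

text \<open>The additive group of the pair ring is free abelian on the pairs, so values on the pairs
  can be prescribed freely.\<close>

lemma additive_extension:
  assumes L: "abelian_group L" and g: "\<And>b c. \<lbrakk>b \<in> carrier B; c \<in> carrier C\<rbrakk> \<Longrightarrow> g b c \<in> carrier L"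
  shows "\<exists>h. (\<forall>z\<in>carrier PR. h z \<in> carrier L) \<and>
    (\<forall>z\<in>carrier PR. \<forall>w\<in>carrier PR. h (z + w) = h z \<oplus>\<^bsub>L\<^esub> h w) \<and>
    (\<forall>b\<in>carrier B. \<forall>c\<in>carrier C. h (frag_of (b, c)) = g b c)"
proof -
  interpret L: abelian_group L by (rule L)
  have "case_prod g ` pairs \<subseteq> carrier (add_monoid L)" using g by auto
  then obtain h where h: "h \<in> hom (free_Abelian_group pairs) (add_monoid L)"
    "\<And>x. x \<in> pairs \<Longrightarrow> h (frag_of x) = case_prod g x"
    using comm_group.free_Abelian_group_universal[OF L.a_comm_group, of "case_prod g" pairs] by metis
  show ?thesis
    by (intro exI[of _ h] conjI ballI)
      (use h in \<open>auto simp: hom_def free_Abelian_group_def carrier_pair_ring\<close>)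
qed

end

text \<open>The residue field is obtained as the localization of the domain R / I at its zero ideal,
  which accounts for the type of \<open>L\<close>: classes of pairs of cosets.\<close>

lemma (in primeideal) quotient_residue_field:
  obtains \<iota> and L :: "('a set \<times> 'a set) set ring" where "ring_hom_cring R L \<iota>"
    "\<And>x. x \<in> I \<Longrightarrow> \<iota> x = \<zero>\<^bsub>L\<^esub>" "\<And>x. x \<in> carrier R - I \<Longrightarrow> \<iota> x \<in> Units L"
    "\<And>x. x \<in> carrier R - I \<Longrightarrow> \<iota> x \<noteq> \<zero>\<^bsub>L\<^esub>"
proof -
  let ?D = "R Quot I"
  interpret D: domain ?D by (rule quotient_is_domain)
  interpret Z: primeideal "{\<zero>\<^bsub>?D\<^esub>}" ?D by (rule D.zeroprimeideal)
  interpret \<pi>: ring_hom_cring R ?D "(+>) I" by (rule rcos_ring_hom_cring)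
  let ?L = "localization ?D {\<zero>\<^bsub>?D\<^esub>}"
  interpret L: cring ?L by (rule Z.localization_is_cring)
  interpret \<kappa>: ring_hom_cring ?D ?L "\<lambda>a. fraction ?D {\<zero>\<^bsub>?D\<^esub>} a \<one>\<^bsub>?D\<^esub>"
    by unfold_locales (rule Z.localization_hom)
  let ?\<iota> = "\<lambda>x. fraction ?D {\<zero>\<^bsub>?D\<^esub>} (I +> x) \<one>\<^bsub>?D\<^esub>"
  show thesis
  proof (rule that[of ?L ?\<iota>])
    have "?\<iota> \<in> ring_hom R ?L"
      using ring_hom_trans[OF \<pi>.homh \<kappa>.homh] by (simp add: o_def)
    then show "ring_hom_cring R ?L ?\<iota>"
      by (intro ring_hom_cring.intro ring_hom_cring_axioms.intro is_cring L.is_cring)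
    show "?\<iota> x = \<zero>\<^bsub>?L\<^esub>" if "x \<in> I" for x
    proof -
      have "I +> x = \<zero>\<^bsub>?D\<^esub>" by (rule iffD2[OF rcos_eq_zero_iff[OF Icarr[OF that]] that])
      then show ?thesis by (simp only: Z.localization_zero)
    qed
    fix x assume x: "x \<in> carrier R - I"
    then have nz: "I +> x \<in> carrier ?D - {\<zero>\<^bsub>?D\<^esub>}" using rcos_eq_zero_iff[of x] by simp
    show "?\<iota> x \<noteq> \<zero>\<^bsub>?L\<^esub>" using Z.frac_one_zero_imp_mem[of "I +> x"] nz by auto
    let ?j = "fraction ?D {\<zero>\<^bsub>?D\<^esub>} \<one>\<^bsub>?D\<^esub> (I +> x)"
    have j: "?j \<in> carrier ?L" using nz by (intro Z.frac_closed) auto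
    have \<iota>x: "?\<iota> x \<in> carrier ?L" using x by simp
    have "?\<iota> x \<otimes>\<^bsub>?L\<^esub> ?j = \<one>\<^bsub>?L\<^esub>" by (rule Z.frac_inverse[OF nz])
    moreover from this have "?j \<otimes>\<^bsub>?L\<^esub> ?\<iota> x = \<one>\<^bsub>?L\<^esub>" by (simp only: L.m_comm[OF j \<iota>x])
    ultimately show "?\<iota> x \<in> Units ?L"
      using j \<iota>x unfolding Units_def by blast
  qed
qed

text \<open>The residue fields of \<open>Q\<close> and \<open>Q'\<close> have a nonzero tensor product over that of \<open>P\<close>: for
  \<open>s \<notin> Q\<close> and \<open>t \<notin> Q'\<close>, a functional \<open>l\<close> on \<open>B\<close> with \<open>l s = 1\<close> gives a bilinear map
  \<open>(b, c) \<mapsto> l b \<cdot> c\<close> with values in the residue field of \<open>Q'\<close> that does not vanish at \<open>(s, t)\<close>.\<close>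

lemma tensor_prime_exists:
  fixes A :: "('a, 'k) ring_scheme" and B :: "('b, 'm) ring_scheme" and C :: "('c, 'n) ring_scheme"
  assumes \<phi>: "ring_hom_cring A B \<phi>" and \<psi>: "ring_hom_cring A C \<psi>"
    and Q: "primeideal Q B" and Q': "primeideal Q' C"
    and eq: "contract A \<phi> Q = contract A \<psi> Q'"
  obtains N where "primeideal N (tensor_ring A B C \<phi> \<psi>)"
    "contract B (\<lambda>b. tensor_elt A B C \<phi> \<psi> b \<one>\<^bsub>C\<^esub>) N = Q"
    "contract C (\<lambda>c. tensor_elt A B C \<phi> \<psi> \<one>\<^bsub>B\<^esub> c) N = Q'"
proof -
  interpret \<phi>: ring_hom_cring A B \<phi> by (rule \<phi>)
  interpret \<psi>: ring_hom_cring A C \<psi> by (rule \<psi>)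
  interpret Q: primeideal Q B by (rule Q)
  interpret Q': primeideal Q' C by (rule Q')
  interpret pair_of_rings B C by unfold_locales
  interpret PR: cring PR by (rule pair_ring_is_cring)
  obtain \<iota> and L :: "('c set \<times> 'c set) set ring" where \<iota>: "ring_hom_cring C L \<iota>"
    and \<iota>_zero: "\<And>x. x \<in> Q' \<Longrightarrow> \<iota> x = \<zero>\<^bsub>L\<^esub>" and \<iota>_unit: "\<And>x. x \<in> carrier C - Q' \<Longrightarrow> \<iota> x \<in> Units L"
    and \<iota>_nz: "\<And>x. x \<in> carrier C - Q' \<Longrightarrow> \<iota> x \<noteq> \<zero>\<^bsub>L\<^esub>"
    using Q'.quotient_residue_field by metis
  interpret \<iota>: ring_hom_cring C L \<iota> by (rule \<iota>)
  have "(\<lambda>a. \<iota> (\<psi> a)) \<in> ring_hom A L"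
    using ring_hom_trans[OF \<psi>.homh \<iota>.homh] by (simp add: o_def)
  then have A_L: "ring_hom_cring A L (\<lambda>a. \<iota> (\<psi> a))"
    by (intro ring_hom_cring.intro ring_hom_cring_axioms.intro \<phi>.R.is_cring \<iota>.S.is_cring)
  have PQ: "\<phi> a \<in> Q \<longleftrightarrow> \<psi> a \<in> Q'" if "a \<in> carrier A" for a
    using eq that unfolding contract_def by blast
  \<comment> \<open>These are the functionals on B that kill Q and are linear over A, with values in
    the residue field of Q'. All of them are needed at once, since a single one may vanish at a
    given s outside Q.\<close>
  define lin where "lin l \<longleftrightarrow> l \<in> carrier B \<rightarrow> carrier L \<and>
      (\<forall>x\<in>carrier B. \<forall>y\<in>carrier B. l (x \<oplus>\<^bsub>B\<^esub> y) = l x \<oplus>\<^bsub>L\<^esub> l y) \<and>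
      (\<forall>a\<in>carrier A. \<forall>x\<in>carrier B. l (\<phi> a \<otimes>\<^bsub>B\<^esub> x) = \<iota> (\<psi> a) \<otimes>\<^bsub>L\<^esub> l x) \<and>
      (\<forall>x\<in>Q. l x = \<zero>\<^bsub>L\<^esub>)" for l
  have "\<forall>l. \<exists>h. lin l \<longrightarrow> (\<forall>z\<in>carrier PR. h z \<in> carrier L) \<and>
      (\<forall>z\<in>carrier PR. \<forall>w\<in>carrier PR. h (z + w) = h z \<oplus>\<^bsub>L\<^esub> h w) \<and>
      (\<forall>b\<in>carrier B. \<forall>c\<in>carrier C. h (frag_of (b, c)) = l b \<otimes>\<^bsub>L\<^esub> \<iota> c)"
  proof
    fix l
    show "\<exists>h. lin l \<longrightarrow> (\<forall>z\<in>carrier PR. h z \<in> carrier L) \<and>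
      (\<forall>z\<in>carrier PR. \<forall>w\<in>carrier PR. h (z + w) = h z \<oplus>\<^bsub>L\<^esub> h w) \<and>
      (\<forall>b\<in>carrier B. \<forall>c\<in>carrier C. h (frag_of (b, c)) = l b \<otimes>\<^bsub>L\<^esub> \<iota> c)"
    proof (cases "lin l")
      case True
      then have "l b \<otimes>\<^bsub>L\<^esub> \<iota> c \<in> carrier L" if "b \<in> carrier B" "c \<in> carrier C" for b c
        using that by (auto simp: lin_def)
      from additive_extension[where g = "\<lambda>b c. l b \<otimes>\<^bsub>L\<^esub> \<iota> c", OF \<iota>.S.is_abelian_group this]
      show ?thesis by simp
    qed simp
  qed
  from choice[OF this] obtain H where H0: "\<forall>l. lin l \<longrightarrow> (\<forall>z\<in>carrier PR. H l z \<in> carrier L) \<and>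
      (\<forall>z\<in>carrier PR. \<forall>w\<in>carrier PR. H l (z + w) = H l z \<oplus>\<^bsub>L\<^esub> H l w) \<and>
      (\<forall>b\<in>carrier B. \<forall>c\<in>carrier C. H l (frag_of (b, c)) = l b \<otimes>\<^bsub>L\<^esub> \<iota> c)" by (rule exE)
  have Hc: "H l z \<in> carrier L" if "lin l" "z \<in> carrier PR" for l z using H0 that by blast
  have Hadd: "H l (z + w) = H l z \<oplus>\<^bsub>L\<^esub> H l w" if "lin l" "z \<in> carrier PR" "w \<in> carrier PR" for l z w
    using H0 that by blast
  have Hf: "H l (frag_of (b, c)) = l b \<otimes>\<^bsub>L\<^esub> \<iota> c" if "lin l" "b \<in> carrier B" "c \<in> carrier C" for l b c
    using H0 that by blast
  have zeroPR: "0 \<in> carrier PR" by (simp add: carrier_pair_ring)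
  have Hzero: "H l 0 = \<zero>\<^bsub>L\<^esub>" if "lin l" for l
    using Hadd[OF that zeroPR zeroPR] Hc[OF that zeroPR] by simp
  have Hdiff: "H l (z - w) = H l z \<ominus>\<^bsub>L\<^esub> H l w" if l: "lin l" and zw: "z \<in> carrier PR" "w \<in> carrier PR" for l z w
  proof -
    have "H l z = H l (z - w) \<oplus>\<^bsub>L\<^esub> H l w"
      using Hadd[OF l diff_closed[OF zw] zw(2)] by simp
    then show ?thesis
      using Hc[OF l] zw diff_closed[OF zw] by (simp add: \<iota>.S.minus_eq \<iota>.S.a_assoc \<iota>.S.r_neg)
  qed
  have lc: "l b \<in> carrier L" if "lin l" "b \<in> carrier B" for l b using that unfolding lin_def by blast
  have ladd: "l (x \<oplus>\<^bsub>B\<^esub> y) = l x \<oplus>\<^bsub>L\<^esub> l y" if "lin l" "x \<in> carrier B" "y \<in> carrier B" for l x y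
    using that unfolding lin_def by blast
  have lsm: "l (\<phi> a \<otimes>\<^bsub>B\<^esub> x) = \<iota> (\<psi> a) \<otimes>\<^bsub>L\<^esub> l x" if "lin l" "a \<in> carrier A" "x \<in> carrier B" for l a x
    using that unfolding lin_def by blast
  have lQ: "l x = \<zero>\<^bsub>L\<^esub>" if "lin l" "x \<in> Q" for l x
    using that unfolding lin_def by blast
  \<comment> \<open>Multiplication by a pair (b, c) precomposes the functional with multiplication
    by b and scales by \<open>\<iota> c\<close>. The functionals are stable under this, which is
    what makes their common kernel \<open>J\<close> an ideal.\<close>
  have Hmult: "H l (frag_of (b, c) \<otimes>\<^bsub>PR\<^esub> z) = \<iota> c \<otimes>\<^bsub>L\<^esub> H (\<lambda>x. l (b \<otimes>\<^bsub>B\<^esub> x)) z"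
    and lin': "lin (\<lambda>x. l (b \<otimes>\<^bsub>B\<^esub> x))"
    if l: "lin l" and bc: "b \<in> carrier B" "c \<in> carrier C" and z: "z \<in> carrier PR" for l b c z
  proof -
    let ?l = "\<lambda>x. l (b \<otimes>\<^bsub>B\<^esub> x)"
    show l': "lin ?l"
      unfolding lin_def
    proof (intro conjI ballI)
      show "?l \<in> carrier B \<rightarrow> carrier L" using bc lc[OF l] by auto
      show "?l (x \<oplus>\<^bsub>B\<^esub> y) = ?l x \<oplus>\<^bsub>L\<^esub> ?l y" if "x \<in> carrier B" "y \<in> carrier B" for x y
        using that bc by (simp add: \<phi>.S.r_distr ladd[OF l])
      show "?l (\<phi> a \<otimes>\<^bsub>B\<^esub> x) = \<iota> (\<psi> a) \<otimes>\<^bsub>L\<^esub> ?l x" if "a \<in> carrier A" "x \<in> carrier B" for a x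
        using that bc lsm[OF l, of a "b \<otimes>\<^bsub>B\<^esub> x"] by (simp add: \<phi>.S.m_lcomm)
      show "?l x = \<zero>\<^bsub>L\<^esub>" if "x \<in> Q" for x
        using that bc by (intro lQ[OF l] Q.I_l_closed)
    qed
    from z show "H l (frag_of (b, c) \<otimes>\<^bsub>PR\<^esub> z) = \<iota> c \<otimes>\<^bsub>L\<^esub> H ?l z"
    proof (induction z rule: pair_ring_induct)
      case zero
      then show ?case using bc by (simp add: mult_0_right Hzero[OF l] Hzero[OF l'])
    next
      case (frag_of b' c')
      then show ?case
        using bc lc[OF l] by (simp add: mult_frag_of Hf[OF l] Hf[OF l'] \<iota>.S.m_lcomm)
    next
      case (diff z w)
      have fz: "frag_of (b, c) \<otimes>\<^bsub>PR\<^esub> z \<in> carrier PR" "frag_of (b, c) \<otimes>\<^bsub>PR\<^esub> w \<in> carrier PR"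
        using diff bc by (auto intro: mult_closed frag_of_closed)
      have "\<iota> c \<in> carrier L" "H ?l z \<in> carrier L" "H ?l w \<in> carrier L"
        using bc diff Hc[OF l'] by auto
      then have "\<iota> c \<otimes>\<^bsub>L\<^esub> H ?l z \<ominus>\<^bsub>L\<^esub> \<iota> c \<otimes>\<^bsub>L\<^esub> H ?l w = \<iota> c \<otimes>\<^bsub>L\<^esub> (H ?l z \<ominus>\<^bsub>L\<^esub> H ?l w)"
        by (simp add: \<iota>.S.minus_eq \<iota>.S.r_distr \<iota>.S.r_minus)
      then show ?case
        using diff fz by (simp add: mult_diff_right Hdiff[OF l] Hdiff[OF l'])
    qed
  qed
  \<comment> \<open>\<open>J\<close> plays the role of the kernel of the map to the tensor product
    of the two residue fields, which is never constructed; functionals detect whether an element of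
    that product is zero.\<close>
  define J where "J = {z \<in> carrier PR. \<forall>l. lin l \<longrightarrow> H l z = \<zero>\<^bsub>L\<^esub>}"
  have Jdiff: "z - w \<in> J" if "z \<in> J" "w \<in> J" for z w
    using that Hdiff by (auto simp: J_def diff_closed \<iota>.S.minus_eq)
  have J0: "0 \<in> J" using zeroPR Hzero by (simp add: J_def)
  have Jmult: "x \<otimes>\<^bsub>PR\<^esub> z \<in> J" if z: "z \<in> J" and x: "x \<in> carrier PR" for x z
    using x
  proof (induction x rule: pair_ring_induct)
    case zero
    then show ?case using J0 by (simp add: mult_0_left)
  next
    case (frag_of b c)
    have zPR: "z \<in> carrier PR" using z by (simp add: J_def)
    have "H l (frag_of (b, c) \<otimes>\<^bsub>PR\<^esub> z) = \<zero>\<^bsub>L\<^esub>" if l: "lin l" for l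
      using Hmult[OF l frag_of zPR] lin'[OF l frag_of zPR] z frag_of(2) by (simp add: J_def)
    then show ?case using frag_of zPR by (simp add: J_def mult_closed frag_of_closed)
  next
    case (diff x y)
    then show ?case by (simp add: mult_diff_left Jdiff)
  qed
  have J_ideal: "ideal J PR"
  proof (rule idealI)
    show "ring PR" by (rule PR.ring_axioms)
    show "subgroup J (add_monoid PR)"
    proof (rule PR.add.subgroupI)
      show "J \<subseteq> carrier PR" by (auto simp: J_def)
      show "J \<noteq> {}" using J0 by blast
      fix z w assume zw: "z \<in> J" "w \<in> J"
      have zPR: "z \<in> carrier PR" using zw by (simp add: J_def)
      have "\<ominus>\<^bsub>PR\<^esub> z = 0 - z"
      proof (rule PR.minus_equality)
        show "(0 - z) \<oplus>\<^bsub>PR\<^esub> z = \<zero>\<^bsub>PR\<^esub>" by (simp add: add_pair_ring zero_pair_ring)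
        show "0 - z \<in> carrier PR" by (rule diff_closed[OF zeroPR zPR])
      qed (rule zPR)
      then show "\<ominus>\<^bsub>PR\<^esub> z \<in> J" using Jdiff[OF J0 zw(1)] by simp
      have "z - (0 - w) \<in> J" by (intro Jdiff J0 zw)
      then show "z \<oplus>\<^bsub>PR\<^esub> w \<in> J" by (simp add: add_pair_ring)
    qed
    show "x \<otimes>\<^bsub>PR\<^esub> z \<in> J" if "z \<in> J" "x \<in> carrier PR" for z x by (rule Jmult[OF that])
    show "z \<otimes>\<^bsub>PR\<^esub> x \<in> J" if "z \<in> J" "x \<in> carrier PR" for z x
      using Jmult[OF that] that by (simp add: J_def mult_commute)
  qed
  define G where "G = {frag_of (b \<oplus>\<^bsub>B\<^esub> b', c) - frag_of (b, c) - frag_of (b', c) | b b' c.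
        b \<in> carrier B \<and> b' \<in> carrier B \<and> c \<in> carrier C} \<union>
     {frag_of (b, c \<oplus>\<^bsub>C\<^esub> c') - frag_of (b, c) - frag_of (b, c') | b c c'.
        b \<in> carrier B \<and> c \<in> carrier C \<and> c' \<in> carrier C} \<union>
     {frag_of (\<phi> a \<otimes>\<^bsub>B\<^esub> b, c) - frag_of (b, \<psi> a \<otimes>\<^bsub>C\<^esub> c) | a b c.
        a \<in> carrier A \<and> b \<in> carrier B \<and> c \<in> carrier C}"
  define K where "K = tensor_ideal A B C \<phi> \<psi>"
  have K: "K = genideal PR G" by (simp add: K_def tensor_ideal_def G_def)
  have r1: "frag_of (b \<oplus>\<^bsub>B\<^esub> b', c) - frag_of (b, c) - frag_of (b', c) \<in> J"
    if "b \<in> carrier B" "b' \<in> carrier B" "c \<in> carrier C" for b b' c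
  proof -
    have "(l b \<oplus>\<^bsub>L\<^esub> l b') \<otimes>\<^bsub>L\<^esub> \<iota> c \<ominus>\<^bsub>L\<^esub> l b \<otimes>\<^bsub>L\<^esub> \<iota> c \<ominus>\<^bsub>L\<^esub> l b' \<otimes>\<^bsub>L\<^esub> \<iota> c = \<zero>\<^bsub>L\<^esub>" if l: "lin l" for l
    proof -
      have "l b \<in> carrier L" "l b' \<in> carrier L" "\<iota> c \<in> carrier L"
        using lc[OF l] \<open>b \<in> carrier B\<close> \<open>b' \<in> carrier B\<close> \<open>c \<in> carrier C\<close> by auto
      then show ?thesis by (simp only: \<iota>.S.minus_eq) algebra
    qed
    then show ?thesis using that by (simp add: J_def Hdiff Hf ladd diff_closed frag_of_closed)
  qed
  have r2: "frag_of (b, c \<oplus>\<^bsub>C\<^esub> c') - frag_of (b, c) - frag_of (b, c') \<in> J"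
    if "b \<in> carrier B" "c \<in> carrier C" "c' \<in> carrier C" for b c c'
  proof -
    have "l b \<otimes>\<^bsub>L\<^esub> (\<iota> c \<oplus>\<^bsub>L\<^esub> \<iota> c') \<ominus>\<^bsub>L\<^esub> l b \<otimes>\<^bsub>L\<^esub> \<iota> c \<ominus>\<^bsub>L\<^esub> l b \<otimes>\<^bsub>L\<^esub> \<iota> c' = \<zero>\<^bsub>L\<^esub>" if l: "lin l" for l
    proof -
      have "l b \<in> carrier L" "\<iota> c \<in> carrier L" "\<iota> c' \<in> carrier L"
        using lc[OF l] \<open>b \<in> carrier B\<close> \<open>c' \<in> carrier C\<close> \<open>c \<in> carrier C\<close> by auto
      then show ?thesis by (simp only: \<iota>.S.minus_eq) algebra
    qed
    then show ?thesis using that by (simp add: J_def Hdiff Hf diff_closed frag_of_closed)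
  qed
  have r3: "frag_of (\<phi> a \<otimes>\<^bsub>B\<^esub> b, c) - frag_of (b, \<psi> a \<otimes>\<^bsub>C\<^esub> c) \<in> J"
    if "a \<in> carrier A" "b \<in> carrier B" "c \<in> carrier C" for a b c
  proof -
    have "(\<iota> (\<psi> a) \<otimes>\<^bsub>L\<^esub> l b) \<otimes>\<^bsub>L\<^esub> \<iota> c \<ominus>\<^bsub>L\<^esub> l b \<otimes>\<^bsub>L\<^esub> (\<iota> (\<psi> a) \<otimes>\<^bsub>L\<^esub> \<iota> c) = \<zero>\<^bsub>L\<^esub>" if l: "lin l" for l
    proof -
      have "l b \<in> carrier L" "\<iota> c \<in> carrier L" "\<iota> (\<psi> a) \<in> carrier L"
        using lc[OF l] \<open>b \<in> carrier B\<close> \<open>a \<in> carrier A\<close> \<open>c \<in> carrier C\<close> by auto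
      then show ?thesis by (simp only: \<iota>.S.minus_eq) algebra
    qed
    then show ?thesis using that by (simp add: J_def Hdiff Hf lsm diff_closed frag_of_closed)
  qed
  have GJ: "G \<subseteq> J" using r1 r2 r3 by (auto simp: G_def)
  have "G \<subseteq> carrier PR" using GJ by (auto simp: J_def)
  then interpret K: ideal K PR unfolding K by (rule PR.genideal_ideal)
  have KJ: "K \<subseteq> J" unfolding K by (rule PR.genideal_minimal[OF J_ideal GJ])
  \<comment> \<open>A prime that avoids these pairs has contractions contained in Q and Q'; one that
    contains \<open>J\<close> has contractions containing them.\<close>
  define S where "S = {frag_of (s, t) | s t. s \<in> carrier B - Q \<and> t \<in> carrier C - Q'}"
  have JS: "J \<inter> S = {}"
  proof (rule ccontr)
    assume "J \<inter> S \<noteq> {}"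
    then obtain s t where st: "s \<in> carrier B - Q" "t \<in> carrier C - Q'" "frag_of (s, t) \<in> J"
      by (auto simp: S_def)
    have "\<exists>l. lin l \<and> l s = \<one>\<^bsub>L\<^esub>"
    proof (rule \<phi>.linear_functional[OF Q st(1) A_L])
      show "\<iota> (\<psi> a) \<in> Units L" if "a \<in> carrier A" "\<phi> a \<notin> Q" for a
        using that \<iota>_unit PQ by simp
      show "\<iota> (\<psi> a) = \<zero>\<^bsub>L\<^esub>" if "a \<in> carrier A" "\<phi> a \<in> Q" for a
        using that \<iota>_zero PQ by simp
      fix l
      assume "l \<in> carrier B \<rightarrow> carrier L"
        "\<And>x y. \<lbrakk>x \<in> carrier B; y \<in> carrier B\<rbrakk> \<Longrightarrow> l (x \<oplus>\<^bsub>B\<^esub> y) = l x \<oplus>\<^bsub>L\<^esub> l y"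
        "\<And>a x. \<lbrakk>a \<in> carrier A; x \<in> carrier B\<rbrakk> \<Longrightarrow> l (\<phi> a \<otimes>\<^bsub>B\<^esub> x) = \<iota> (\<psi> a) \<otimes>\<^bsub>L\<^esub> l x"
        "\<And>x. x \<in> Q \<Longrightarrow> l x = \<zero>\<^bsub>L\<^esub>" "l s = \<one>\<^bsub>L\<^esub>"
      then show "\<exists>l. lin l \<and> l s = \<one>\<^bsub>L\<^esub>" unfolding lin_def by (intro exI[of _ l]) simp
    qed
    then obtain l where lin: "lin l" "l s = \<one>\<^bsub>L\<^esub>" by blast
    have "H l (frag_of (s, t)) = \<zero>\<^bsub>L\<^esub>" using st(3) lin by (simp add: J_def)
    then have "\<iota> t = \<zero>\<^bsub>L\<^esub>" using Hf[OF lin(1), of s t] st lin(2) by simp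
    then show False using \<iota>_nz st(2) by blast
  qed
  have S1: "\<one>\<^bsub>PR\<^esub> \<in> S"
    using Q.one_nonmemb Q'.one_nonmemb unfolding S_def one_pair_ring by blast
  have S2: "x \<otimes>\<^bsub>PR\<^esub> y \<in> S" if xy: "x \<in> S" "y \<in> S" for x y
  proof -
    obtain s t s' t' where "x = frag_of (s, t)" "y = frag_of (s', t')"
      and m: "s \<in> carrier B - Q" "t \<in> carrier C - Q'" "s' \<in> carrier B - Q" "t' \<in> carrier C - Q'"
      using xy by (auto simp: S_def)
    then have "x \<otimes>\<^bsub>PR\<^esub> y = frag_of (s \<otimes>\<^bsub>B\<^esub> s', t \<otimes>\<^bsub>C\<^esub> t')" by (simp add: mult_frag_of)
    then show ?thesis
      using Q.nonmemb_mult[OF m(1,3)] Q'.nonmemb_mult[OF m(2,4)] unfolding S_def by blast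
  qed
  obtain N where N: "primeideal N PR" "J \<subseteq> N" "N \<inter> S = {}"
    using PR.prime_avoiding_mult_closed[OF J_ideal S1 S2 JS] by metis
  interpret N: primeideal N PR by (rule N)
  have KN: "K \<subseteq> N" using KJ N(2) by blast
  let ?T = "PR Quot K"
  interpret \<pi>: ring_hom_cring PR ?T "(+>\<^bsub>PR\<^esub>) K" by (rule K.rcos_ring_hom_cring[OF PR.is_cring])
  let ?N = "(+>\<^bsub>PR\<^esub>) K ` N"
  have carrier_T: "\<exists>x\<in>carrier PR. X = K +>\<^bsub>PR\<^esub> x" if "X \<in> carrier ?T" for X
    using that unfolding FactRing_def A_RCOSETS_def' by auto
  \<comment> \<open>Because \<open>K\<close> is contained in \<open>N\<close>, membership in the
    image ideal may be tested on any representative of a coset.\<close>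
  have memN: "K +>\<^bsub>PR\<^esub> x \<in> ?N \<longleftrightarrow> x \<in> N" if x: "x \<in> carrier PR" for x
  proof
    assume "K +>\<^bsub>PR\<^esub> x \<in> ?N"
    then obtain z where z: "z \<in> N" "K +>\<^bsub>PR\<^esub> x = K +>\<^bsub>PR\<^esub> z" by blast
    have zPR: "z \<in> carrier PR" using z N.Icarr by simp
    have "K +>\<^bsub>PR\<^esub> (x \<ominus>\<^bsub>PR\<^esub> z) = \<zero>\<^bsub>?T\<^esub>" using x zPR z(2) by (simp add: PR.minus_eq \<pi>.S.r_neg)
    then have "x \<ominus>\<^bsub>PR\<^esub> z \<in> N" using K.rcos_eq_zero_iff[of "x \<ominus>\<^bsub>PR\<^esub> z"] x zPR KN by auto
    then have "(x \<ominus>\<^bsub>PR\<^esub> z) \<oplus>\<^bsub>PR\<^esub> z \<in> N" using z(1) by (rule N.a_closed)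
    then show "x \<in> N" using x zPR by (simp add: PR.minus_eq PR.a_assoc PR.l_neg)
  qed blast
  note ones = \<phi>.S.one_closed \<psi>.S.one_closed
  have "primeideal ?N ?T"
  proof (rule primeidealI)
    show "ideal ?N ?T" by (rule PR.ring_ideal_imp_quot_ideal[OF K.is_ideal N.is_ideal])
    show "cring ?T" by (rule \<pi>.S.is_cring)
    have "K +>\<^bsub>PR\<^esub> \<one>\<^bsub>PR\<^esub> \<notin> ?N" using memN[OF PR.one_closed] S1 N(3) by blast
    then show "carrier ?T \<noteq> ?N" using \<pi>.hom_closed[OF PR.one_closed] by auto
    fix X Y assume "X \<in> carrier ?T" "Y \<in> carrier ?T" "X \<otimes>\<^bsub>?T\<^esub> Y \<in> ?N"
    then obtain x y where xy: "x \<in> carrier PR" "y \<in> carrier PR" "X = K +>\<^bsub>PR\<^esub> x" "Y = K +>\<^bsub>PR\<^esub> y"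
      "(K +>\<^bsub>PR\<^esub> x) \<otimes>\<^bsub>?T\<^esub> (K +>\<^bsub>PR\<^esub> y) \<in> ?N" using carrier_T by metis
    then have "K +>\<^bsub>PR\<^esub> (x \<otimes>\<^bsub>PR\<^esub> y) \<in> ?N" by simp
    then have "x \<otimes>\<^bsub>PR\<^esub> y \<in> N" by (rule iffD1[OF memN[OF mult_closed[OF xy(1,2)]]])
    then show "X \<in> ?N \<or> Y \<in> ?N" using N.I_prime xy by blast
  qed
  moreover have "contract B (\<lambda>b. K +>\<^bsub>PR\<^esub> frag_of (b, \<one>\<^bsub>C\<^esub>)) ?N = Q"
  proof -
    have "frag_of (b, \<one>\<^bsub>C\<^esub>) \<in> N \<longleftrightarrow> b \<in> Q" if b: "b \<in> carrier B" for b
    proof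
      assume "b \<in> Q"
      then have "frag_of (b, \<one>\<^bsub>C\<^esub>) \<in> J" using b by (simp add: J_def frag_of_closed Hf lQ)
      then show "frag_of (b, \<one>\<^bsub>C\<^esub>) \<in> N" using N(2) by blast
    next
      assume "frag_of (b, \<one>\<^bsub>C\<^esub>) \<in> N"
      then show "b \<in> Q" using N(3) b Q'.one_nonmemb unfolding S_def by blast
    qed
    then have "K +>\<^bsub>PR\<^esub> frag_of (b, \<one>\<^bsub>C\<^esub>) \<in> ?N \<longleftrightarrow> b \<in> Q" if "b \<in> carrier B" for b
      using memN[OF frag_of_closed[OF that ones(2)]] that by blast
    then show ?thesis unfolding contract_def using Q.Icarr by blast
  qed
  moreover have "contract C (\<lambda>c. K +>\<^bsub>PR\<^esub> frag_of (\<one>\<^bsub>B\<^esub>, c)) ?N = Q'"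
  proof -
    have "frag_of (\<one>\<^bsub>B\<^esub>, c) \<in> N \<longleftrightarrow> c \<in> Q'" if c: "c \<in> carrier C" for c
    proof
      assume "c \<in> Q'"
      then have "frag_of (\<one>\<^bsub>B\<^esub>, c) \<in> J" using c lc by (simp add: J_def frag_of_closed Hf \<iota>_zero)
      then show "frag_of (\<one>\<^bsub>B\<^esub>, c) \<in> N" using N(2) by blast
    next
      assume "frag_of (\<one>\<^bsub>B\<^esub>, c) \<in> N"
      then show "c \<in> Q'" using N(3) c Q.one_nonmemb unfolding S_def by blast
    qed
    then have "K +>\<^bsub>PR\<^esub> frag_of (\<one>\<^bsub>B\<^esub>, c) \<in> ?N \<longleftrightarrow> c \<in> Q'" if "c \<in> carrier C" for c
      using memN[OF frag_of_closed[OF ones(1) that]] that by blast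
    then show ?thesis unfolding contract_def using Q'.Icarr by blast
  qed
  ultimately show thesis
    using that by (simp add: tensor_ring_def tensor_elt_def K_def)
qed

section \<open>Point-set topology: partitions, irreducible components, descending chains\<close>

section \<open>Open partitions and local connectedness\<close>

definition open_partition :: "'a topology \<Rightarrow> 'a set \<Rightarrow> 'a set set \<Rightarrow> bool" where
  "open_partition T U \<A> \<longleftrightarrow> finite \<A> \<and> pairwise disjnt \<A> \<and>
     (\<forall>A \<in> \<A>. openin T A \<and> A \<noteq> {}) \<and> \<Union>\<A> = U"

text \<open>For open U this says that U has finitely many connected components, all of them open,
  without mentioning components. The formulation can be carried along unions and images by mere
  counting.\<close>

definition splits_boundedly :: "'a topology \<Rightarrow> 'a set \<Rightarrow> bool" where
  "splits_boundedly T U \<longleftrightarrow> (\<exists>N. \<forall>\<A>. open_partition T U \<A> \<longrightarrow> card \<A> \<le> N)"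

lemma splits_boundedlyI: "(\<And>\<A>. open_partition T U \<A> \<Longrightarrow> card \<A> \<le> N) \<Longrightarrow> splits_boundedly T U"
  by (auto simp: splits_boundedly_def)

lemma splits_boundedly_empty: "splits_boundedly T {}"
proof (rule splits_boundedlyI[of _ _ 0])
  fix \<A> assume "open_partition T {} \<A>"
  then have "\<A> = {}" by (auto simp: open_partition_def)
  then show "card \<A> \<le> 0" by simp
qed

text \<open>The pieces that meet V restrict to a partition of V, and distinct pieces have distinct
  traces, being disjoint and nonempty on V. The bound is therefore uniform in the surrounding set
  U.\<close>

lemma splits_boundedly_trace:
  assumes "splits_boundedly T V" "openin T V"
  shows "\<exists>N. \<forall>\<A> U. open_partition T U \<A> \<longrightarrow> V \<subseteq> U \<longrightarrow> card {A \<in> \<A>. A \<inter> V \<noteq> {}} \<le> N"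
proof -
  from assms(1) obtain N where N: "\<And>\<A>. open_partition T V \<A> \<Longrightarrow> card \<A> \<le> N"
    by (auto simp: splits_boundedly_def)
  have "card {A \<in> \<A>. A \<inter> V \<noteq> {}} \<le> N" if \<A>: "open_partition T U \<A>" and VU: "V \<subseteq> U" for \<A> U
  proof -
    let ?\<B> = "{A \<in> \<A>. A \<inter> V \<noteq> {}}"
    have disj: "A \<inter> B = {}" if "A \<in> \<A>" "B \<in> \<A>" "A \<noteq> B" for A B
      using \<A> that unfolding open_partition_def pairwise_def disjnt_def by blast
    have "open_partition T V ((\<lambda>A. A \<inter> V) ` ?\<B>)"
      unfolding open_partition_def
    proof (intro conjI)
      show "finite ((\<lambda>A. A \<inter> V) ` ?\<B>)" using \<A> by (simp add: open_partition_def)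
      show "pairwise disjnt ((\<lambda>A. A \<inter> V) ` ?\<B>)"
        unfolding pairwise_def disjnt_def using disj by blast
      show "\<forall>A \<in> (\<lambda>A. A \<inter> V) ` ?\<B>. openin T A \<and> A \<noteq> {}"
        using \<A> assms(2) by (auto simp: open_partition_def)
      show "\<Union>((\<lambda>A. A \<inter> V) ` ?\<B>) = V"
        using \<A> VU unfolding open_partition_def by blast
    qed
    moreover have "inj_on (\<lambda>A. A \<inter> V) ?\<B>"
      unfolding inj_on_def using disj by blast
    ultimately show ?thesis
      using N[of "(\<lambda>A. A \<inter> V) ` ?\<B>"] by (simp add: card_image)
  qed
  then show ?thesis by blast
qed

text \<open>Each piece is nonempty and so meets some member of the family; the trace bounds add
  up.\<close>

lemma splits_boundedly_UN:
  assumes "finite I" and op: "\<And>i. i \<in> I \<Longrightarrow> openin T (U i)"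
    and spl: "\<And>i. i \<in> I \<Longrightarrow> splits_boundedly T (U i)"
  shows "splits_boundedly T (\<Union>i\<in>I. U i)"
proof -
  have "\<exists>N. \<forall>\<A> W. open_partition T W \<A> \<longrightarrow> U i \<subseteq> W \<longrightarrow> card {A \<in> \<A>. A \<inter> U i \<noteq> {}} \<le> N"
    if "i \<in> I" for i
    by (rule splits_boundedly_trace[OF spl[OF that] op[OF that]])
  then obtain N where N: "\<And>i \<A> W. i \<in> I \<Longrightarrow> open_partition T W \<A> \<Longrightarrow> U i \<subseteq> W \<Longrightarrow>
      card {A \<in> \<A>. A \<inter> U i \<noteq> {}} \<le> N i"
    using bchoice[of I "\<lambda>i N. \<forall>\<A> W. open_partition T W \<A> \<longrightarrow> U i \<subseteq> W \<longrightarrow>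
      card {A \<in> \<A>. A \<inter> U i \<noteq> {}} \<le> N"] by blast
  show ?thesis
  proof (rule splits_boundedlyI)
    fix \<A> assume \<A>: "open_partition T (\<Union>i\<in>I. U i) \<A>"
    have "\<A> = (\<Union>i\<in>I. {A \<in> \<A>. A \<inter> U i \<noteq> {}})"
      using \<A> unfolding open_partition_def by blast
    then have "card \<A> = card (\<Union>i\<in>I. {A \<in> \<A>. A \<inter> U i \<noteq> {}})" by (rule arg_cong)
    also have "\<dots> \<le> (\<Sum>i\<in>I. card {A \<in> \<A>. A \<inter> U i \<noteq> {}})"
      by (rule card_UN_le[OF assms(1)])
    also have "\<dots> \<le> (\<Sum>i\<in>I. N i)"
      by (intro sum_mono N[OF _ \<A>]) auto
    finally show "card \<A> \<le> (\<Sum>i\<in>I. N i)" .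
  qed
qed

text \<open>A partition of V pulls back to one of U with equally many pieces: surjectivity onto V
  keeps them nonempty, and continuity keeps them open.\<close>

lemma splits_boundedly_image:
  assumes f: "continuous_map X Y f" and U: "openin X U" "f ` U = V" and spl: "splits_boundedly X U"
  shows "splits_boundedly Y V"
proof -
  from spl obtain N where N: "\<And>\<A>. open_partition X U \<A> \<Longrightarrow> card \<A> \<le> N"
    by (auto simp: splits_boundedly_def)
  show ?thesis
  proof (rule splits_boundedlyI)
    fix \<A> assume \<A>: "open_partition Y V \<A>"
    let ?p = "\<lambda>A. {x \<in> U. f x \<in> A}"
    have ne: "?p A \<noteq> {}" if "A \<in> \<A>" for A
    proof -
      have "A \<noteq> {}" "A \<subseteq> f ` U" using \<A> U(2) that by (auto simp: open_partition_def)
      then show ?thesis by blast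
    qed
    have disj: "A \<inter> B = {}" if "A \<in> \<A>" "B \<in> \<A>" "A \<noteq> B" for A B
      using \<A> that unfolding open_partition_def pairwise_def disjnt_def by blast
    have op: "openin X (?p A)" if "A \<in> \<A>" for A
    proof -
      have "openin X ({x \<in> topspace X. f x \<in> A} \<inter> U)"
        using \<A> that f U(1) by (intro openin_Int openin_continuous_map_preimage) (auto simp: open_partition_def)
      moreover have "{x \<in> topspace X. f x \<in> A} \<inter> U = ?p A"
        using openin_subset[OF U(1)] by auto
      ultimately show ?thesis by simp
    qed
    have "open_partition X U (?p ` \<A>)"
      unfolding open_partition_def
    proof (intro conjI)
      show "finite (?p ` \<A>)" using \<A> by (simp add: open_partition_def)
      show "pairwise disjnt (?p ` \<A>)"
        unfolding pairwise_def disjnt_def using disj by blast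
      show "\<forall>A \<in> ?p ` \<A>. openin X A \<and> A \<noteq> {}" using op ne by auto
      show "\<Union>(?p ` \<A>) = U" using \<A> U(2) unfolding open_partition_def by auto
    qed
    moreover have "inj_on ?p \<A>"
    proof (rule inj_onI, rule ccontr)
      fix A B assume AB: "A \<in> \<A>" "B \<in> \<A>" "?p A = ?p B" "A \<noteq> B"
      from ne[OF AB(1)] obtain x where "x \<in> ?p A" by blast
      moreover from this have "x \<in> ?p B" using AB(3) by simp
      ultimately show False using disj[OF AB(1,2,4)] by blast
    qed
    ultimately show "card \<A> \<le> N"
      using N[of "?p ` \<A>"] by (simp add: card_image)
  qed
qed

lemma splits_boundedly_connectedin:
  assumes "connectedin T U"
  shows "splits_boundedly T U"
proof (rule splits_boundedlyI[of _ _ 1])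
  fix \<A> assume \<A>: "open_partition T U \<A>"
  have "A = B" if AB: "A \<in> \<A>" "B \<in> \<A>" for A B
  proof (rule ccontr)
    assume "A \<noteq> B"
    have "openin T A" "openin T (\<Union>(\<A> - {A}))" "A \<noteq> {}" "B \<noteq> {}"
      "U = A \<union> \<Union>(\<A> - {A})"
      using \<A> AB unfolding open_partition_def by blast+
    moreover have "A \<inter> \<Union>(\<A> - {A}) = {}"
      using \<A> AB unfolding open_partition_def pairwise_def disjnt_def by blast
    ultimately show False
      using assms AB \<open>A \<noteq> B\<close> unfolding connectedin by blast
  qed
  then show "card \<A> \<le> 1"
    using \<A> by (metis card_le_Suc0_iff_eq One_nat_def open_partition_def)
qed

lemma compact_open_finite_connected_cover:
  assumes "locally_connected_space T" "compactin T U" "openin T U"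
  obtains \<C> where "finite \<C>" "\<And>C. C \<in> \<C> \<Longrightarrow> openin T C \<and> connectedin T C" "\<Union>\<C> = U"
proof -
  have "\<forall>x \<in> U. \<exists>C. openin T C \<and> connectedin T C \<and> x \<in> C \<and> C \<subseteq> U"
    using assms(1,3) unfolding locally_connected_space by blast
  then obtain c where c: "\<And>x. x \<in> U \<Longrightarrow> openin T (c x) \<and> connectedin T (c x) \<and> x \<in> c x \<and> c x \<subseteq> U"
    by metis
  then have "(\<forall>C \<in> c ` U. openin T C) \<and> U \<subseteq> \<Union>(c ` U)" by blast
  then obtain \<F> where \<F>: "finite \<F>" "\<F> \<subseteq> c ` U" "U \<subseteq> \<Union>\<F>"
    using assms(2) unfolding compactin_def by meson
  show thesis
    by (rule that[of \<F>]) (use \<F> c in blast)+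
qed

lemma splits_boundedly_if_locally_connected:
  assumes "locally_connected_space T" "compactin T U" "openin T U"
  shows "splits_boundedly T U"
proof -
  obtain \<C> where "finite \<C>" "\<And>C. C \<in> \<C> \<Longrightarrow> openin T C \<and> connectedin T C" "\<Union>\<C> = U"
    using compact_open_finite_connected_cover[OF assms] by blast
  then show ?thesis
    using splits_boundedly_UN[of \<C> T "\<lambda>C. C"] splits_boundedly_connectedin by auto
qed

text \<open>In a partition with the largest possible number of pieces every piece is connected,
  since splitting one would increase the number.\<close>

lemma splits_boundedly_open_connected_nbhd:
  assumes "splits_boundedly T U" "openin T U" "x \<in> U"
  obtains C where "openin T C" "connectedin T C" "x \<in> C" "C \<subseteq> U"
proof -
  let ?P = "\<lambda>n. \<exists>\<A>. open_partition T U \<A> \<and> card \<A> = n"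
  obtain N where N: "\<And>n. ?P n \<Longrightarrow> n \<le> N"
    using assms(1) unfolding splits_boundedly_def by blast
  have "open_partition T U {U}"
    using assms(2,3) by (auto simp: open_partition_def)
  then have "?P 1" by (intro exI[of _ "{U}"]) auto
  then have "?P (Greatest ?P)"
    using N by (rule GreatestI_nat)
  then obtain \<A> where \<A>: "open_partition T U \<A>" "card \<A> = Greatest ?P" by blast
  have max: "card \<B> \<le> card \<A>" if "open_partition T U \<B>" for \<B>
    unfolding \<A>(2) by (rule Greatest_le_nat[of ?P _ N]) (use that N in blast)+
  from \<A>(1) assms(3) obtain C where C: "C \<in> \<A>" "x \<in> C"
    unfolding open_partition_def by blast
  have fin: "finite \<A>" and opn: "\<And>A. A \<in> \<A> \<Longrightarrow> openin T A \<and> A \<noteq> {}" and un: "\<Union>\<A> = U"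
    and disj: "\<And>A B. A \<in> \<A> \<Longrightarrow> B \<in> \<A> \<Longrightarrow> A \<noteq> B \<Longrightarrow> A \<inter> B = {}"
    using \<A>(1) unfolding open_partition_def pairwise_def disjnt_def by auto
  have "connectedin T C"
    unfolding connectedin
  proof (intro conjI notI)
    show "C \<subseteq> topspace T" using opn[OF C(1)] by (simp add: openin_subset)
    assume "\<exists>E1 E2. openin T E1 \<and> openin T E2 \<and> C \<subseteq> E1 \<union> E2 \<and> E1 \<inter> E2 \<inter> C = {} \<and>
      E1 \<inter> C \<noteq> {} \<and> E2 \<inter> C \<noteq> {}"
    then obtain E1 E2 where E: "openin T E1" "openin T E2" "C \<subseteq> E1 \<union> E2" "E1 \<inter> E2 \<inter> C = {}"
      "E1 \<inter> C \<noteq> {}" "E2 \<inter> C \<noteq> {}" by blast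
    define \<B> where "\<B> = {E1 \<inter> C, E2 \<inter> C} \<union> (\<A> - {C})"
    \<comment> \<open>The halves of C are nonempty and disjoint from all other pieces, so they are
      new members and the count grows by exactly one.\<close>
    have notin: "E1 \<inter> C \<notin> \<A> - {C}" "E2 \<inter> C \<notin> \<A> - {C}"
      using disj[OF C(1)] E(5,6) by blast+
    have "open_partition T U \<B>"
      unfolding open_partition_def pairwise_def disjnt_def
    proof (intro conjI ballI impI)
      show "finite \<B>" using fin by (simp add: \<B>_def)
      show "openin T B" "B \<noteq> {}" if "B \<in> \<B>" for B
        using that E opn C(1) unfolding \<B>_def by auto
      show "\<Union>\<B> = U"
        using un C(1) E(3) unfolding \<B>_def by auto
      show "A \<inter> B = {}" if "A \<in> \<B>" "B \<in> \<B>" "A \<noteq> B" for A B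
        using that disj C(1) E(4) unfolding \<B>_def by blast
    qed
    moreover have "card \<B> = card (\<A> - {C}) + 2"
    proof -
      have "E1 \<inter> C \<noteq> E2 \<inter> C" using E by blast
      then show ?thesis using notin fin by (simp add: \<B>_def)
    qed
    ultimately show False
      using max[of \<B>] card_Suc_Diff1[OF fin C(1)] by linarith
  qed
  then show thesis using that[of C] opn C un by blast
qed

text \<open>Pieces of a partition of \<open>U i\<close> that miss every other \<open>U j\<close> are clopen in \<open>W\<close>.\<close>

lemma splits_boundedly_member_of_cover:
  assumes I: "finite I" "i \<in> I"
    and op: "\<And>j. j \<in> I \<Longrightarrow> openin T (U j)"
    and W: "W = (\<Union>j\<in>I. U j)" "splits_boundedly T W"
    and int: "\<And>j. j \<in> I \<Longrightarrow> j \<noteq> i \<Longrightarrow> splits_boundedly T (U i \<inter> U j)"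
  shows "splits_boundedly T (U i)"
proof -
  \<comment> \<open>The overlap of \<open>U i\<close> with the other members splits boundedly as a
    finite union, which bounds the pieces that meet it. Only the pieces that miss it remain to be
    counted.\<close>
  define D where "D = (\<Union>j\<in>I - {i}. U i \<inter> U j)"
  have opij: "openin T (U i \<inter> U j)" if "j \<in> I - {i}" for j
    using that I(2) op by blast
  have "splits_boundedly T D"
    unfolding D_def by (rule splits_boundedly_UN) (use I opij int in auto)
  moreover have "openin T D"
    unfolding D_def using opij by blast
  ultimately obtain N where N: "\<And>\<A> V. open_partition T V \<A> \<Longrightarrow> D \<subseteq> V \<Longrightarrow> card {A \<in> \<A>. A \<inter> D \<noteq> {}} \<le> N"
    using splits_boundedly_trace[of T D] by blast
  from W(2) obtain M where M: "\<And>\<A>. open_partition T W \<A> \<Longrightarrow> card \<A> \<le> M"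
    by (auto simp: splits_boundedly_def)
  show ?thesis
  proof (rule splits_boundedlyI)
    fix \<A> assume \<A>: "open_partition T (U i) \<A>"
    have fin: "finite \<A>" and opn: "\<And>A. A \<in> \<A> \<Longrightarrow> openin T A \<and> A \<noteq> {}" and un: "\<Union>\<A> = U i"
      and disj: "\<And>A B. A \<in> \<A> \<Longrightarrow> B \<in> \<A> \<Longrightarrow> A \<noteq> B \<Longrightarrow> A \<inter> B = {}"
      using \<A> unfolding open_partition_def pairwise_def disjnt_def by auto
    let ?\<B> = "{A \<in> \<A>. A \<inter> D = {}}"
    \<comment> \<open>This set is open because it is also the union of the other \<open>U j\<close>
      and of the pieces meeting \<open>D\<close>. Hence it completes the pieces missing
      \<open>D\<close> to a partition of \<open>W\<close>.\<close>
    define R where "R = W - \<Union>?\<B>"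
    have "R = (\<Union>j\<in>I - {i}. U j) \<union> \<Union>{A \<in> \<A>. A \<inter> D \<noteq> {}}"
      (is "_ = ?R")
    proof (rule equalityI; rule subsetI)
      fix x assume "x \<in> R"
      then have x: "x \<in> W" "\<And>A. A \<in> \<A> \<Longrightarrow> A \<inter> D = {} \<Longrightarrow> x \<notin> A" by (auto simp: R_def)
      show "x \<in> ?R"
      proof (cases "x \<in> (\<Union>j\<in>I - {i}. U j)")
        case False
        then have "x \<in> U i" using x(1) W(1) by auto
        then obtain A where "A \<in> \<A>" "x \<in> A" using un by auto
        then show ?thesis using x(2)[of A] by auto
      qed (rule UnI1)
    next
      fix x assume x: "x \<in> ?R"
      then have xW: "x \<in> W" using un W(1) I(2) by blast
      have nA: "x \<notin> A" if A: "A \<in> ?\<B>" for A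
      proof
        assume xA: "x \<in> A"
        then have "x \<in> U i" "x \<notin> D" using A un by auto
        then have "x \<notin> (\<Union>j\<in>I - {i}. U j)" unfolding D_def by blast
        then obtain B where "B \<in> \<A>" "B \<inter> D \<noteq> {}" "x \<in> B" using x by blast
        then show False using disj[of A B] A xA by blast
      qed
      show "x \<in> R" unfolding R_def
      proof (rule DiffI[OF xW], rule notI)
        assume "x \<in> \<Union>?\<B>"
        then show False using nA by (elim UnionE) blast
      qed
    qed
    then have "openin T R"
      using op opn by (auto intro!: openin_Un openin_Union)
    then have "open_partition T W (?\<B> \<union> ({R} - {{}}))"
      unfolding open_partition_def
    proof (intro conjI)
      show "finite (?\<B> \<union> ({R} - {{}}))" using fin by simp
      show "pairwise disjnt (?\<B> \<union> ({R} - {{}}))"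
      proof (rule pairwiseI)
        fix A B assume AB: "A \<in> ?\<B> \<union> ({R} - {{}})" "B \<in> ?\<B> \<union> ({R} - {{}})" "A \<noteq> B"
        have *: "C \<inter> R = {}" if "C \<in> ?\<B>" for C using that by (auto simp: R_def)
        consider "A \<in> ?\<B>" "B \<in> ?\<B>" | "A = R" "B \<in> ?\<B>" | "A \<in> ?\<B>" "B = R"
          using AB by blast
        then show "disjnt A B"
        proof cases
          case 1
          then have "A \<inter> B = {}" using AB(3) by (intro disj) simp_all
          then show ?thesis by (simp add: disjnt_def)
        next
          case 2
          with *[of B] show ?thesis by (simp add: disjnt_def Int_commute)
        next
          case 3
          with *[of A] show ?thesis by (simp add: disjnt_def)
        qed
      qed
      show "\<forall>A \<in> ?\<B> \<union> ({R} - {{}}). openin T A \<and> A \<noteq> {}" using opn \<open>openin T R\<close> by auto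
      have "\<Union>?\<B> \<subseteq> W" using un W(1) I(2) by auto
      then show "\<Union>(?\<B> \<union> ({R} - {{}})) = W" by (auto simp: R_def)
    qed
    then have "card (?\<B> \<union> ({R} - {{}})) \<le> M" by (rule M)
    moreover have "card ?\<B> \<le> card (?\<B> \<union> ({R} - {{}}))"
      using fin by (intro card_mono) auto
    moreover have "card {A \<in> \<A>. A \<inter> D \<noteq> {}} \<le> N"
      by (rule N[OF \<A>]) (auto simp: D_def)
    moreover have "card \<A> = card ?\<B> + card {A \<in> \<A>. A \<inter> D \<noteq> {}}"
      using fin by (subst card_Un_disjoint[symmetric]) (auto intro: arg_cong[of _ _ card])
    ultimately show "card \<A> \<le> M + N" by linarith
  qed
qed

section \<open>Irreducible sets\<close>

lemma irreducible_inD: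
  assumes "irreducible_in T Z" "closedin T C" "closedin T D" "Z \<subseteq> C \<union> D"
  shows "Z \<subseteq> C \<or> Z \<subseteq> D"
  using assms unfolding irreducible_in_def by blast

lemma irreducible_in_subset: "irreducible_in T Z \<Longrightarrow> Z \<subseteq> topspace T"
  by (simp add: irreducible_in_def)

lemma irreducible_in_nonempty: "irreducible_in T Z \<Longrightarrow> Z \<noteq> {}"
  by (simp add: irreducible_in_def)

lemma irreducible_in_finite_Union:
  assumes "irreducible_in T Z" "finite \<C>" "\<And>C. C \<in> \<C> \<Longrightarrow> closedin T C" "Z \<subseteq> \<Union>\<C>"
  shows "\<exists>C \<in> \<C>. Z \<subseteq> C"
  using assms(2-)
proof (induction \<C>)
  case empty
  then show ?case using irreducible_in_nonempty[OF assms(1)] by auto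
next
  case (insert C \<C>)
  have "closedin T (\<Union>\<C>)" using insert by (intro closedin_Union) auto
  then have "Z \<subseteq> C \<or> Z \<subseteq> \<Union>\<C>"
    using insert.prems by (intro irreducible_inD[OF assms(1)]) auto
  then show ?case using insert by auto
qed

lemma irreducible_in_image:
  assumes f: "continuous_map X Y f" and Z: "irreducible_in X Z"
  shows "irreducible_in Y (f ` Z)"
  unfolding irreducible_in_def
proof (intro conjI allI impI)
  have sub: "Z \<subseteq> topspace X" by (rule irreducible_in_subset[OF Z])
  show "f ` Z \<subseteq> topspace Y" "f ` Z \<noteq> {}"
    using continuous_map_image_subset_topspace[OF f] sub irreducible_in_nonempty[OF Z] by auto
  fix C D assume CD: "closedin Y C \<and> closedin Y D \<and> f ` Z \<subseteq> C \<union> D"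
  let ?p = "\<lambda>C. {x \<in> topspace X. f x \<in> C}"
  have "Z \<subseteq> ?p C \<or> Z \<subseteq> ?p D"
    using CD sub f by (intro irreducible_inD[OF Z] closedin_continuous_map_preimage) auto
  then show "f ` Z \<subseteq> C \<or> f ` Z \<subseteq> D" by auto
qed

lemma irreducible_in_closure:
  assumes Z: "irreducible_in T Z"
  shows "irreducible_in T (T closure_of Z)"
  unfolding irreducible_in_def
proof (intro conjI allI impI)
  have sub: "Z \<subseteq> T closure_of Z" by (rule closure_of_subset[OF irreducible_in_subset[OF Z]])
  show "T closure_of Z \<subseteq> topspace T" by (rule closure_of_subset_topspace)
  show "T closure_of Z \<noteq> {}" using sub irreducible_in_nonempty[OF Z] by auto
  fix C D assume CD: "closedin T C \<and> closedin T D \<and> T closure_of Z \<subseteq> C \<union> D"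
  then have "Z \<subseteq> C \<or> Z \<subseteq> D" using sub by (intro irreducible_inD[OF Z]) auto
  then show "T closure_of Z \<subseteq> C \<or> T closure_of Z \<subseteq> D"
    using CD closure_of_minimal[of Z C T] closure_of_minimal[of Z D T] by auto
qed

lemma irreducible_component_of_irreducible:
  "irreducible_component_of T Z \<Longrightarrow> irreducible_in T Z"
  by (simp add: irreducible_component_of_def)

lemma irreducible_component_of_maximal:
  "irreducible_component_of T Z \<Longrightarrow> irreducible_in T Z' \<Longrightarrow> Z \<subseteq> Z' \<Longrightarrow> Z' = Z"
  by (simp add: irreducible_component_of_def)

text \<open>By Zorn: the union of a chain of irreducible sets is irreducible, for if one member is
  not inside C and another not inside D, the larger of the two is inside neither.\<close>

lemma irreducible_in_subset_component:
  assumes Z: "irreducible_in T Z"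
  obtains Z' where "irreducible_component_of T Z'" "Z \<subseteq> Z'"
proof -
  let ?\<S> = "{Z'. irreducible_in T Z' \<and> Z \<subseteq> Z'}"
  have "\<exists>M\<in>?\<S>. \<forall>X\<in>?\<S>. M \<subseteq> X \<longrightarrow> X = M"
  proof (rule subset_Zorn_nonempty)
    show "?\<S> \<noteq> {}" using Z by blast
    fix \<C> assume ne: "\<C> \<noteq> {}" and ch: "subset.chain ?\<S> \<C>"
    then have sub: "\<C> \<subseteq> ?\<S>" and lin: "\<And>A B. A \<in> \<C> \<Longrightarrow> B \<in> \<C> \<Longrightarrow> A \<subseteq> B \<or> B \<subseteq> A"
      unfolding subset_chain_def by blast+
    obtain A0 where A0: "A0 \<in> \<C>" using ne by blast
    have "irreducible_in T (\<Union>\<C>)"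
      unfolding irreducible_in_def
    proof (intro conjI allI impI)
      show "\<Union>\<C> \<subseteq> topspace T" using sub irreducible_in_subset by blast
      show "\<Union>\<C> \<noteq> {}" using A0 sub irreducible_in_nonempty by blast
      fix C D assume CD: "closedin T C \<and> closedin T D \<and> \<Union>\<C> \<subseteq> C \<union> D"
      have or: "A \<subseteq> C \<or> A \<subseteq> D" if "A \<in> \<C>" for A
        using CD that sub by (intro irreducible_inD[of T]) auto
      show "\<Union>\<C> \<subseteq> C \<or> \<Union>\<C> \<subseteq> D"
      proof (rule ccontr)
        assume "\<not> ?thesis"
        then obtain A B where "A \<in> \<C>" "\<not> A \<subseteq> C" "B \<in> \<C>" "\<not> B \<subseteq> D" by blast
        then show False using lin[of A B] or[of A] or[of B] by blast
      qed
    qed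
    then show "\<Union>\<C> \<in> ?\<S>" using A0 sub by blast
  qed
  then obtain M where M: "M \<in> ?\<S>" "\<forall>X\<in>?\<S>. M \<subseteq> X \<longrightarrow> X = M" by (rule bexE)
  then have "irreducible_component_of T M" unfolding irreducible_component_of_def by auto
  then show thesis using M(1) by (intro that[of M]) auto
qed

lemma irreducible_component_of_closed:
  assumes "irreducible_component_of T Z"
  shows "T closure_of Z = Z"
  using assms irreducible_in_closure[of T Z] closure_of_subset[of Z T]
  by (simp add: irreducible_component_of_def irreducible_in_def)

lemma irreducible_in_subtopology:
  "irreducible_in (subtopology T S) Z \<longleftrightarrow> Z \<subseteq> S \<and> irreducible_in T Z"
proof
  assume L: "irreducible_in (subtopology T S) Z"
  have "irreducible_in T ((\<lambda>x. x) ` Z)"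
    by (rule irreducible_in_image[OF _ L]) (simp add: continuous_map_from_subtopology)
  then show "Z \<subseteq> S \<and> irreducible_in T Z"
    using irreducible_in_subset[OF L] by auto
next
  assume R: "Z \<subseteq> S \<and> irreducible_in T Z"
  show "irreducible_in (subtopology T S) Z"
    unfolding irreducible_in_def
  proof (intro conjI allI impI)
    show "Z \<subseteq> topspace (subtopology T S)" "Z \<noteq> {}"
      using R by (auto simp: irreducible_in_def)
    fix C D assume "closedin (subtopology T S) C \<and> closedin (subtopology T S) D \<and> Z \<subseteq> C \<union> D"
    then obtain C' D' where CD: "closedin T C'" "closedin T D'" "C = C' \<inter> S" "D = D' \<inter> S"
      "Z \<subseteq> C \<union> D"
      unfolding closedin_subtopology by blast
    then have "Z \<subseteq> C' \<or> Z \<subseteq> D'"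
      using R by (intro irreducible_inD[of T]) auto
    then show "Z \<subseteq> C \<or> Z \<subseteq> D" using R CD by auto
  qed
qed

text \<open>Z is covered by the complement of U together with any closed set containing the trace of
  Z on U, so such a closed set contains Z. Both conclusions come from this density of the
  trace.\<close>

lemma irreducible_in_open_Int:
  assumes Z: "irreducible_in T Z" and U: "openin T U" "Z \<inter> U \<noteq> {}"
  shows "irreducible_in T (Z \<inter> U)" "Z \<subseteq> T closure_of (Z \<inter> U)"
proof -
  have sub: "Z \<subseteq> topspace T" by (rule irreducible_in_subset[OF Z])
  have cl: "closedin T (topspace T - U)" using U(1) by blast
  have *: "Z \<subseteq> C" if "closedin T C" "Z \<inter> U \<subseteq> C" for C
  proof -
    have "Z \<subseteq> C \<or> Z \<subseteq> topspace T - U"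
      using sub that by (intro irreducible_inD[OF Z that(1) cl]) auto
    then show ?thesis using U(2) by auto
  qed
  show "Z \<subseteq> T closure_of (Z \<inter> U)"
    using sub by (intro * closure_of_subset) auto
  show "irreducible_in T (Z \<inter> U)"
    unfolding irreducible_in_def
  proof (intro conjI allI impI)
    show "Z \<inter> U \<subseteq> topspace T" using sub by auto
    show "Z \<inter> U \<noteq> {}" by (rule U(2))
    fix C D assume CD: "closedin T C \<and> closedin T D \<and> Z \<inter> U \<subseteq> C \<union> D"
    then have "Z \<subseteq> C \<union> D" by (intro *) auto
    then show "Z \<inter> U \<subseteq> C \<or> Z \<inter> U \<subseteq> D"
      using CD irreducible_inD[OF Z, of C D] by auto
  qed
qed

text \<open>Closure undoes the trace: an irreducible subset of U that contains the trace has an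
  irreducible closure that contains Z, hence equals Z.\<close>

lemma irreducible_component_of_Int_open:
  assumes Z: "irreducible_component_of T Z" and U: "openin T U" "Z \<inter> U \<noteq> {}"
  shows "irreducible_component_of (subtopology T U) (Z \<inter> U)"
  unfolding irreducible_component_of_def irreducible_in_subtopology
proof (intro conjI allI impI)
  note irr = irreducible_in_open_Int[OF irreducible_component_of_irreducible[OF Z] U]
  show "Z \<inter> U \<subseteq> U" "irreducible_in T (Z \<inter> U)" using irr by auto
  fix Z' assume Z': "(Z' \<subseteq> U \<and> irreducible_in T Z') \<and> Z \<inter> U \<subseteq> Z'"
  have "Z \<subseteq> T closure_of Z'"
    using irr(2) closure_of_mono[of "Z \<inter> U" Z' T] Z' by blast
  then have "T closure_of Z' = Z"
    using Z Z' irreducible_in_closure irreducible_component_of_maximal by blast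
  moreover have "Z' \<subseteq> T closure_of Z'"
    using Z' by (intro closure_of_subset irreducible_in_subset) auto
  ultimately show "Z' = Z \<inter> U" using Z' by blast
qed

lemma irreducible_component_of_subtopologyE:
  assumes Z: "irreducible_component_of (subtopology T U) Z" and U: "openin T U"
  obtains Z' where "irreducible_component_of T Z'" "Z = Z' \<inter> U"
proof -
  have irr: "Z \<subseteq> U" "irreducible_in T Z"
    using irreducible_component_of_irreducible[OF Z] by (simp_all add: irreducible_in_subtopology)
  then obtain Z' where Z': "irreducible_component_of T Z'" "Z \<subseteq> Z'"
    using irreducible_in_subset_component by blast
  have ne: "Z' \<inter> U \<noteq> {}" using irr Z' irreducible_in_nonempty by blast
  have "irreducible_in (subtopology T U) (Z' \<inter> U)"
    by (rule irreducible_component_of_irreducible[OF irreducible_component_of_Int_open[OF Z'(1) U ne]])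
  then have "Z' \<inter> U = Z"
    using irreducible_component_of_maximal[OF Z] irr Z'(2) by blast
  then show thesis using that Z'(1) by blast
qed

lemma loc_fin_many_irred_components_open_subset:
  assumes T: "loc_fin_many_irred_components T" and U: "openin T U"
  shows "loc_fin_many_irred_components (subtopology T U)"
  unfolding loc_fin_many_irred_components_def
proof
  fix x assume "x \<in> topspace (subtopology T U)"
  then have x: "x \<in> topspace T" "x \<in> U" by auto
  then obtain V where V: "openin T V" "x \<in> V"
    and fin: "finite {Z. irreducible_component_of T Z \<and> Z \<inter> V \<noteq> {}}" (is "finite ?F")
    using T unfolding loc_fin_many_irred_components_def by blast
  have "{Z. irreducible_component_of (subtopology T U) Z \<and> Z \<inter> (V \<inter> U) \<noteq> {}} \<subseteq> (\<lambda>Z. Z \<inter> U) ` ?F"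
    by (auto elim!: irreducible_component_of_subtopologyE[OF _ U])
  then have "finite {Z. irreducible_component_of (subtopology T U) Z \<and> Z \<inter> (V \<inter> U) \<noteq> {}}"
    using fin finite_subset by blast
  then show "\<exists>V. openin (subtopology T U) V \<and> x \<in> V \<and>
      finite {Z. irreducible_component_of (subtopology T U) Z \<and> Z \<inter> V \<noteq> {}}"
    using V x U by (intro exI[of _ "V \<inter> U"]) (auto simp: openin_subtopology)
qed

text \<open>A component of T meeting U is the closure of its trace on U, so the finitely many traces
  near a point come from finitely many components.\<close>

lemma loc_fin_many_irred_components_cover:
  assumes cov: "\<Union>\<U> = topspace T"
    and U: "\<And>U. U \<in> \<U> \<Longrightarrow> openin T U \<and> loc_fin_many_irred_components (subtopology T U)"
  shows "loc_fin_many_irred_components T"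
  unfolding loc_fin_many_irred_components_def
proof
  fix x assume "x \<in> topspace T"
  then obtain U where xU: "U \<in> \<U>" "x \<in> U" using cov by blast
  have opU: "openin T U" and "U \<subseteq> topspace T" using U[OF xU(1)] openin_subset by blast+
  then have "x \<in> topspace (subtopology T U)" using xU by auto
  then obtain V where V: "openin (subtopology T U) V" "x \<in> V"
    and fin: "finite {Z. irreducible_component_of (subtopology T U) Z \<and> Z \<inter> V \<noteq> {}}" (is "finite ?F")
    using U[OF xU(1)] unfolding loc_fin_many_irred_components_def by blast
  have opV: "openin T V" and VU: "V \<subseteq> U"
    using V(1) opU openin_open_subtopology by blast+
  have "{Z. irreducible_component_of T Z \<and> Z \<inter> V \<noteq> {}} \<subseteq> (\<lambda>Z. T closure_of Z) ` ?F"
  proof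
    fix Z assume "Z \<in> {Z. irreducible_component_of T Z \<and> Z \<inter> V \<noteq> {}}"
    then have Z: "irreducible_component_of T Z" "Z \<inter> V \<noteq> {}" by auto
    then have ne: "Z \<inter> U \<noteq> {}" using VU by blast
    have "Z \<subseteq> T closure_of (Z \<inter> U)"
      by (rule irreducible_in_open_Int[OF irreducible_component_of_irreducible[OF Z(1)] opU ne])
    moreover have "T closure_of (Z \<inter> U) \<subseteq> Z"
      using irreducible_component_of_closed[OF Z(1)] closure_of_mono[of "Z \<inter> U" Z T] by auto
    moreover have "Z \<inter> U \<in> ?F"
      using irreducible_component_of_Int_open[OF Z(1) opU ne] Z(2) VU by blast
    ultimately show "Z \<in> (\<lambda>Z. T closure_of Z) ` ?F" by blast
  qed
  then have "finite {Z. irreducible_component_of T Z \<and> Z \<inter> V \<noteq> {}}"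
    using fin finite_subset by blast
  then show "\<exists>V. openin T V \<and> x \<in> V \<and> finite {Z. irreducible_component_of T Z \<and> Z \<inter> V \<noteq> {}}"
    using opV V(2) by blast
qed

lemma compact_space_finite_cover:
  assumes T: "compact_space T" and P: "\<And>x. x \<in> topspace T \<Longrightarrow> \<exists>U. openin T U \<and> x \<in> U \<and> P U"
  shows "\<exists>\<F>. finite \<F> \<and> topspace T \<subseteq> \<Union>\<F> \<and> (\<forall>U \<in> \<F>. openin T U \<and> P U)"
proof -
  let ?\<U> = "{U. openin T U \<and> P U}"
  have "\<forall>\<U>. (\<forall>U \<in> \<U>. openin T U) \<and> topspace T \<subseteq> \<Union>\<U> \<longrightarrow>
      (\<exists>\<F>. finite \<F> \<and> \<F> \<subseteq> \<U> \<and> topspace T \<subseteq> \<Union>\<F>)"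
    using T by (simp add: compact_space_def compactin_def)
  moreover have "(\<forall>U \<in> ?\<U>. openin T U) \<and> topspace T \<subseteq> \<Union>?\<U>" using P by blast
  ultimately have "\<exists>\<F>. finite \<F> \<and> \<F> \<subseteq> ?\<U> \<and> topspace T \<subseteq> \<Union>\<F>" by (elim allE impE)
  then show ?thesis by blast
qed

lemma finite_irreducible_components_compact_space:
  assumes "loc_fin_many_irred_components T" "compact_space T"
  shows "finite {Z. irreducible_component_of T Z}"
proof -
  obtain \<F> where \<F>: "finite \<F>" "topspace T \<subseteq> \<Union>\<F>"
    and u: "\<And>U. U \<in> \<F> \<Longrightarrow> finite {Z. irreducible_component_of T Z \<and> Z \<inter> U \<noteq> {}}"
    using compact_space_finite_cover[OF assms(2), of
        "\<lambda>U. finite {Z. irreducible_component_of T Z \<and> Z \<inter> U \<noteq> {}}"] assms(1)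
    unfolding loc_fin_many_irred_components_def by blast
  have "{Z. irreducible_component_of T Z} \<subseteq>
      (\<Union>U\<in>\<F>. {Z. irreducible_component_of T Z \<and> Z \<inter> U \<noteq> {}})"
  proof
    fix Z assume "Z \<in> {Z. irreducible_component_of T Z}"
    then have Z: "irreducible_component_of T Z" by simp
    then have "Z \<noteq> {}" "Z \<subseteq> topspace T"
      by (auto simp: irreducible_component_of_def irreducible_in_def)
    then obtain z where "z \<in> Z" "z \<in> \<Union>\<F>" using \<F>(2) by blast
    then show "Z \<in> (\<Union>U\<in>\<F>. {Z. irreducible_component_of T Z \<and> Z \<inter> U \<noteq> {}})"
      using Z by blast
  qed
  moreover have "finite (\<Union>U\<in>\<F>. {Z. irreducible_component_of T Z \<and> Z \<inter> U \<noteq> {}})"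
    using \<F> u by (intro finite_UN_I) auto
  ultimately show ?thesis by (rule finite_subset)
qed

text \<open>Compactness leaves finitely many components in X. The closures of their images are
  irreducible and cover Y, so each component of Y lies in one of them and equals it by
  maximality.\<close>

lemma loc_fin_many_irred_components_image:
  assumes f: "continuous_map X Y f" "f ` topspace X = topspace Y"
    and X: "loc_fin_many_irred_components X" "compact_space X"
  shows "loc_fin_many_irred_components Y"
proof -
  have fin: "finite {Z. irreducible_component_of X Z}" (is "finite ?\<Z>")
    by (rule finite_irreducible_components_compact_space[OF X])
  have "{W. irreducible_component_of Y W} \<subseteq> (\<lambda>Z. Y closure_of (f ` Z)) ` ?\<Z>"
  proof
    fix W assume "W \<in> {W. irreducible_component_of Y W}"
    then have W: "irreducible_component_of Y W" by simp
    let ?\<C> = "(\<lambda>Z. Y closure_of (f ` Z)) ` ?\<Z>"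
    have "\<exists>C \<in> ?\<C>. W \<subseteq> C"
    proof (rule irreducible_in_finite_Union[OF irreducible_component_of_irreducible[OF W]])
      show "finite ?\<C>" using fin by simp
      show "closedin Y C" if "C \<in> ?\<C>" for C using that by auto
      show "W \<subseteq> \<Union>?\<C>"
      proof
        fix w assume "w \<in> W"
        then have "w \<in> topspace Y"
          using irreducible_in_subset[OF irreducible_component_of_irreducible[OF W]] by blast
        then obtain x where x: "x \<in> topspace X" "w = f x" using f(2) by blast
        \<comment> \<open>Points are irreducible, so every point of X lies in some
          component.\<close>
        have "irreducible_in X {x}" using x(1) by (auto simp: irreducible_in_def)
        then obtain Z where Z: "irreducible_component_of X Z" "{x} \<subseteq> Z"
          by (rule irreducible_in_subset_component)
        have "f ` Z \<subseteq> Y closure_of (f ` Z)"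
          by (intro closure_of_subset irreducible_in_subset irreducible_in_image[OF f(1)]
              irreducible_component_of_irreducible Z(1))
        then show "w \<in> \<Union>?\<C>" using x Z by blast
      qed
    qed
    then obtain Z where Z: "irreducible_component_of X Z" "W \<subseteq> Y closure_of (f ` Z)" by blast
    have "irreducible_in Y (Y closure_of (f ` Z))"
      by (intro irreducible_in_closure irreducible_in_image[OF f(1)]
          irreducible_component_of_irreducible Z(1))
    then have "Y closure_of (f ` Z) = W"
      using irreducible_component_of_maximal[OF W] Z(2) by blast
    then show "W \<in> ?\<C>" using Z(1) by blast
  qed
  then have "finite {W. irreducible_component_of Y W}"
    using fin finite_subset by blast
  then have "finite {W. irreducible_component_of Y W \<and> W \<inter> topspace Y \<noteq> {}}"
    by (rule rev_finite_subset) blast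
  then show ?thesis
    unfolding loc_fin_many_irred_components_def by blast
qed

section \<open>Noetherian spaces\<close>

text \<open>The closures in T of the chain members form a descending chain, and each member is
  recovered as the trace on S of its closure.\<close>

lemma noetherian_top_subtopology:
  assumes T: "noetherian_top T" and S: "S \<subseteq> topspace T"
  shows "noetherian_top (subtopology T S)"
  unfolding noetherian_top_def
proof (intro allI impI, elim conjE)
  fix C assume C: "\<forall>n. closedin (subtopology T S) (C n)" "\<forall>n. C (Suc n) \<subseteq> C n"
  have sub: "C n \<subseteq> topspace T" for n
    using C(1) closedin_subset[of "subtopology T S" "C n"] by auto
  have eq: "C n = S \<inter> T closure_of (C n)" for n
  proof -
    obtain D where D: "closedin T D" "C n = D \<inter> S"
      using C(1) unfolding closedin_subtopology by blast
    then have "T closure_of (C n) \<subseteq> D" by (intro closure_of_minimal) auto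
    then show ?thesis using D closure_of_subset[OF sub, of n] by blast
  qed
  have "\<forall>n. T closure_of C (Suc n) \<subseteq> T closure_of C n"
    using C(2) by (simp add: closure_of_mono)
  then have "\<exists>N. \<forall>n \<ge> N. T closure_of (C n) = T closure_of (C N)"
    by (intro T[unfolded noetherian_top_def, rule_format]) auto
  then obtain N where N: "\<And>n. n \<ge> N \<Longrightarrow> T closure_of (C n) = T closure_of (C N)" by blast
  have "C n = C N" if "n \<ge> N" for n
    using eq[of n] eq[of N] N[OF that] by simp
  then show "\<exists>N. \<forall>n \<ge> N. C n = C N" by blast
qed

text \<open>The chain is pulled back to X, where it stabilises, and surjectivity recovers each
  member from its preimage.\<close>

lemma noetherian_top_image:
  assumes f: "continuous_map X Y f" "f ` topspace X = topspace Y" and X: "noetherian_top X"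
  shows "noetherian_top Y"
  unfolding noetherian_top_def
proof (intro allI impI, elim conjE)
  fix C assume C: "\<forall>n. closedin Y (C n)" "\<forall>n. C (Suc n) \<subseteq> C n"
  let ?p = "\<lambda>n. {x \<in> topspace X. f x \<in> C n}"
  have "\<exists>N. \<forall>n \<ge> N. ?p n = ?p N"
    using C f(1) by (intro X[unfolded noetherian_top_def, rule_format])
      (auto intro: closedin_continuous_map_preimage)
  then obtain N where N: "\<And>n. n \<ge> N \<Longrightarrow> ?p n = ?p N" by blast
  have im: "C n = f ` ?p n" for n
  proof -
    have "C n \<subseteq> f ` topspace X" using closedin_subset[of Y "C n"] C(1) f(2) by simp
    then show ?thesis by blast
  qed
  have "C n = C N" if "n \<ge> N" for n
    using im[of n] im[of N] N[OF that] by simp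
  then show "\<exists>N. \<forall>n \<ge> N. C n = C N" by blast
qed

lemma locally_noetherian_top_open_subset:
  assumes T: "locally_noetherian_top T" and U: "openin T U"
  shows "locally_noetherian_top (subtopology T U)"
  unfolding locally_noetherian_top_def
proof
  fix x assume "x \<in> topspace (subtopology T U)"
  then have x: "x \<in> topspace T" "x \<in> U" by auto
  then obtain V where V: "openin T V" "x \<in> V" "noetherian_top (subtopology T V)"
    using T unfolding locally_noetherian_top_def by blast
  have "noetherian_top (subtopology (subtopology T V) (V \<inter> U))"
    using V(1) openin_subset[OF V(1)] by (intro noetherian_top_subtopology[OF V(3)]) auto
  then have "noetherian_top (subtopology (subtopology T U) (V \<inter> U))"
    by (simp add: subtopology_subtopology inf_commute inf_left_commute)
  then show "\<exists>W. openin (subtopology T U) W \<and> x \<in> W \<and> noetherian_top (subtopology (subtopology T U) W)"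
    using V x by (intro exI[of _ "V \<inter> U"]) (auto simp: openin_subtopology)
qed

lemma locally_noetherian_top_cover:
  assumes cov: "\<Union>\<U> = topspace T"
    and U: "\<And>U. U \<in> \<U> \<Longrightarrow> openin T U \<and> locally_noetherian_top (subtopology T U)"
  shows "locally_noetherian_top T"
  unfolding locally_noetherian_top_def
proof
  fix x assume "x \<in> topspace T"
  then obtain U where xU: "U \<in> \<U>" "x \<in> U" using cov by blast
  have opU: "openin T U" and "U \<subseteq> topspace T" using U[OF xU(1)] openin_subset by blast+
  then have "x \<in> topspace (subtopology T U)" using xU by auto
  then obtain V where V: "openin (subtopology T U) V" "x \<in> V"
      "noetherian_top (subtopology (subtopology T U) V)"
    using U[OF xU(1)] unfolding locally_noetherian_top_def by blast
  have "openin T V" "V \<subseteq> U"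
    using V(1) opU openin_open_subtopology by blast+
  moreover from this have "subtopology (subtopology T U) V = subtopology T V"
    by (simp add: subtopology_subtopology inf_absorb2)
  ultimately show "\<exists>V. openin T V \<and> x \<in> V \<and> noetherian_top (subtopology T V)"
    using V by auto
qed

lemma noetherian_top_finite_cover:
  assumes "finite \<F>" "topspace T \<subseteq> \<Union>\<F>" and U: "\<And>U. U \<in> \<F> \<Longrightarrow> noetherian_top (subtopology T U)"
  shows "noetherian_top T"
  unfolding noetherian_top_def
proof (intro allI impI, elim conjE)
  fix C assume C: "\<forall>n. closedin T (C n)" "\<forall>n. C (Suc n) \<subseteq> C n"
  have "\<exists>N. \<forall>n \<ge> N. C n \<inter> U = C N \<inter> U" if "U \<in> \<F>" for U
    using C by (intro U[OF that, unfolded noetherian_top_def, rule_format])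
      (auto simp: closedin_subtopology)
  then obtain N where N: "\<And>U n. U \<in> \<F> \<Longrightarrow> n \<ge> N U \<Longrightarrow> C n \<inter> U = C (N U) \<inter> U" by metis
  \<comment> \<open>The extra 0 keeps \<open>Max\<close> meaningful when the cover is empty.\<close>
  define M where "M = Max (insert 0 (N ` \<F>))"
  have M: "N U \<le> M" if "U \<in> \<F>" for U
    unfolding M_def using assms(1) that by (intro Max_ge) auto
  have "C n = C M" if "n \<ge> M" for n
  proof -
    have "C n \<inter> U = C M \<inter> U" if "U \<in> \<F>" for U
      using N[OF that, of n] N[OF that, of M] M[OF that] \<open>n \<ge> M\<close> by simp
    moreover have "C n \<subseteq> \<Union>\<F>" "C M \<subseteq> \<Union>\<F>"
      using C(1) closedin_subset assms(2) by blast+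
    ultimately show ?thesis by blast
  qed
  then show "\<exists>N. \<forall>n \<ge> N. C n = C N" by blast
qed

text \<open>Neighbourhoods in X need not map to neighbourhoods in Y. Compactness makes X Noetherian
  as a whole, and this global property passes to Y.\<close>

lemma locally_noetherian_top_image:
  assumes f: "continuous_map X Y f" "f ` topspace X = topspace Y"
    and X: "locally_noetherian_top X" "compact_space X"
  shows "locally_noetherian_top Y"
proof -
  obtain \<F> where "finite \<F>" "topspace X \<subseteq> \<Union>\<F>"
    "\<And>U. U \<in> \<F> \<Longrightarrow> noetherian_top (subtopology X U)"
    using compact_space_finite_cover[OF X(2), of "\<lambda>U. noetherian_top (subtopology X U)"] X(1)
    unfolding locally_noetherian_top_def by blast
  then have "noetherian_top X" by (rule noetherian_top_finite_cover)
  then have "noetherian_top Y" by (rule noetherian_top_image[OF f])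
  then show ?thesis
    unfolding locally_noetherian_top_def
    by (intro ballI exI[of _ "topspace Y"] conjI openin_topspace)
      (simp_all only: subtopology_topspace)
qed

section \<open>Local connectedness of open covers\<close>

lemma locally_connected_space_cover:
  assumes cov: "\<Union>\<U> = topspace T"
    and U: "\<And>U. U \<in> \<U> \<Longrightarrow> openin T U \<and> locally_connected_space (subtopology T U)"
  shows "locally_connected_space T"
  unfolding locally_connected_space
proof (intro allI impI, elim conjE)
  fix V x assume V: "openin T V" "x \<in> V"
  then obtain U where xU: "U \<in> \<U>" "x \<in> U" using cov openin_subset by blast
  then have *: "openin (subtopology T U) (V \<inter> U) \<and> x \<in> V \<inter> U"
    using V by (auto simp: openin_subtopology)
  have "locally_connected_space (subtopology T U)" using U[OF xU(1)] by simp
  from this[unfolded locally_connected_space, rule_format, OF *] obtain C where C: "openin (subtopology T U) C" "connectedin (subtopology T U) C" "x \<in> C"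
      "C \<subseteq> V \<inter> U"
    by blast
  then have "openin T C" "connectedin T C"
    using U[OF xU(1)] by (auto simp: openin_open_subtopology connectedin_subtopology)
  then show "\<exists>U. openin T U \<and> connectedin T U \<and> x \<in> U \<and> U \<subseteq> V"
    using C by blast
qed

section \<open>Ascent of the three properties along a finite group quotient\<close>

section \<open>Quotients by finite groups\<close>

text \<open>This is the topological content of the situation in (i): \<open>fibre\<close> records
  the surjectivity onto the fibre product and \<open>f_closed\<close> the integrality. The arguments
  in the locale involve no sheaves.\<close>

locale finite_group_quotient =
  fixes G :: "('g, 'm) monoid_scheme" (structure)
    and X :: "'p topology" and Y :: "'q topology" and f :: "'p \<Rightarrow> 'q" and act :: "'g \<Rightarrow> 'p \<Rightarrow> 'p"
  assumes group: "group G" and fin: "finite (carrier G)"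
    and act_cont: "g \<in> carrier G \<Longrightarrow> continuous_map X X (act g)"
    and act_one: "x \<in> topspace X \<Longrightarrow> act \<one> x = x"
    and act_mult: "\<lbrakk>g \<in> carrier G; h \<in> carrier G; x \<in> topspace X\<rbrakk> \<Longrightarrow> act g (act h x) = act (g \<otimes> h) x"
    and f_cont: "continuous_map X Y f"
    and f_closed: "closed_map X Y f"
    and f_surj: "f ` topspace X = topspace Y"
    and fibre: "\<lbrakk>x \<in> topspace X; x' \<in> topspace X\<rbrakk> \<Longrightarrow>
      f x = f x' \<longleftrightarrow> (\<exists>g \<in> carrier G. x = act g x')"
begin

sublocale group G by (rule group)

lemma act_closed: "g \<in> carrier G \<Longrightarrow> x \<in> topspace X \<Longrightarrow> act g x \<in> topspace X"
  using continuous_map_image_subset_topspace[OF act_cont] by blast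

lemma act_inv: "g \<in> carrier G \<Longrightarrow> x \<in> topspace X \<Longrightarrow> act (inv g) (act g x) = x"
  by (simp add: act_mult act_one)

lemma act_inv': "g \<in> carrier G \<Longrightarrow> x \<in> topspace X \<Longrightarrow> act g (act (inv g) x) = x"
  by (simp add: act_mult act_one)

lemma f_act: "g \<in> carrier G \<Longrightarrow> x \<in> topspace X \<Longrightarrow> f (act g x) = f x"
  using fibre[OF act_closed, of g x x] by blast

lemma open_vimage_act:
  "g \<in> carrier G \<Longrightarrow> openin X U \<Longrightarrow> openin X {x \<in> topspace X. act g x \<in> U}"
  by (rule openin_continuous_map_preimage[OF act_cont])

lemma closed_vimage_act:
  "g \<in> carrier G \<Longrightarrow> closedin X U \<Longrightarrow> closedin X {x \<in> topspace X. act g x \<in> U}"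
  by (rule closedin_continuous_map_preimage[OF act_cont])

lemma image_act:
  assumes "g \<in> carrier G" "U \<subseteq> topspace X"
  shows "act g ` U = {x \<in> topspace X. act (inv g) x \<in> U}"
proof (intro equalityI subsetI)
  fix x assume "x \<in> act g ` U"
  then obtain u where "u \<in> U" "x = act g u" by blast
  then show "x \<in> {x \<in> topspace X. act (inv g) x \<in> U}"
    using assms act_inv[of g u] act_closed[of g u] by auto
next
  fix x assume "x \<in> {x \<in> topspace X. act (inv g) x \<in> U}"
  then have "act (inv g) x \<in> U" "x = act g (act (inv g) x)" using act_inv'[of g x] assms by auto
  then show "x \<in> act g ` U" by blast
qed

lemma f_eq_actE:
  assumes "x \<in> topspace X" "x' \<in> topspace X" "f x = f x'"
  obtains g where "g \<in> carrier G" "x' = act g x"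
  using fibre[OF assms(2,1)] assms(3) by metis

text \<open>The union S of the translates of U is open and saturated, so the complement of the image
  of U is the image of the closed complement of S, and f is closed.\<close>

lemma f_open: "open_map X Y f"
  unfolding open_map_def
proof (intro allI impI)
  fix U assume U: "openin X U"
  define S where "S = (\<Union>g\<in>carrier G. {x \<in> topspace X. act g x \<in> U})"
  have "openin X S"
    unfolding S_def using open_vimage_act[OF _ U] by blast
  then have cl: "closedin Y (f ` (topspace X - S))"
    using f_closed unfolding closed_map_def by blast
  have "f ` U = topspace Y - f ` (topspace X - S)"
  proof (intro equalityI subsetI)
    fix y assume "y \<in> f ` U"
    then obtain u where u: "u \<in> U" "y = f u" by blast
    have uX: "u \<in> topspace X" using u U openin_subset by blast
    have "y \<notin> f ` (topspace X - S)"
    proof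
      assume "y \<in> f ` (topspace X - S)"
      then obtain x where x: "x \<in> topspace X" "x \<notin> S" "f x = f u" using u by auto
      then obtain g where "g \<in> carrier G" "u = act g x" using f_eq_actE uX by metis
      then show False using x u unfolding S_def by blast
    qed
    then show "y \<in> topspace Y - f ` (topspace X - S)" using u uX f_surj by blast
  next
    fix y assume y: "y \<in> topspace Y - f ` (topspace X - S)"
    then obtain x where x: "x \<in> topspace X" "y = f x" "x \<in> S" using f_surj by blast
    then obtain g where "g \<in> carrier G" "act g x \<in> U" unfolding S_def by blast
    then show "y \<in> f ` U" using f_act[of g x] x by (metis imageI)
  qed
  then show "openin Y (f ` U)" using cl by auto
qed

lemma fibre_card:
  assumes "x \<in> topspace X"
  shows "finite {x' \<in> topspace X. f x' = f x}" "card {x' \<in> topspace X. f x' = f x} \<le> card (carrier G)"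
proof -
  have sub: "{x' \<in> topspace X. f x' = f x} \<subseteq> (\<lambda>g. act g x) ` carrier G"
    using fibre[OF _ assms] by blast
  show "finite {x' \<in> topspace X. f x' = f x}"
    by (rule finite_subset[OF sub]) (use fin in auto)
  show "card {x' \<in> topspace X. f x' = f x} \<le> card (carrier G)"
    by (rule order_trans[OF card_mono[OF _ sub] card_image_le]) (use fin in auto)
qed

text \<open>Each open piece of the preimage is clopen there, hence so is its image under \<open>f\<close>;
  so every piece meets every fibre.\<close>

lemma splits_boundedly_preimage:
  assumes V: "openin Y V" "connectedin Y V"
  shows "splits_boundedly X {x \<in> topspace X. f x \<in> V}" (is "splits_boundedly X ?U")
proof (cases "?U = {}")
  case True
  then show ?thesis using splits_boundedly_empty by metis
next
  case False
  then obtain x0 where x0: "x0 \<in> topspace X" "f x0 \<in> V" by blast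
  let ?F = "{x \<in> topspace X. f x = f x0}"
  show ?thesis
  proof (rule splits_boundedlyI)
    fix \<A> assume \<A>: "open_partition X ?U \<A>"
    have finA: "finite \<A>" and opn: "\<And>A. A \<in> \<A> \<Longrightarrow> openin X A" and ne: "\<And>A. A \<in> \<A> \<Longrightarrow> A \<noteq> {}"
      and un: "\<Union>\<A> = ?U"
      and disj: "\<And>A B. A \<in> \<A> \<Longrightarrow> B \<in> \<A> \<Longrightarrow> A \<noteq> B \<Longrightarrow> A \<inter> B = {}"
      using \<A> unfolding open_partition_def pairwise_def disjnt_def by auto
    have meets: "\<exists>x \<in> ?F. x \<in> A" if A: "A \<in> \<A>" for A
    proof -
      \<comment> \<open>These are the points over V whose orbit avoids A. The fibres are the orbits,
        so the images of A and E are disjoint open sets covering V; connectedness makes E empty, and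
        A meets every fibre over V.\<close>
      define E where "E = ?U \<inter> (\<Inter>g\<in>carrier G. {x \<in> topspace X. act g x \<in> \<Union>(\<A> - {A})})"
      have "openin X ?U" by (rule openin_continuous_map_preimage[OF f_cont V(1)])
      moreover have "openin X (\<Inter>g\<in>carrier G. {x \<in> topspace X. act g x \<in> \<Union>(\<A> - {A})})"
      proof (rule openin_Inter)
        show "finite ((\<lambda>g. {x \<in> topspace X. act g x \<in> \<Union>(\<A> - {A})}) ` carrier G)" using fin by simp
        show "(\<lambda>g. {x \<in> topspace X. act g x \<in> \<Union>(\<A> - {A})}) ` carrier G \<noteq> {}" by auto
        show "openin X S" if "S \<in> (\<lambda>g. {x \<in> topspace X. act g x \<in> \<Union>(\<A> - {A})}) ` carrier G" for S
          using that opn by (auto intro!: open_vimage_act openin_Union simp del: Union_iff)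
      qed
      ultimately have E: "openin X E" unfolding E_def by (rule openin_Int)
      have opens: "openin Y (f ` A)" "openin Y (f ` E)"
        using f_open E opn[OF A] unfolding open_map_def by blast+
      have AU: "A \<subseteq> ?U" using un A by blast
      have dis: "f ` A \<inter> f ` E = {}"
      proof (rule ccontr)
        assume "f ` A \<inter> f ` E \<noteq> {}"
        then obtain y where "y \<in> f ` A" "y \<in> f ` E" by blast
        then obtain a e where ae: "a \<in> A" "e \<in> E" "f e = f a" by (elim imageE) simp
        have "a \<in> topspace X" "e \<in> topspace X" using ae AU unfolding E_def by blast+
        then obtain g where g: "g \<in> carrier G" "a = act g e" using f_eq_actE ae(3) by metis
        then have "a \<in> \<Union>(\<A> - {A})" using ae(2) unfolding E_def by blast
        then obtain B where "B \<in> \<A>" "B \<noteq> A" "a \<in> B" by blast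
        then show False using disj[OF A, of B] ae(1) by blast
      qed
      have cov: "V \<subseteq> f ` A \<union> f ` E"
      proof
        fix v assume v: "v \<in> V"
        then have "v \<in> topspace Y" using V(1) openin_subset by blast
        then obtain x where x: "x \<in> topspace X" "v = f x" using f_surj by blast
        show "v \<in> f ` A \<union> f ` E"
        proof (cases "\<exists>g \<in> carrier G. act g x \<in> A")
          case True
          then obtain g where "g \<in> carrier G" "act g x \<in> A" by blast
          then show ?thesis using f_act[of g x] x by (metis imageI UnI1)
        next
          case False
          have "act g x \<in> \<Union>(\<A> - {A})" if g: "g \<in> carrier G" for g
          proof -
            have "act g x \<in> ?U" using act_closed[OF g x(1)] f_act[OF g x(1)] x v by simp
            then obtain B where "B \<in> \<A>" "act g x \<in> B" unfolding un[symmetric] by (rule UnionE)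
            moreover from this have "B \<noteq> A" using False g by blast
            ultimately show ?thesis by blast
          qed
          then have "x \<in> E" using x v unfolding E_def by blast
          then show ?thesis using x by blast
        qed
      qed
      have sub: "f ` A \<subseteq> V" "f ` E \<subseteq> V" using AU unfolding E_def by blast+
      have "f ` E = {}"
      proof (rule ccontr)
        assume "f ` E \<noteq> {}"
        moreover have "f ` A \<noteq> {}" using ne[OF A] by simp
        moreover have "f ` A \<inter> f ` E \<inter> V = {}" "f ` A \<inter> V = f ` A" "f ` E \<inter> V = f ` E"
          using dis sub by blast+
        ultimately have "\<exists>E1 E2. openin Y E1 \<and> openin Y E2 \<and> V \<subseteq> E1 \<union> E2 \<and> E1 \<inter> E2 \<inter> V = {} \<and>
            E1 \<inter> V \<noteq> {} \<and> E2 \<inter> V \<noteq> {}"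
          using opens cov by (intro exI[of _ "f ` A"] exI[of _ "f ` E"] conjI) simp_all
        then show False using V(2) unfolding connectedin by (elim conjE notE)
      qed
      then have "f x0 \<in> f ` A" using cov x0 by blast
      then show ?thesis using AU by auto
    qed
    then have "\<forall>A \<in> \<A>. \<exists>x. x \<in> ?F \<and> x \<in> A" by blast
    from bchoice[OF this] obtain p where p: "\<And>A. A \<in> \<A> \<Longrightarrow> p A \<in> ?F \<and> p A \<in> A" by blast
    have "inj_on p \<A>"
    proof (rule inj_onI, rule ccontr)
      fix A B assume AB: "A \<in> \<A>" "B \<in> \<A>" "p A = p B" "A \<noteq> B"
      then show False using disj[OF AB(1,2,4)] p[OF AB(1)] p[OF AB(2)] by auto
    qed
    moreover have "p ` \<A> \<subseteq> ?F" using p by blast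
    ultimately have "card \<A> \<le> card ?F"
      using fibre_card(1)[OF x0(1)] by (intro card_inj_on_le)
    then show "card \<A> \<le> card (carrier G)"
      using fibre_card(2)[OF x0(1)] by linarith
  qed
qed

text \<open>Downward induction on \<open>card S\<close>: the points with at least \<open>k\<close> translates in \<open>U\<close> form a
  saturated set covered by the sets for \<open>card S = k\<close>, whose pairwise intersections have larger index
  sets.\<close>

lemma locally_connected_source:
  assumes Y: "locally_connected_space Y"
    and base: "\<And>U x. openin X U \<Longrightarrow> x \<in> U \<Longrightarrow> \<exists>W. openin X W \<and> compactin X W \<and> x \<in> W \<and> W \<subseteq> U"
    and inter: "\<And>U V. \<lbrakk>openin X U; compactin X U; openin X V; compactin X V\<rbrakk> \<Longrightarrow> compactin X (U \<inter> V)"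
  shows "locally_connected_space X"
proof -
  have spl: "splits_boundedly X U" if U: "openin X U" "compactin X U" for U
  proof -
    \<comment> \<open>An intersection of translates of U: the index set containing only the unit
      gives U itself, and a union of index sets gives an intersection of the sets.\<close>
    define M where "M S = {x \<in> topspace X. \<forall>g \<in> S. act g x \<in> U}" for S
    have UX: "U \<subseteq> topspace X" by (rule openin_subset[OF U(1)])
    have M1: "openin X (M {g}) \<and> compactin X (M {g})" if g: "g \<in> carrier G" for g
    proof -
      have "M {g} = act (inv g) ` U"
        using image_act[of "inv g" U] g UX by (simp add: M_def)
      then have "compactin X (M {g})"
        using image_compactin[OF U(2) act_cont[of "inv g"]] g by simp
      then show ?thesis using open_vimage_act[OF g U(1)] by (simp add: M_def)
    qed
    have M: "openin X (M S) \<and> compactin X (M S)" if "S \<subseteq> carrier G" "S \<noteq> {}" for S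
      using finite_subset[OF that(1) fin] that(2,1)
    proof (induction rule: finite_ne_induct)
      case (singleton g)
      then show ?case using M1 by simp
    next
      case (insert g S)
      have "M (insert g S) = M {g} \<inter> M S" by (auto simp: M_def)
      then show ?case using insert M1[of g] inter by auto
    qed
    have "splits_boundedly X (M S)" if "S \<subseteq> carrier G" "S \<noteq> {}" for S
      using that
    proof (induction "card (carrier G) - card S" arbitrary: S rule: less_induct)
      case less
      define I where "I = {S'. S' \<subseteq> carrier G \<and> card S' = card S}"
      have finS: "finite S" by (rule finite_subset[OF less.prems(1) fin])
      have SI: "S \<in> I" using less.prems by (simp add: I_def)
      have neI: "S' \<noteq> {}" if "S' \<in> I" for S'
        using that less.prems(2) finS by (auto simp: I_def)
      \<comment> \<open>These are the points with at least \<open>card S\<close> translates in U.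
        When S is the whole group, it is the only member of \<open>I\<close>, so there are no
        overlaps to bound and the induction starts there.\<close>
      define W where "W = (\<Union>S'\<in>I. M S')"
      have finI: "finite I" unfolding I_def using fin by simp
      show ?case
      proof (rule splits_boundedly_member_of_cover[OF finI SI])
        show "openin X (M S')" if "S' \<in> I" for S'
          using M[of S'] neI[OF that] that by (simp add: I_def)
        show "W = (\<Union>S'\<in>I. M S')" by (rule W_def)
        show "splits_boundedly X (M S \<inter> M S')" if S': "S' \<in> I" "S' \<noteq> S" for S'
        proof -
          have c: "S' \<subseteq> carrier G" "card S' = card S" using S' by (auto simp: I_def)
          have finS': "finite S'" by (rule finite_subset[OF c(1) fin])
          have "\<not> S' \<subseteq> S" using card_subset_eq[OF finS] c S'(2) by blast
          then have "S \<subset> S \<union> S'" by blast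
          then have "card S < card (S \<union> S')" using finS finS' by (intro psubset_card_mono) auto
          moreover have "card (S \<union> S') \<le> card (carrier G)"
            using c less.prems fin by (intro card_mono) auto
          ultimately have "card (carrier G) - card (S \<union> S') < card (carrier G) - card S" by linarith
          then have "splits_boundedly X (M (S \<union> S'))"
            by (rule less.hyps) (use c less.prems in auto)
          moreover have "M (S \<union> S') = M S \<inter> M S'" by (auto simp: M_def)
          ultimately show ?thesis by simp
        qed
        have opW: "openin X W" unfolding W_def using M neI by (auto simp: I_def)
        have "compactin X W" unfolding W_def
          using finI M neI by (intro compactin_Union) (auto simp: I_def)
        then have "compactin Y (f ` W)" by (rule image_compactin[OF _ f_cont])
        moreover have "openin Y (f ` W)" using f_open opW unfolding open_map_def by blast
        ultimately obtain \<C> where \<C>: "finite \<C>" "\<And>C. C \<in> \<C> \<Longrightarrow> openin Y C \<and> connectedin Y C" "\<Union>\<C> = f ` W"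
          using compact_open_finite_connected_cover[OF Y] by metis
        have "W = {x \<in> topspace X. f x \<in> f ` W}"
        proof (intro equalityI subsetI)
          fix x assume "x \<in> W"
          then show "x \<in> {x \<in> topspace X. f x \<in> f ` W}" using opW openin_subset by blast
        next
          fix x assume "x \<in> {x \<in> topspace X. f x \<in> f ` W}"
          then obtain w where x: "x \<in> topspace X" and w: "w \<in> W" "f x = f w" by auto
          then obtain S' where S': "S' \<in> I" "w \<in> M S'" unfolding W_def by blast
          have "w \<in> topspace X" using S'(2) by (simp add: M_def)
          then obtain h where h: "h \<in> carrier G" "w = act h x" using f_eq_actE x w by metis
          \<comment> \<open>For w = hx, the translate of w by g is the translate of x by gh.
            Shifting the index set by h on the right keeps its size and replaces w by x, so W is
            saturated.\<close>
          let ?S = "(\<lambda>g. g \<otimes> h) ` S'"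
          have S'G: "S' \<subseteq> carrier G" using S'(1) by (simp add: I_def)
          have "inj_on (\<lambda>g. g \<otimes> h) S'"
            by (rule inj_on_subset[OF inj_on_multc[OF h(1)] S'G])
          then have "card ?S = card S" using S'(1) by (simp add: I_def card_image)
          moreover have "?S \<subseteq> carrier G" using S'G h by auto
          ultimately have "?S \<in> I" by (simp add: I_def)
          moreover have "x \<in> M ?S"
            using S'(2) S'G h x unfolding M_def by (auto simp: act_mult subset_iff)
          ultimately show "x \<in> W" unfolding W_def by blast
        qed
        also have "\<dots> = (\<Union>C\<in>\<C>. {x \<in> topspace X. f x \<in> C})"
          unfolding \<C>(3)[symmetric] by auto
        finally have Weq: "W = (\<Union>C\<in>\<C>. {x \<in> topspace X. f x \<in> C})" .
        show "splits_boundedly X W"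
          unfolding Weq using \<C>
          by (intro splits_boundedly_UN splits_boundedly_preimage
              openin_continuous_map_preimage[OF f_cont]) auto
      qed
    qed
    from this[of "{\<one>}"] have "splits_boundedly X (M {\<one>})" by simp
    moreover have "M {\<one>} = U" using UX act_one by (auto simp: M_def)
    ultimately show ?thesis by simp
  qed
  show ?thesis
    unfolding locally_connected_space
  proof (intro allI impI, elim conjE)
    fix V x assume V: "openin X V" "x \<in> V"
    then obtain W where W: "openin X W" "compactin X W" "x \<in> W" "W \<subseteq> V" using base by blast
    obtain C where "openin X C" "connectedin X C" "x \<in> C" "C \<subseteq> W"
      using splits_boundedly_open_connected_nbhd[OF spl[OF W(1,2)] W(1,3)] by blast
    then show "\<exists>U. openin X U \<and> connectedin X U \<and> x \<in> U \<and> U \<subseteq> V" using W(4) by blast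
  qed
qed

text \<open>Take a minimal closed set with image W. If two closed sets cover it, the images of its
  traces on them are closed and cover W, so one trace already maps onto W and, by minimality, is
  everything.\<close>

lemma irreducible_lift:
  assumes W: "irreducible_in Y W" "closedin Y W"
  obtains C where "closedin X C" "irreducible_in X C" "f ` C = W"
proof -
  \<comment> \<open>Open complements stand for closed sets, so that a minimal closed set becomes a
    maximal element.\<close>
  let ?\<S> = "{D. openin X D \<and> f ` (topspace X - D) = W}"
  let ?P = "{x \<in> topspace X. f x \<in> W}"
  have WY: "W \<subseteq> topspace Y" by (rule closedin_subset[OF W(2)])
  have "\<exists>M\<in>?\<S>. \<forall>D\<in>?\<S>. M \<subseteq> D \<longrightarrow> D = M"
  proof (rule subset_Zorn_nonempty)
    have "closedin X ?P" by (rule closedin_continuous_map_preimage[OF f_cont W(2)])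
    moreover have "topspace X - (topspace X - ?P) = ?P" by blast
    moreover have "f ` ?P = W"
    proof (intro equalityI subsetI)
      fix w assume w: "w \<in> W"
      then obtain x where "x \<in> topspace X" "w = f x" using WY f_surj by blast
      then show "w \<in> f ` ?P" using w by auto
    qed auto
    ultimately have "topspace X - ?P \<in> ?\<S>" by auto
    then show "?\<S> \<noteq> {}" by blast
    fix \<C> assume ne: "\<C> \<noteq> {}" and ch: "subset.chain ?\<S> \<C>"
    then have sub: "\<And>D. D \<in> \<C> \<Longrightarrow> openin X D \<and> f ` (topspace X - D) = W"
      and lin: "\<And>A B. A \<in> \<C> \<Longrightarrow> B \<in> \<C> \<Longrightarrow> A \<subseteq> B \<or> B \<subseteq> A"
      unfolding subset_chain_def by blast+
    have "W \<subseteq> f ` (topspace X - \<Union>\<C>)"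
    proof
      fix w assume w: "w \<in> W"
      then obtain x where x: "x \<in> topspace X" "w = f x" using WY f_surj by blast
      let ?F = "{x' \<in> topspace X. f x' = f x}"
      show "w \<in> f ` (topspace X - \<Union>\<C>)"
      proof (rule ccontr)
        assume "w \<notin> f ` (topspace X - \<Union>\<C>)"
        then have "x' \<in> \<Union>\<C>" if "x' \<in> ?F" for x'
          using x(2) that imageI[of x' "topspace X - \<Union>\<C>" f] by auto
        then have "?F \<subseteq> \<Union>\<C>" by blast
        \<comment> \<open>The fibre is finite, so a single member of the chain already covers it;
          its complement would then miss the fibre over w.\<close>
        then obtain D where D: "D \<in> \<C>" "?F \<subseteq> D"
          using finite_subset_Union_chain[OF fibre_card(1)[OF x(1)] _ ne ch] by blast
        have "w \<in> f ` (topspace X - D)" using sub[OF D(1)] w by simp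
        then show False using D(2) x by auto
      qed
    qed
    moreover have "f ` (topspace X - \<Union>\<C>) \<subseteq> W" using ne sub by blast
    moreover have "openin X (\<Union>\<C>)" using sub by blast
    ultimately show "\<Union>\<C> \<in> ?\<S>" by blast
  qed
  then obtain M where "M \<in> ?\<S>" and max: "\<forall>D \<in> ?\<S>. M \<subseteq> D \<longrightarrow> D = M" by (rule bexE)
  then have M: "openin X M" "f ` (topspace X - M) = W" by auto
  define C where "C = topspace X - M"
  have C: "closedin X C" "f ` C = W" using M(1,2) by (auto simp: C_def)
  have min: "C \<subseteq> D" if D: "closedin X D" "D \<subseteq> C" "f ` D = W" for D
  proof -
    have "topspace X - (topspace X - D) = D" using closedin_subset[OF D(1)] by blast
    then have "topspace X - D \<in> ?\<S>" using D by auto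
    moreover have "M \<subseteq> topspace X - D" using D(2) openin_subset[OF M(1)] by (auto simp: C_def)
    ultimately have "topspace X - D = M" using max by blast
    then show ?thesis unfolding C_def using D(1) closedin_subset by blast
  qed
  have "irreducible_in X C"
    unfolding irreducible_in_def
  proof (intro conjI allI impI)
    show "C \<subseteq> topspace X" by (simp add: C_def)
    show "C \<noteq> {}" using C(2) irreducible_in_nonempty[OF W(1)] by blast
    fix D E assume DE: "closedin X D \<and> closedin X E \<and> C \<subseteq> D \<union> E"
    have cl: "closedin X (C \<inter> D)" "closedin X (C \<inter> E)" using C(1) DE by (auto intro: closedin_Int)
    then have "closedin Y (f ` (C \<inter> D))" "closedin Y (f ` (C \<inter> E))"
      using f_closed unfolding closed_map_def by blast+
    moreover have "W \<subseteq> f ` (C \<inter> D) \<union> f ` (C \<inter> E)" using C(2) DE by blast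
    ultimately have "W \<subseteq> f ` (C \<inter> D) \<or> W \<subseteq> f ` (C \<inter> E)" by (rule irreducible_inD[OF W(1)])
    then have "f ` (C \<inter> D) = W \<or> f ` (C \<inter> E) = W" using C(2) by blast
    then show "C \<subseteq> D \<or> C \<subseteq> E" using min[OF cl(1)] min[OF cl(2)] by blast
  qed
  then show thesis using that C by blast
qed

lemma loc_fin_many_irred_components_source:
  assumes Y: "loc_fin_many_irred_components Y"
  shows "loc_fin_many_irred_components X"
  unfolding loc_fin_many_irred_components_def
proof
  fix x assume x: "x \<in> topspace X"
  then have "f x \<in> topspace Y" using f_surj by blast
  then obtain V where V: "openin Y V" "f x \<in> V"
    and fin\<W>: "finite {W. irreducible_component_of Y W \<and> W \<inter> V \<noteq> {}}" (is "finite ?\<W>")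
    using Y unfolding loc_fin_many_irred_components_def by blast
  have "\<forall>W \<in> ?\<W>. \<exists>C. closedin X C \<and> irreducible_in X C \<and> f ` C = W"
  proof
    fix W assume "W \<in> ?\<W>"
    then have W: "irreducible_component_of Y W" by simp
    have "closedin Y W" using irreducible_component_of_closed[OF W] by (metis closedin_closure_of)
    with irreducible_component_of_irreducible[OF W] obtain C where
      "closedin X C" "irreducible_in X C" "f ` C = W" by (rule irreducible_lift)
    then show "\<exists>C. closedin X C \<and> irreducible_in X C \<and> f ` C = W" by (intro exI conjI)
  qed
  from bchoice[OF this] obtain c where
    c: "\<forall>W \<in> ?\<W>. closedin X (c W) \<and> irreducible_in X (c W) \<and> f ` c W = W" by (rule exE)
  let ?U = "{x \<in> topspace X. f x \<in> V}"
  have "{Z. irreducible_component_of X Z \<and> Z \<inter> ?U \<noteq> {}} \<subseteq> (\<lambda>(g, W). act g ` c W) ` (carrier G \<times> ?\<W>)"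
  proof
    fix Z assume "Z \<in> {Z. irreducible_component_of X Z \<and> Z \<inter> ?U \<noteq> {}}"
    then have Z: "irreducible_component_of X Z" "Z \<inter> ?U \<noteq> {}" by auto
    note irr = irreducible_component_of_irreducible[OF Z(1)]
    obtain W where W: "irreducible_component_of Y W" "f ` Z \<subseteq> W"
      by (rule irreducible_in_subset_component[OF irreducible_in_image[OF f_cont irr]])
    then have W\<W>: "W \<in> ?\<W>" using Z(2) by blast
    note cW = bspec[OF c W\<W>]
    have cWX: "c W \<subseteq> topspace X" using cW closedin_subset by blast
    \<comment> \<open>The translates of the lift of W exhaust the preimage of W because fibres are
      orbits. The irreducible set Z lies in one of them and, being maximal, equals it.\<close>
    have "\<exists>C \<in> (\<lambda>g. act g ` c W) ` carrier G. Z \<subseteq> C"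
    proof (rule irreducible_in_finite_Union[OF irr])
      show "finite ((\<lambda>g. act g ` c W) ` carrier G)" using fin by simp
      show "closedin X C" if "C \<in> (\<lambda>g. act g ` c W) ` carrier G" for C
        using that cW cWX by (auto simp: image_act intro!: closed_vimage_act)
      show "Z \<subseteq> \<Union>((\<lambda>g. act g ` c W) ` carrier G)"
      proof
        fix z assume z: "z \<in> Z"
        then have zX: "z \<in> topspace X" using irreducible_in_subset[OF irr] by blast
        have "f z \<in> f ` c W" using z W(2) cW by blast
        then obtain w where w: "w \<in> c W" "f z = f w" by blast
        then obtain g where "g \<in> carrier G" "z = act g w"
          using fibre[OF zX, of w] cWX by blast
        then show "z \<in> \<Union>((\<lambda>g. act g ` c W) ` carrier G)" using w by blast
      qed
    qed
    then obtain g where g: "g \<in> carrier G" "Z \<subseteq> act g ` c W" by blast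
    have "irreducible_in X (act g ` c W)"
      using cW by (intro irreducible_in_image[OF act_cont[OF g(1)]]) simp
    then have "act g ` c W = Z" using irreducible_component_of_maximal[OF Z(1)] g(2) by blast
    then show "Z \<in> (\<lambda>(g, W). act g ` c W) ` (carrier G \<times> ?\<W>)" using g(1) W\<W> by blast
  qed
  moreover have "finite ((\<lambda>(g, W). act g ` c W) ` (carrier G \<times> ?\<W>))" using fin fin\<W> by simp
  ultimately have "finite {Z. irreducible_component_of X Z \<and> Z \<inter> ?U \<noteq> {}}" by (rule finite_subset)
  moreover have "openin X ?U" by (rule openin_continuous_map_preimage[OF f_cont V(1)])
  ultimately show "\<exists>U. openin X U \<and> x \<in> U \<and> finite {Z. irreducible_component_of X Z \<and> Z \<inter> U \<noteq> {}}"
    using x V(2) by blast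
qed

text \<open>For each k, the points with at least k translates in the n-th closed set have a closed
  image, and these images stabilise over V. Once this holds for all k up to the group order, the
  number of translates of a point, and then the set of group elements producing them, no longer
  changes.\<close>

lemma locally_noetherian_top_source:
  assumes Y: "locally_noetherian_top Y"
  shows "locally_noetherian_top X"
  unfolding locally_noetherian_top_def
proof
  fix x assume x: "x \<in> topspace X"
  then have "f x \<in> topspace Y" using f_surj by blast
  then obtain V where V: "openin Y V" "f x \<in> V" "noetherian_top (subtopology Y V)"
    using Y unfolding locally_noetherian_top_def by blast
  let ?U = "{x \<in> topspace X. f x \<in> V}"
  have "noetherian_top (subtopology X ?U)"
    unfolding noetherian_top_def
  proof (intro allI impI, elim conjE)
    fix C assume C: "\<forall>n. closedin (subtopology X ?U) (C n)" "\<forall>n. C (Suc n) \<subseteq> C n"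
    have "\<exists>D. closedin X D \<and> C n = D \<inter> ?U" for n
      using C(1) unfolding closedin_subtopology by blast
    \<comment> \<open>The closed extensions \<open>D n\<close> need not decrease; only their traces
      over V do. Images are therefore compared after intersecting with V.\<close>
    then obtain D where D: "\<And>n. closedin X (D n)" "\<And>n. C n = D n \<inter> ?U" by metis
    define M where "M S n = {x \<in> topspace X. \<forall>g \<in> S. act g x \<in> D n}" for S n
    have MD: "closedin X (M S n)" if "S \<subseteq> carrier G" for S n
    proof -
      have "M S n = topspace X \<inter> (\<Inter>g\<in>S. {x \<in> topspace X. act g x \<in> D n})"
        by (auto simp: M_def)
      also have "closedin X \<dots>"
      proof (cases "S = {}")
        case False
        then show ?thesis using that D(1)
          by (intro closedin_Int closedin_Inter) (auto intro!: closed_vimage_act)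
      qed simp
      finally show ?thesis .
    qed
    have stab: "\<exists>N. \<forall>n \<ge> N. f ` (\<Union>S\<in>{S. S \<subseteq> carrier G \<and> card S = k}. M S n) \<inter> V =
        f ` (\<Union>S\<in>{S. S \<subseteq> carrier G \<and> card S = k}. M S N) \<inter> V" for k
    proof (rule V(3)[unfolded noetherian_top_def, rule_format], intro conjI allI)
      let ?K = "{S. S \<subseteq> carrier G \<and> card S = k}"
      fix n
      have "closedin X (\<Union>S\<in>?K. M S n)"
        using fin MD by (intro closedin_Union) auto
      then have "closedin Y (f ` (\<Union>S\<in>?K. M S n))"
        using f_closed unfolding closed_map_def by blast
      then show "closedin (subtopology Y V) (f ` (\<Union>S\<in>?K. M S n) \<inter> V)"
        unfolding closedin_subtopology by blast
      show "f ` (\<Union>S\<in>?K. M S (Suc n)) \<inter> V \<subseteq> f ` (\<Union>S\<in>?K. M S n) \<inter> V"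
      proof
        fix y assume y: "y \<in> f ` (\<Union>S\<in>?K. M S (Suc n)) \<inter> V"
        then obtain S z where S: "S \<in> ?K" "z \<in> M S (Suc n)" "y = f z" by blast
        have "act g z \<in> D n" if g: "g \<in> S" for g
        proof -
          have gz: "g \<in> carrier G" "z \<in> topspace X" using g S by (auto simp: M_def)
          have "act g z \<in> C (Suc n)"
            using S g gz y act_closed[OF gz] f_act[OF gz] by (auto simp: D(2) M_def)
          then show ?thesis using C(2) D(2) by blast
        qed
        then have "z \<in> M S n" using S by (simp add: M_def)
        then show "y \<in> f ` (\<Union>S\<in>?K. M S n) \<inter> V" using S y by blast
      qed
    qed
    define A where "A n z = {g \<in> carrier G. act g z \<in> D n}" for n z
    \<comment> \<open>If any point w of the fibre of z has k translates in \<open>D n\<close>, so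
      does z: writing w = hz, the index set is shifted by h on the right.\<close>
    have memiff: "f z \<in> f ` (\<Union>S\<in>{S. S \<subseteq> carrier G \<and> card S = k}. M S n) \<inter> V \<longleftrightarrow> k \<le> card (A n z)"
      if z: "z \<in> ?U" for z k n
    proof
      have zX: "z \<in> topspace X" using z by simp
      assume "k \<le> card (A n z)"
      then obtain S where "S \<subseteq> A n z" "card S = k" by (meson obtain_subset_with_card_n)
      then have "S \<in> {S. S \<subseteq> carrier G \<and> card S = k}" "z \<in> M S n" using zX by (auto simp: A_def M_def)
      then show "f z \<in> f ` (\<Union>S\<in>{S. S \<subseteq> carrier G \<and> card S = k}. M S n) \<inter> V" using z by blast
    next
      have zX: "z \<in> topspace X" using z by simp
      assume "f z \<in> f ` (\<Union>S\<in>{S. S \<subseteq> carrier G \<and> card S = k}. M S n) \<inter> V"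
      then obtain S w where S: "S \<subseteq> carrier G" "card S = k" "w \<in> M S n" "f z = f w" by blast
      then have "w \<in> topspace X" by (simp add: M_def)
      then obtain h where h: "h \<in> carrier G" "w = act h z" using f_eq_actE zX S(4) by metis
      have "(\<lambda>g. g \<otimes> h) ` S \<subseteq> A n z"
        using S h zX by (auto simp: A_def M_def act_mult subset_iff)
      moreover have "inj_on (\<lambda>g. g \<otimes> h) S"
        by (rule inj_on_subset[OF inj_on_multc[OF h(1)] S(1)])
      moreover have "finite (A n z)" using fin by (simp add: A_def)
      ultimately show "k \<le> card (A n z)" using S(2) card_inj_on_le by blast
    qed
    from choice[OF allI, OF stab] obtain N where N: "\<forall>k. \<forall>n \<ge> N k.
        f ` (\<Union>S\<in>{S. S \<subseteq> carrier G \<and> card S = k}. M S n) \<inter> V =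
        f ` (\<Union>S\<in>{S. S \<subseteq> carrier G \<and> card S = k}. M S (N k)) \<inter> V" by (rule exE)
    \<comment> \<open>A point has at most as many relevant translates as the group has elements, so
      finitely many stabilisation indices matter.\<close>
    define L where "L = Max (N ` {..card (carrier G)})"
    have NL: "N k \<le> L" if "k \<le> card (carrier G)" for k
      unfolding L_def using that by (intro Max_ge) auto
    have "C n = C L" if n: "n \<ge> L" for n
    proof
      show sub: "C n \<subseteq> C L" by (rule lift_Suc_antimono_le[of C L n]) (use C(2) n in auto)
      show "C L \<subseteq> C n"
      proof
        fix z assume zL: "z \<in> C L"
        then have z: "z \<in> ?U" using D(2) by blast
        then have zX: "z \<in> topspace X" by simp
        let ?k = "card (A L z)"
        have "?k \<le> card (carrier G)" using fin by (intro card_mono) (auto simp: A_def)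
        from NL[OF this] have k: "N ?k \<le> L" "N ?k \<le> n" using n by auto
        \<comment> \<open>Stabilisation at \<open>?k\<close> prevents the number of translates from
          dropping. Since the index sets shrink, they are equal, and the unit element in them gives
          z itself.\<close>
        have "?k \<le> card (A n z)"
          using memiff[OF z, of L ?k] memiff[OF z, of n ?k]
            trans[OF N[rule_format, OF k(1)] N[rule_format, OF k(2), symmetric]]
          by (simp only: order_refl)
        moreover have "A n z \<subseteq> A L z"
        proof
          fix g assume "g \<in> A n z"
          then have g: "g \<in> carrier G" "act g z \<in> D n" by (auto simp: A_def)
          then have "act g z \<in> C n" using z act_closed[OF g(1) zX] f_act[OF g(1) zX] by (simp add: D(2))
          then show "g \<in> A L z" using sub g(1) D(2) by (auto simp: A_def)
        qed
        moreover have "finite (A L z)" using fin by (simp add: A_def)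
        ultimately have "A n z = A L z" using card_seteq by blast
        moreover have "\<one> \<in> A L z" using zL D(2) zX act_one by (auto simp: A_def)
        ultimately have "\<one> \<in> A n z" by (simp only:)
        then have "z \<in> D n" using act_one[OF zX] by (simp add: A_def)
        then show "z \<in> C n" using z D(2) by blast
      qed
    qed
    then show "\<exists>N. \<forall>n \<ge> N. C n = C N" by blast
  qed
  moreover have "openin X ?U" by (rule openin_continuous_map_preimage[OF f_cont V(1)])
  ultimately show "\<exists>U. openin X U \<and> x \<in> U \<and> noetherian_top (subtopology X U)"
    using x V(2) by blast
qed

end

section \<open>Spectra: topology, induced maps and sections\<close>

section \<open>The Zariski topology\<close>

definition basic_open :: "('a, 'm) ring_scheme \<Rightarrow> 'a \<Rightarrow> 'a set set" where
  "basic_open R a = {P \<in> primes R. a \<notin> P}"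

context cring
begin

lemma primes_primeideal: "P \<in> primes R \<Longrightarrow> primeideal P R"
  by (simp add: primes_def)

lemma one_notin_prime: "P \<in> primes R \<Longrightarrow> \<one> \<notin> P"
  using primeideal.one_nonmemb[OF primes_primeideal] by blast

lemma zero_in_prime: "P \<in> primes R \<Longrightarrow> \<zero> \<in> P"
  using primes_primeideal[of P] by (auto simp: primeideal_def ideal_def additive_subgroup.zero_closed)

lemma basic_open_one: "basic_open R \<one> = primes R"
  using one_notin_prime by (auto simp: basic_open_def)

lemma openin_basic_open: "a \<in> carrier R \<Longrightarrow> openin (zariski R) (basic_open R a)"
  unfolding openin_zariski basic_open_def by (intro exI[of _ "{a}"]) auto

lemma openin_zariski_subset: "openin (zariski R) U \<Longrightarrow> U \<subseteq> primes R"
  unfolding openin_zariski by blast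

lemma topspace_zariski: "topspace (zariski R) = primes R"
proof
  show "topspace (zariski R) \<subseteq> primes R" by (rule openin_zariski_subset[OF openin_topspace])
  show "primes R \<subseteq> topspace (zariski R)"
    using openin_subset[OF openin_basic_open[OF one_closed]] by (simp add: basic_open_one)
qed

lemma basic_open_mult:
  assumes "a \<in> carrier R" "b \<in> carrier R"
  shows "basic_open R (a \<otimes> b) = basic_open R a \<inter> basic_open R b"
proof -
  have "a \<otimes> b \<in> P \<longleftrightarrow> a \<in> P \<or> b \<in> P" if "P \<in> primes R" for P
  proof -
    interpret primeideal P R using that by (rule primes_primeideal)
    show ?thesis using I_prime I_l_closed I_r_closed assms by blast
  qed
  then show ?thesis by (auto simp: basic_open_def)
qed

lemma open_contains_basic_open:
  assumes "openin (zariski R) U" "P \<in> U"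
  obtains a where "a \<in> carrier R" "P \<in> basic_open R a" "basic_open R a \<subseteq> U"
proof -
  obtain E where E: "E \<subseteq> carrier R" "U = {P \<in> primes R. \<not> E \<subseteq> P}"
    using assms(1) unfolding openin_zariski by blast
  then obtain a where "a \<in> E" "a \<notin> P" "P \<in> primes R" using assms(2) by blast
  then show thesis using E by (intro that[of a]) (auto simp: basic_open_def)
qed

text \<open>This allows a fraction that represents a section near a prime to be evaluated at a
  smaller prime as well.\<close>

lemma open_generization_closed:
  assumes "openin (zariski R) U" "P \<in> U" "P' \<in> primes R" "P' \<subseteq> P"
  shows "P' \<in> U"
  using assms unfolding openin_zariski by blast

text \<open>If \<open>basic_open R a\<close> had no finite subcover, the elements \<open>x\<close> for which
  \<open>basic_open R x \<inter> basic_open R a\<close> has one would form an ideal containing no power of \<open>a\<close>.\<close>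

lemma compactin_basic_open:
  assumes a: "a \<in> carrier R"
  shows "compactin (zariski R) (basic_open R a)"
  unfolding compactin_def
proof (intro conjI allI impI)
  show "basic_open R a \<subseteq> topspace (zariski R)"
    by (auto simp: topspace_zariski basic_open_def)
  fix \<U> assume \<U>: "Ball \<U> (openin (zariski R)) \<and> basic_open R a \<subseteq> \<Union>\<U>"
  define J where "J = {x \<in> carrier R. \<exists>\<F>. finite \<F> \<and> \<F> \<subseteq> \<U> \<and> basic_open R x \<inter> basic_open R a \<subseteq> \<Union>\<F>}"
  have JI: "x \<in> J" if "x \<in> carrier R" "finite \<F>" "\<F> \<subseteq> \<U>" "basic_open R x \<inter> basic_open R a \<subseteq> \<Union>\<F>" for x \<F>
    using that unfolding J_def by blast
  have le: "y \<in> J" if "y \<in> carrier R" "x \<in> J" "basic_open R y \<subseteq> basic_open R x" for x y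
    using that unfolding J_def by blast
  have Jmult: "r \<otimes> x \<in> J" if "x \<in> J" "r \<in> carrier R" for x r
  proof (rule le[OF _ that(1)])
    have x: "x \<in> carrier R" using that by (simp add: J_def)
    then show "r \<otimes> x \<in> carrier R" using that by simp
    show "basic_open R (r \<otimes> x) \<subseteq> basic_open R x" using basic_open_mult[OF that(2) x] by blast
  qed
  have J: "ideal J R"
  proof (rule idealI)
    show "subgroup J (add_monoid R)"
    proof (rule add.subgroupI)
      show "J \<subseteq> carrier R" by (auto simp: J_def)
      have "\<zero> \<in> J" using zero_in_prime by (intro JI[of _ "{}"]) (auto simp: basic_open_def)
      then show "J \<noteq> {}" by blast
      fix x y assume x: "x \<in> J" and y: "y \<in> J"
      then have c: "x \<in> carrier R" "y \<in> carrier R" by (simp_all add: J_def)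
      show "\<ominus> x \<in> J" using Jmult[OF x, of "\<ominus> \<one>"] c by (simp add: l_minus)
      obtain \<F> \<F>' where "finite \<F>" "\<F> \<subseteq> \<U>" "basic_open R x \<inter> basic_open R a \<subseteq> \<Union>\<F>"
        "finite \<F>'" "\<F>' \<subseteq> \<U>" "basic_open R y \<inter> basic_open R a \<subseteq> \<Union>\<F>'"
        using x y unfolding J_def by blast
      moreover have "basic_open R (x \<oplus> y) \<subseteq> basic_open R x \<union> basic_open R y"
      proof
        fix P assume P: "P \<in> basic_open R (x \<oplus> y)"
        then interpret primeideal P R by (auto simp: basic_open_def primes_def)
        show "P \<in> basic_open R x \<union> basic_open R y"
          using P a_closed unfolding basic_open_def by blast
      qed
      ultimately show "x \<oplus> y \<in> J"
        using c by (intro JI[of _ "\<F> \<union> \<F>'"]) auto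
    qed
    show "r \<otimes> x \<in> J" if "x \<in> J" "r \<in> carrier R" for x r by (rule Jmult[OF that])
    show "x \<otimes> r \<in> J" if "x \<in> J" "r \<in> carrier R" for x r
      using Jmult[OF that] that by (simp add: J_def m_comm)
  qed (rule ring_axioms)
  show "\<exists>\<F>. finite \<F> \<and> \<F> \<subseteq> \<U> \<and> basic_open R a \<subseteq> \<Union>\<F>"
  proof (rule ccontr)
    assume no: "\<not> ?thesis"
    let ?S = "{a [^] n | n :: nat. True}"
    have "a [^] n \<notin> J" for n :: nat
    proof
      assume "a [^] n \<in> J"
      then obtain \<F> where "finite \<F>" "\<F> \<subseteq> \<U>" "basic_open R (a [^] n) \<inter> basic_open R a \<subseteq> \<Union>\<F>"
        unfolding J_def by blast
      moreover have "basic_open R a \<subseteq> basic_open R (a [^] n)"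
      proof
        fix P assume P: "P \<in> basic_open R a"
        then interpret primeideal P R by (auto simp: basic_open_def primes_def)
        show "P \<in> basic_open R (a [^] n)"
          using P nonmemb_pow[of a n] a by (auto simp: basic_open_def)
      qed
      ultimately show False using no by blast
    qed
    then have JS: "J \<inter> ?S = {}" by blast
    have S1: "\<one> \<in> ?S" by (rule CollectI, rule exI[of _ 0]) simp
    have S2: "s \<otimes> t \<in> ?S" if "s \<in> ?S" "t \<in> ?S" for s t
    proof -
      from that obtain m n :: nat where "s = a [^] m" "t = a [^] n" by blast
      then have "s \<otimes> t = a [^] (m + n)" using a by (simp add: nat_pow_mult)
      then show ?thesis by blast
    qed
    \<comment> \<open>Such a prime lies in \<open>basic_open R a\<close>, hence in a member of the
      cover. A basic open neighbourhood of P inside that member has a defining element which belongs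
      to \<open>J\<close> but not to P.\<close>
    obtain P where P: "primeideal P R" "J \<subseteq> P" "P \<inter> ?S = {}"
      using prime_avoiding_mult_closed[OF J S1 S2 JS] by metis
    have "a [^] (1 :: nat) \<in> ?S" by blast
    then have "a \<notin> P" using P(3) a by auto
    then have "P \<in> basic_open R a" using P(1) by (simp add: basic_open_def primes_def)
    then obtain U where U: "U \<in> \<U>" "P \<in> U" using \<U> by blast
    then obtain x where x: "x \<in> carrier R" "P \<in> basic_open R x" "basic_open R x \<subseteq> U"
      using \<U> open_contains_basic_open by metis
    have "x \<in> J" using x U by (intro JI[of _ "{U}"]) auto
    then show False using x(2) P(2) by (auto simp: basic_open_def)
  qed
qed

lemma compact_space_zariski: "compact_space (zariski R)"
  using compactin_basic_open[OF one_closed] by (simp add: compact_space_def topspace_zariski basic_open_one)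

lemma compact_open_finite_basic:
  assumes U: "openin (zariski R) U" "compactin (zariski R) U"
  obtains F where "finite F" "F \<subseteq> carrier R" "U = (\<Union>a\<in>F. basic_open R a)"
proof -
  let ?\<U> = "basic_open R ` {a \<in> carrier R. basic_open R a \<subseteq> U}"
  have "U \<subseteq> \<Union>?\<U>"
  proof
    fix P assume "P \<in> U"
    then obtain a where "a \<in> carrier R" "P \<in> basic_open R a" "basic_open R a \<subseteq> U"
      using open_contains_basic_open[OF U(1)] by blast
    then show "P \<in> \<Union>?\<U>" by blast
  qed
  moreover have "Ball ?\<U> (openin (zariski R))" using openin_basic_open by blast
  ultimately have "\<exists>\<F>. finite \<F> \<and> \<F> \<subseteq> ?\<U> \<and> U \<subseteq> \<Union>\<F>"
    using U(2) unfolding compactin_def by (elim conjE allE impE) (rule conjI)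
  then obtain \<F> where \<F>: "finite \<F>" "\<F> \<subseteq> ?\<U>" "U \<subseteq> \<Union>\<F>" by blast
  obtain F where F: "F \<subseteq> {a \<in> carrier R. basic_open R a \<subseteq> U}" "finite F" "\<F> = basic_open R ` F"
    using finite_subset_image[OF \<F>(1,2)] by blast
  show thesis by (rule that[of F]) (use F \<F>(3) in auto)
qed

text \<open>Quasi-compact open sets are finite unions of basic ones, and two basic open sets
  intersect in the basic open set of the product.\<close>

lemma compactin_Int_open:
  assumes "openin (zariski R) U" "compactin (zariski R) U" "openin (zariski R) V" "compactin (zariski R) V"
  shows "compactin (zariski R) (U \<inter> V)"
proof -
  obtain F where F: "finite F" "F \<subseteq> carrier R" "U = (\<Union>a\<in>F. basic_open R a)"
    using compact_open_finite_basic[OF assms(1,2)] .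
  obtain F' where F': "finite F'" "F' \<subseteq> carrier R" "V = (\<Union>a\<in>F'. basic_open R a)"
    using compact_open_finite_basic[OF assms(3,4)] .
  have "U \<inter> V = (\<Union>a\<in>F. \<Union>b\<in>F'. basic_open R a \<inter> basic_open R b)" using F F' by blast
  also have "\<dots> = (\<Union>a\<in>F. \<Union>b\<in>F'. basic_open R (a \<otimes> b))"
    by (intro SUP_cong refl basic_open_mult[symmetric]) (use F F' in auto)
  also have "compactin (zariski R) \<dots>"
    using F F' by (intro compactin_Union) (auto intro!: compactin_Union compactin_basic_open)
  finally show ?thesis .
qed

end

section \<open>Maps of spectra\<close>

context ring_hom_cring
begin

lemma contract_prime: "Q \<in> primes S \<Longrightarrow> contract R h Q \<in> primes R"
  using ring.primeideal_vimage[OF R.is_cring] by (simp add: primes_def contract_def)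

lemma continuous_map_contract: "continuous_map (zariski S) (zariski R) (contract R h)"
  unfolding continuous_map_alt
proof (intro conjI allI impI)
  show "contract R h \<in> topspace (zariski S) \<rightarrow> topspace (zariski R)"
    using contract_prime by (auto simp: R.topspace_zariski S.topspace_zariski)
  fix U assume "openin (zariski R) U"
  then obtain E where E: "E \<subseteq> carrier R" "U = {P \<in> primes R. \<not> E \<subseteq> P}"
    unfolding openin_zariski by blast
  have "contract R h -` U \<inter> topspace (zariski S) = {Q \<in> primes S. \<not> h ` E \<subseteq> Q}"
    using E contract_prime by (auto simp: S.topspace_zariski contract_def)
  then show "openin (zariski S) (contract R h -` U \<inter> topspace (zariski S))"
    unfolding openin_zariski using E(1) by (intro exI[of _ "h ` E"]) auto
qed

text \<open>The image of the closed set defined by E is the closed set of the contraction of the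
  ideal generated by E; lying over supplies the nontrivial inclusion.\<close>

lemma closed_map_contract:
  assumes integral: "\<And>P Q b. \<lbrakk>primeideal P R; primeideal Q S; contract R h Q \<subseteq> P; b \<in> carrier S\<rbrakk> \<Longrightarrow>
      \<exists>(n :: nat) u c. u \<in> carrier R - P \<and> (\<forall>i<n. c i \<in> carrier R) \<and>
        h u \<otimes>\<^bsub>S\<^esub> b [^]\<^bsub>S\<^esub> n \<oplus>\<^bsub>S\<^esub> (\<Oplus>\<^bsub>S\<^esub>i\<in>{..<n}. h (c i) \<otimes>\<^bsub>S\<^esub> b [^]\<^bsub>S\<^esub> i) \<in> Q"
  shows "closed_map (zariski S) (zariski R) (contract R h)"
  unfolding closed_map_def
proof (intro allI impI)
  fix Z assume Z: "closedin (zariski S) Z"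
  then obtain E where E: "E \<subseteq> carrier S" "primes S - Z = {Q \<in> primes S. \<not> E \<subseteq> Q}"
    unfolding closedin_def openin_zariski S.topspace_zariski by blast
  have "Z \<subseteq> primes S" using closedin_subset[OF Z] by (simp add: S.topspace_zariski)
  then have ZE: "Z = {Q \<in> primes S. E \<subseteq> Q}" using E(2) by blast
  let ?I = "genideal S E"
  interpret I: ideal ?I S by (rule S.genideal_ideal[OF E(1)])
  have EI: "E \<subseteq> ?I" by (rule S.genideal_self[OF E(1)])
  have "contract R h ` Z = {P \<in> primes R. contract R h ?I \<subseteq> P}"
  proof (intro equalityI subsetI)
    fix P assume "P \<in> contract R h ` Z"
    then obtain Q where Q: "Q \<in> primes S" "E \<subseteq> Q" "P = contract R h Q" using ZE by blast
    then have "?I \<subseteq> Q" by (intro S.genideal_minimal) (auto simp: primes_def primeideal_def)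
    then show "P \<in> {P \<in> primes R. contract R h ?I \<subseteq> P}"
      using Q contract_prime by (auto simp: contract_def)
  next
    fix P assume "P \<in> {P \<in> primes R. contract R h ?I \<subseteq> P}"
    then have P: "primeideal P R" "contract R h ?I \<subseteq> P" by (auto simp: primes_def)
    obtain Q where "primeideal Q S" "?I \<subseteq> Q" "contract R h Q = P"
      using lying_over[OF I.is_ideal P integral[OF P(1)]] by blast
    then show "P \<in> contract R h ` Z" using EI ZE by (auto simp: primes_def)
  qed
  then have "topspace (zariski R) - contract R h ` Z = {P \<in> primes R. \<not> contract R h ?I \<subseteq> P}"
    by (auto simp: R.topspace_zariski)
  moreover have "contract R h ?I \<subseteq> carrier R" by (auto simp: contract_def)
  ultimately have "openin (zariski R) (topspace (zariski R) - contract R h ` Z)"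
    unfolding openin_zariski by blast
  moreover have "contract R h ` Z \<subseteq> topspace (zariski R)"
    using contract_prime ZE by (auto simp: R.topspace_zariski)
  ultimately show "closedin (zariski R) (contract R h ` Z)"
    unfolding closedin_def by (rule conjI[rotated])
qed

end

section \<open>Sections of the structure sheaf\<close>

lemma top_of_Spec [simp]: "top_of (Spec R) = zariski R"
  by (simp add: Spec_def)

lemma carrier_sec_Spec: "carrier (sec (Spec R) U) =
  {\<sigma> \<in> (\<Pi>\<^sub>E P\<in>U. carrier (localization R P)).
     \<forall>P \<in> U. \<exists>V a s. openin (zariski R) V \<and> P \<in> V \<and> V \<subseteq> U \<and>
       a \<in> carrier R \<and> s \<in> carrier R \<and> (\<forall>Q \<in> V. s \<notin> Q \<and> \<sigma> Q = fraction R Q a s)}"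
  by (simp add: Spec_def)

lemma mult_sec_Spec: "\<sigma> \<otimes>\<^bsub>sec (Spec R) U\<^esub> \<tau> = (\<lambda>P\<in>U. \<sigma> P \<otimes>\<^bsub>localization R P\<^esub> \<tau> P)"
  by (simp add: Spec_def prod_ring_def)

lemma add_sec_Spec: "\<sigma> \<oplus>\<^bsub>sec (Spec R) U\<^esub> \<tau> = (\<lambda>P\<in>U. \<sigma> P \<oplus>\<^bsub>localization R P\<^esub> \<tau> P)"
  by (simp add: Spec_def prod_ring_def)

lemma one_sec_Spec: "\<one>\<^bsub>sec (Spec R) U\<^esub> = (\<lambda>P\<in>U. \<one>\<^bsub>localization R P\<^esub>)"
  by (simp add: Spec_def prod_ring_def)

lemma res_Spec: "res (Spec R) U V \<sigma> = restrict \<sigma> V"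
  by (simp add: Spec_def)

lemma sec_Spec_value:
  "\<sigma> \<in> carrier (sec (Spec R) U) \<Longrightarrow> P \<in> U \<Longrightarrow> \<sigma> P \<in> carrier (localization R P)"
  unfolding carrier_sec_Spec by blast

lemma sec_Spec_local:
  assumes "\<sigma> \<in> carrier (sec (Spec R) U)" "P \<in> U"
  obtains V a s where "openin (zariski R) V" "P \<in> V" "V \<subseteq> U" "a \<in> carrier R" "s \<in> carrier R"
    "\<And>Q. Q \<in> V \<Longrightarrow> s \<notin> Q \<and> \<sigma> Q = fraction R Q a s"
proof -
  have "\<exists>V a s. openin (zariski R) V \<and> P \<in> V \<and> V \<subseteq> U \<and>
       a \<in> carrier R \<and> s \<in> carrier R \<and> (\<forall>Q \<in> V. s \<notin> Q \<and> \<sigma> Q = fraction R Q a s)"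
    using assms unfolding carrier_sec_Spec by simp
  then show thesis using that by (elim exE conjE) blast
qed

lemma sec_Spec_restrict:
  assumes \<sigma>: "\<sigma> \<in> carrier (sec (Spec R) U)" and V: "openin (zariski R) V" "V \<subseteq> U"
  shows "restrict \<sigma> V \<in> carrier (sec (Spec R) V)"
  unfolding carrier_sec_Spec
proof (intro CollectI conjI ballI)
  show "restrict \<sigma> V \<in> (\<Pi>\<^sub>E P\<in>V. carrier (localization R P))"
    using sec_Spec_value[OF \<sigma>] V(2) by auto
  fix P assume P: "P \<in> V"
  then have "P \<in> U" using V(2) by blast
  from sec_Spec_local[OF \<sigma> this] obtain W a s where W: "openin (zariski R) W" "P \<in> W" "W \<subseteq> U"
    "a \<in> carrier R" "s \<in> carrier R" "\<And>Q. Q \<in> W \<Longrightarrow> s \<notin> Q \<and> \<sigma> Q = fraction R Q a s" by metis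
  then show "\<exists>W a s. openin (zariski R) W \<and> P \<in> W \<and> W \<subseteq> V \<and> a \<in> carrier R \<and> s \<in> carrier R \<and>
      (\<forall>Q \<in> W. s \<notin> Q \<and> restrict \<sigma> V Q = fraction R Q a s)"
    using P V(1) by (intro exI[of _ "W \<inter> V"] exI[of _ a] exI[of _ s]) (auto intro: openin_Int)
qed

context cring
begin

lemma fraction_section:
  assumes "openin (zariski R) V" "a \<in> carrier R" "s \<in> carrier R" "\<And>P. P \<in> V \<Longrightarrow> s \<notin> P"
  shows "(\<lambda>P\<in>V. fraction R P a s) \<in> carrier (sec (Spec R) V)"
  unfolding carrier_sec_Spec
proof (intro CollectI conjI ballI)
  show "(\<lambda>P\<in>V. fraction R P a s) \<in> (\<Pi>\<^sub>E P\<in>V. carrier (localization R P))"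
  proof (rule restrict_PiE_iff[THEN iffD2], intro ballI)
    fix P assume P: "P \<in> V"
    then interpret primeideal P R
      using openin_zariski_subset[OF assms(1)] primes_primeideal by blast
    show "fraction R P a s \<in> carrier (localization R P)"
      using assms P by (intro frac_closed) auto
  qed
  fix P assume P: "P \<in> V"
  show "\<exists>W b t. openin (zariski R) W \<and> P \<in> W \<and> W \<subseteq> V \<and> b \<in> carrier R \<and> t \<in> carrier R \<and>
      (\<forall>Q \<in> W. t \<notin> Q \<and> (\<lambda>P\<in>V. fraction R P a s) Q = fraction R Q b t)"
    using assms P by (intro exI[of _ V] exI[of _ a] exI[of _ s]) auto
qed

lemma openin_primes: "openin (zariski R) (primes R)"
  using openin_topspace[of "zariski R"] by (simp add: topspace_zariski)

end

context ring_hom_cring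
begin

text \<open>Applying h to a relation between two fractions gives the relation between their images,
  so the definite description in \<open>localization_map\<close> has a single value.\<close>

lemma localization_map_fraction:
  assumes Q: "primeideal Q S" and a: "a \<in> carrier R" "s \<in> carrier R" "h s \<notin> Q"
  shows "localization_map R S h Q (fraction R (contract R h Q) a s) = fraction S Q (h a) (h s)"
  unfolding localization_map_def
proof (rule the_equality)
  let ?P = "contract R h Q"
  interpret Q: primeideal Q S by (rule Q)
  have P: "primeideal ?P R" using contract_prime Q by (simp add: primes_def)
  interpret P: primeideal ?P R by (rule P)
  have nP: "t \<in> carrier R - ?P \<longleftrightarrow> t \<in> carrier R \<and> h t \<notin> Q" for t unfolding contract_def by blast
  show "\<exists>b\<in>carrier R. \<exists>t\<in>carrier R - ?P.
      fraction R ?P a s = fraction R ?P b t \<and> fraction S Q (h a) (h s) = fraction S Q (h b) (h t)"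
    by (rule bexI[of _ a], rule bexI[of _ s]) (use nP[of s] a in simp_all)
  fix y assume "\<exists>b\<in>carrier R. \<exists>t\<in>carrier R - ?P.
      fraction R ?P a s = fraction R ?P b t \<and> y = fraction S Q (h b) (h t)"
  then obtain b t where bt: "b \<in> carrier R" "t \<in> carrier R - ?P" "fraction R ?P a s = fraction R ?P b t"
    and y: "y = fraction S Q (h b) (h t)" by blast
  have s: "s \<in> carrier R - ?P" using a nP by blast
  obtain u where u: "u \<in> carrier R - ?P" "u \<otimes> (t \<otimes> a) = u \<otimes> (s \<otimes> b)"
    using P.frac_eq_iff[OF a(1) s bt(1,2)] bt(3) by blast
  have "h (u \<otimes> (t \<otimes> a)) = h (u \<otimes> (s \<otimes> b))" by (simp only: u(2))
  then have eq: "h u \<otimes>\<^bsub>S\<^esub> (h t \<otimes>\<^bsub>S\<^esub> h a) = h u \<otimes>\<^bsub>S\<^esub> (h s \<otimes>\<^bsub>S\<^esub> h b)"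
    using u(1) bt(1,2) a by simp
  have "fraction S Q (h a) (h s) = fraction S Q (h b) (h t)"
  proof (rule Q.frac_eq_iff[THEN iffD2])
    show "\<exists>u\<in>carrier S - Q. u \<otimes>\<^bsub>S\<^esub> (h t \<otimes>\<^bsub>S\<^esub> h a) = u \<otimes>\<^bsub>S\<^esub> (h s \<otimes>\<^bsub>S\<^esub> h b)"
      using eq u(1) nP by blast
  qed (use a bt nP in auto)
  then show "y = fraction S Q (h a) (h s)" by (simp add: y)
qed

text \<open>A local expression a/s on V becomes the expression with numerator h a and denominator h
  s on the preimage of V, so local representability survives the pullback.\<close>

lemma Spec_map_section:
  assumes \<sigma>: "\<sigma> \<in> carrier (sec (Spec R) (primes R))"
  shows "com (Spec_map R S h) (primes R) \<sigma> \<in> carrier (sec (Spec S) (primes S))"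
    and "Q \<in> primes S \<Longrightarrow> com (Spec_map R S h) (primes R) \<sigma> Q =
      localization_map R S h Q (\<sigma> (contract R h Q))"
proof -
  let ?\<tau> = "com (Spec_map R S h) (primes R) \<sigma>"
  have dom: "{Q \<in> primes S. contract R h Q \<in> primes R} = primes S" using contract_prime by blast
  have \<tau>: "?\<tau> = (\<lambda>Q\<in>primes S. localization_map R S h Q (\<sigma> (contract R h Q)))"
    by (simp add: Spec_map_def dom)
  show val: "?\<tau> Q = localization_map R S h Q (\<sigma> (contract R h Q))" if "Q \<in> primes S" for Q
    using that by (simp add: \<tau>)
  have loc: "\<exists>V a s. openin (zariski S) V \<and> Q \<in> V \<and> V \<subseteq> primes S \<and> a \<in> carrier S \<and> s \<in> carrier S \<and>
      (\<forall>Q' \<in> V. s \<notin> Q' \<and> ?\<tau> Q' = fraction S Q' a s)" if Q: "Q \<in> primes S" for Q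
  proof -
    obtain V a s where V: "openin (zariski R) V" "contract R h Q \<in> V" "V \<subseteq> primes R"
      "a \<in> carrier R" "s \<in> carrier R" "\<And>P. P \<in> V \<Longrightarrow> s \<notin> P \<and> \<sigma> P = fraction R P a s"
      using sec_Spec_local[OF \<sigma> contract_prime[OF Q]] by metis
    let ?V = "{Q \<in> primes S. contract R h Q \<in> V}"
    have "openin (zariski S) ?V"
      using openin_continuous_map_preimage[OF continuous_map_contract V(1)] by (simp add: S.topspace_zariski)
    moreover have "h s \<notin> Q' \<and> ?\<tau> Q' = fraction S Q' (h a) (h s)" if "Q' \<in> ?V" for Q'
    proof -
      have s: "h s \<notin> Q'" using V(5) V(6)[of "contract R h Q'"] that by (auto simp: contract_def)
      moreover have "\<sigma> (contract R h Q') = fraction R (contract R h Q') a s" using V(6) that by blast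
      ultimately show ?thesis
        using that val[of Q'] localization_map_fraction[of Q' a s] V(4,5) by (simp add: primes_def)
    qed
    ultimately show ?thesis
      using Q V(2,4,5) by (intro exI[of _ ?V] exI[of _ "h a"] exI[of _ "h s"]) auto
  qed
  show "?\<tau> \<in> carrier (sec (Spec S) (primes S))"
    unfolding carrier_sec_Spec
  proof (intro CollectI conjI ballI)
    show "?\<tau> \<in> (\<Pi>\<^sub>E Q\<in>primes S. carrier (localization S Q))"
    proof (rule PiE_I)
      fix Q assume Q: "Q \<in> primes S"
      then interpret Q: primeideal Q S by (simp add: primes_def)
      from loc[OF Q] obtain V a s where "Q \<in> V" "a \<in> carrier S" "s \<in> carrier S"
        "\<forall>Q' \<in> V. s \<notin> Q' \<and> ?\<tau> Q' = fraction S Q' a s" by blast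
      then show "?\<tau> Q \<in> carrier (localization S Q)" using Q.frac_closed[of a s] by auto
    qed (simp add: \<tau>)
  qed (rule loc)
qed

end

section \<open>From integral morphisms to relations between ring elements\<close>

section \<open>Integrality on the level of rings\<close>

text \<open>The product of the finitely many denominators works, since the complement of a prime is
  multiplicatively closed.\<close>

lemma (in primeideal) common_multiple_avoiding:
  assumes "\<And>i. i < (n :: nat) \<Longrightarrow> s i \<in> carrier R - I"
  shows "\<exists>u \<in> carrier R - I. \<forall>i<n. \<exists>w \<in> carrier R. u = s i \<otimes> w"
  using assms
proof (induction n)
  case 0
  then show ?case using one_nonmemb by blast
next
  case (Suc n)
  then obtain u where u: "u \<in> carrier R - I" "\<forall>i<n. \<exists>w \<in> carrier R. u = s i \<otimes> w" by auto
  have sn: "s n \<in> carrier R - I" using Suc.prems by simp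
  have "\<exists>w \<in> carrier R. u \<otimes> s n = s i \<otimes> w" if i: "i < Suc n" for i
  proof (cases "i = n")
    case True
    then show ?thesis using u sn by (intro bexI[of _ u]) (auto simp: m_comm)
  next
    case False
    then obtain w where w: "w \<in> carrier R" "u = s i \<otimes> w" using u i by (auto simp: less_Suc_eq)
    moreover have "s i \<in> carrier R" using Suc.prems i by blast
    ultimately show ?thesis using sn by (intro bexI[of _ "w \<otimes> s n"]) (auto simp: m_assoc)
  qed
  then show ?case using nonmemb_mult[OF u(1) sn] by blast
qed

text \<open>Multiplication by a common multiple u of the denominators turns the coefficients into
  images of elements of R, at the price of u as leading coefficient. Vanishing in the local ring at
  Q then gives membership in Q.\<close>

lemma (in ring_hom_cring) relation_clear_denominators:
  fixes n :: nat
  assumes Q: "primeideal Q S" and P: "primeideal P R" and QP: "contract R h Q \<subseteq> P"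
    and b: "b \<in> carrier S" and a: "\<And>i. i < n \<Longrightarrow> a i \<in> carrier R" "\<And>i. i < n \<Longrightarrow> s i \<in> carrier R - P"
    and rel: "(fraction S Q b \<one>\<^bsub>S\<^esub>) [^]\<^bsub>localization S Q\<^esub> n \<oplus>\<^bsub>localization S Q\<^esub>
      (\<Oplus>\<^bsub>localization S Q\<^esub>i\<in>{..<n}. fraction S Q (h (a i)) (h (s i)) \<otimes>\<^bsub>localization S Q\<^esub>
        (fraction S Q b \<one>\<^bsub>S\<^esub>) [^]\<^bsub>localization S Q\<^esub> i) = \<zero>\<^bsub>localization S Q\<^esub>"
  shows "\<exists>(n :: nat) u c. u \<in> carrier R - P \<and> (\<forall>i<n. c i \<in> carrier R) \<and>
        h u \<otimes>\<^bsub>S\<^esub> b [^]\<^bsub>S\<^esub> n \<oplus>\<^bsub>S\<^esub> (\<Oplus>\<^bsub>S\<^esub>i\<in>{..<n}. h (c i) \<otimes>\<^bsub>S\<^esub> b [^]\<^bsub>S\<^esub> i) \<in> Q"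
proof -
  interpret Q: primeideal Q S by (rule Q)
  interpret P: primeideal P R by (rule P)
  let ?L = "localization S Q"
  interpret L: cring ?L by (rule Q.localization_is_cring)
  let ?j = "\<lambda>x. fraction S Q x \<one>\<^bsub>S\<^esub>"
  interpret j: ring_hom_cring S ?L ?j
    by (intro ring_hom_cring.intro ring_hom_cring_axioms.intro S.is_cring L.is_cring Q.localization_hom)
  obtain u where u: "u \<in> carrier R - P" "\<forall>i<n. \<exists>w \<in> carrier R. u = s i \<otimes> w"
    using P.common_multiple_avoiding[of n s] a(2) by blast
  then have "\<forall>i\<in>{..<n}. \<exists>w. w \<in> carrier R \<and> u = s i \<otimes> w" by blast
  from bchoice[OF this] obtain w where w: "\<And>i. i < n \<Longrightarrow> w i \<in> carrier R \<and> u = s i \<otimes> w i" by blast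
  have uR: "u \<in> carrier R" using u by simp
  define c where "c i = w i \<otimes> a i" for i
  have c: "c i \<in> carrier R" if "i < n" for i using a(1)[OF that] w[OF that] by (simp add: c_def)
  have hs: "h (s i) \<in> carrier S - Q" if "i < n" for i
    using a(2)[OF that] QP by (auto simp: contract_def)
  let ?F = "\<lambda>i. fraction S Q (h (a i)) (h (s i))"
  have F: "?F i \<in> carrier ?L" if "i < n" for i
    using a(1)[OF that] hs[OF that] by (intro Q.frac_closed) auto
  have uF: "?j (h u) \<otimes>\<^bsub>?L\<^esub> ?F i = ?j (h (c i))" if i: "i < n" for i
  proof -
    have sR: "s i \<in> carrier R" using a(2)[OF i] by simp
    have "?j (h u) \<otimes>\<^bsub>?L\<^esub> ?F i = fraction S Q (h u \<otimes>\<^bsub>S\<^esub> h (a i)) (\<one>\<^bsub>S\<^esub> \<otimes>\<^bsub>S\<^esub> h (s i))"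
      using uR a(1)[OF i] hs[OF i] Q.one_nonmemb by (intro Q.frac_mult) auto
    also have "\<dots> = ?j (h (c i))"
    proof (rule Q.frac_eqI)
      have wi: "w i \<in> carrier R" "u = s i \<otimes> w i" using w[OF i] by auto
      have "h u = h (s i) \<otimes>\<^bsub>S\<^esub> h (w i)" using wi sR by simp
      then show "\<one>\<^bsub>S\<^esub> \<otimes>\<^bsub>S\<^esub> (h u \<otimes>\<^bsub>S\<^esub> h (a i)) = \<one>\<^bsub>S\<^esub> \<otimes>\<^bsub>S\<^esub> h (s i) \<otimes>\<^bsub>S\<^esub> h (c i)"
        using wi sR a(1)[OF i] by (simp add: c_def S.m_assoc)
    qed (use uR a(1)[OF i] c[OF i] hs[OF i] Q.one_nonmemb in auto)
    finally show ?thesis .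
  qed
  have jb: "?j b \<in> carrier ?L" using b by simp
  let ?sum = "\<Oplus>\<^bsub>S\<^esub>i\<in>{..<n}. h (c i) \<otimes>\<^bsub>S\<^esub> b [^]\<^bsub>S\<^esub> i"
  have fS: "(\<lambda>i. h (c i) \<otimes>\<^bsub>S\<^esub> b [^]\<^bsub>S\<^esub> i) \<in> {..<n} \<rightarrow> carrier S" using c b by auto
  have FL: "(\<lambda>i. ?F i \<otimes>\<^bsub>?L\<^esub> ?j b [^]\<^bsub>?L\<^esub> i) \<in> {..<n} \<rightarrow> carrier ?L" using F jb by auto
  have "?j (h u \<otimes>\<^bsub>S\<^esub> b [^]\<^bsub>S\<^esub> n \<oplus>\<^bsub>S\<^esub> ?sum) = ?j (h u) \<otimes>\<^bsub>?L\<^esub> ?j b [^]\<^bsub>?L\<^esub> n \<oplus>\<^bsub>?L\<^esub> ?j ?sum"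
    using uR b fS by (simp add: j.ring.hom_nat_pow)
  also have "?j ?sum = (\<Oplus>\<^bsub>?L\<^esub>i\<in>{..<n}. ?j (h u) \<otimes>\<^bsub>?L\<^esub> (?F i \<otimes>\<^bsub>?L\<^esub> ?j b [^]\<^bsub>?L\<^esub> i))"
    unfolding j.hom_finsum[OF fS]
  proof (rule L.finsum_cong')
    show "(\<lambda>i. ?j (h u) \<otimes>\<^bsub>?L\<^esub> (?F i \<otimes>\<^bsub>?L\<^esub> ?j b [^]\<^bsub>?L\<^esub> i)) \<in> {..<n} \<rightarrow> carrier ?L"
      using F jb uR by auto
    fix i assume "i \<in> {..<n}"
    then have i: "i < n" by simp
    have "((?j \<circ> (\<lambda>i. h (c i) \<otimes>\<^bsub>S\<^esub> b [^]\<^bsub>S\<^esub> i)) i) = ?j (h (c i)) \<otimes>\<^bsub>?L\<^esub> ?j b [^]\<^bsub>?L\<^esub> i"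
      using c[OF i] b by (simp add: j.ring.hom_nat_pow)
    also have "\<dots> = ?j (h u) \<otimes>\<^bsub>?L\<^esub> (?F i \<otimes>\<^bsub>?L\<^esub> ?j b [^]\<^bsub>?L\<^esub> i)"
      unfolding uF[OF i, symmetric] using F[OF i] jb uR by (simp add: L.m_assoc)
    finally show "((?j \<circ> (\<lambda>i. h (c i) \<otimes>\<^bsub>S\<^esub> b [^]\<^bsub>S\<^esub> i)) i) =
        ?j (h u) \<otimes>\<^bsub>?L\<^esub> (?F i \<otimes>\<^bsub>?L\<^esub> ?j b [^]\<^bsub>?L\<^esub> i)" .
  qed simp
  also have "\<dots> = ?j (h u) \<otimes>\<^bsub>?L\<^esub> (\<Oplus>\<^bsub>?L\<^esub>i\<in>{..<n}. ?F i \<otimes>\<^bsub>?L\<^esub> ?j b [^]\<^bsub>?L\<^esub> i)"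
    using FL uR by (intro L.finsum_rdistr[symmetric]) auto
  also have "?j (h u) \<otimes>\<^bsub>?L\<^esub> ?j b [^]\<^bsub>?L\<^esub> n \<oplus>\<^bsub>?L\<^esub> \<dots> =
      ?j (h u) \<otimes>\<^bsub>?L\<^esub> (?j b [^]\<^bsub>?L\<^esub> n \<oplus>\<^bsub>?L\<^esub> (\<Oplus>\<^bsub>?L\<^esub>i\<in>{..<n}. ?F i \<otimes>\<^bsub>?L\<^esub> ?j b [^]\<^bsub>?L\<^esub> i))"
    using jb uR FL by (intro L.r_distr[symmetric]) auto
  also have "\<dots> = \<zero>\<^bsub>?L\<^esub>" unfolding rel using uR by simp
  finally have "?j (h u \<otimes>\<^bsub>S\<^esub> b [^]\<^bsub>S\<^esub> n \<oplus>\<^bsub>S\<^esub> ?sum) = \<zero>\<^bsub>?L\<^esub>" .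
  then have "h u \<otimes>\<^bsub>S\<^esub> b [^]\<^bsub>S\<^esub> n \<oplus>\<^bsub>S\<^esub> ?sum \<in> Q"
    using uR b fS by (intro Q.frac_one_zero_imp_mem) auto
  then show ?thesis using u(1) c by blast
qed

lemma morphism_continuous: "morphism X Y f \<Longrightarrow> continuous_map (top_of X) (top_of Y) (pt f)"
  by (simp add: morphism_def)

lemma morphism_com: "morphism X Y f \<Longrightarrow> open_of Y V \<Longrightarrow> com f V \<in> ring_hom (sec Y V) (sec X (preim X f V))"
  by (simp add: morphism_def)

lemma morphism_res:
  assumes "morphism X Y f" "open_of Y V" "open_of Y W" "W \<subseteq> V" "s \<in> carrier (sec Y V)"
  shows "com f W (res Y V W s) = res X (preim X f V) (preim X f W) (com f V s)"
  using assms unfolding morphism_def by blast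

lemma preim_points: "morphism X Y f \<Longrightarrow> preim X f (points Y) = points X"
  using continuous_map_image_subset_topspace[OF morphism_continuous] unfolding preim_def by blast

lemma open_preim: "morphism X Y f \<Longrightarrow> open_of Y V \<Longrightarrow> open_of X (preim X f V)"
  unfolding preim_def by (rule openin_continuous_map_preimage[OF morphism_continuous])

lemma locally_ringed_space_cring:
  "locally_ringed_space X \<Longrightarrow> open_of X U \<Longrightarrow> cring (sec X U)"
  by (simp add: locally_ringed_space_def sheaf_of_rings_def presheaf_of_rings_def)

lemma evaluation_hom:
  assumes h: "h \<in> ring_hom T (sec (Spec R) U)" and Q: "Q \<in> U"
  shows "(\<lambda>s. h s Q) \<in> ring_hom T (localization R Q)"
proof (rule ring_hom_memI)
  show "h x Q \<in> carrier (localization R Q)" if "x \<in> carrier T" for x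
    by (rule sec_Spec_value[OF ring_hom_closed[OF h that] Q])
  show "h (x \<otimes>\<^bsub>T\<^esub> y) Q = h x Q \<otimes>\<^bsub>localization R Q\<^esub> h y Q"
    if "x \<in> carrier T" "y \<in> carrier T" for x y
    using Q by (simp add: ring_hom_mult[OF h that] mult_sec_Spec)
  show "h (x \<oplus>\<^bsub>T\<^esub> y) Q = h x Q \<oplus>\<^bsub>localization R Q\<^esub> h y Q"
    if "x \<in> carrier T" "y \<in> carrier T" for x y
    using Q by (simp add: ring_hom_add[OF h that] add_sec_Spec)
  show "h \<one>\<^bsub>T\<^esub> Q = \<one>\<^bsub>localization R Q\<^esub>"
    using Q by (simp add: ring_hom_one[OF h] one_sec_Spec)
qed

text \<open>The integral equation of the global section \<open>b\<close> is pulled back to \<open>Spec B\<close> and evaluated in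
  the localization at \<open>Q\<close>; this avoids identifying \<open>B\<close> with the global sections of \<open>Spec B\<close>.\<close>

lemma integral_mor_relation:
  fixes X :: "('p, 's) ringed_space" and Y :: "('q, 't) ringed_space"
  assumes \<phi>: "ring_hom_cring A B \<phi>" and X: "locally_ringed_space X"
    and f: "morphism X Y f" and \<alpha>: "iso_mor Y (Spec A) \<alpha>" and \<beta>: "iso_mor X (Spec B) \<beta>"
    and eq: "mor_eq X (Spec A) (comp_mor Y \<alpha> f) (comp_mor (Spec B) (Spec_map A B \<phi>) \<beta>)"
    and int: "integral_hom (sec Y (points Y)) (sec X (points X)) (com f (points Y))"
    and P: "primeideal P A" and Q: "primeideal Q B" and QP: "contract A \<phi> Q \<subseteq> P" and b: "b \<in> carrier B"
  shows "\<exists>(n :: nat) u c. u \<in> carrier A - P \<and> (\<forall>i<n. c i \<in> carrier A) \<and>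
        \<phi> u \<otimes>\<^bsub>B\<^esub> b [^]\<^bsub>B\<^esub> n \<oplus>\<^bsub>B\<^esub> (\<Oplus>\<^bsub>B\<^esub>i\<in>{..<n}. \<phi> (c i) \<otimes>\<^bsub>B\<^esub> b [^]\<^bsub>B\<^esub> i) \<in> Q"
proof -
  interpret \<phi>: ring_hom_cring A B \<phi> by (rule \<phi>)
  interpret Q: primeideal Q B by (rule Q)
  let ?L = "localization B Q"
  have PA: "P \<in> primes A" and QB: "Q \<in> primes B" using P Q by (simp_all add: primes_def)
  have ptA: "points (Spec A) = primes A" and ptB: "points (Spec B) = primes B"
    by (simp_all add: \<phi>.R.topspace_zariski \<phi>.S.topspace_zariski)
  have opA: "open_of (Spec A) (primes A)" and opB: "open_of (Spec B) (primes B)"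
    by (simp_all add: \<phi>.R.openin_primes \<phi>.S.openin_primes)
  from \<alpha> obtain \<gamma> where \<alpha>m: "morphism Y (Spec A) \<alpha>" and \<gamma>: "morphism (Spec A) Y \<gamma>"
    and \<gamma>\<alpha>: "mor_eq Y Y (comp_mor (Spec A) \<gamma> \<alpha>) id_mor" unfolding iso_mor_def by blast
  from \<beta> obtain \<delta> where \<beta>m: "morphism X (Spec B) \<beta>" and \<delta>: "morphism (Spec B) X \<delta>"
    and \<beta>\<delta>: "mor_eq (Spec B) (Spec B) (comp_mor X \<beta> \<delta>) id_mor" unfolding iso_mor_def by blast
  have pre: "preim X f (points Y) = points X" "preim Y \<alpha> (primes A) = points Y"
    "preim (Spec A) \<gamma> (points Y) = primes A" "preim X \<beta> (primes B) = points X"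
    "preim (Spec B) \<delta> (points X) = primes B"
    using preim_points[OF f] preim_points[OF \<alpha>m] preim_points[OF \<gamma>] preim_points[OF \<beta>m]
      preim_points[OF \<delta>] by (simp_all only: ptA ptB)
  have preS: "preim (Spec B) (Spec_map A B \<phi>) (primes A) = primes B"
    using \<phi>.contract_prime unfolding preim_def ptB by (auto simp: Spec_map_def)
  have \<delta>hom: "com \<delta> (points X) \<in> ring_hom (sec X (points X)) (sec (Spec B) (primes B))"
    using morphism_com[OF \<delta> openin_topspace] by (simp add: pre)
  have \<beta>hom: "com \<beta> (primes B) \<in> ring_hom (sec (Spec B) (primes B)) (sec X (points X))"
    using morphism_com[OF \<beta>m opB] by (simp add: pre)
  have \<gamma>hom: "com \<gamma> (points Y) \<in> ring_hom (sec Y (points Y)) (sec (Spec A) (primes A))"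
    using morphism_com[OF \<gamma> openin_topspace] by (simp add: pre)
  have fhom: "com f (points Y) \<in> ring_hom (sec Y (points Y)) (sec X (points X))"
    using morphism_com[OF f openin_topspace] by (simp add: pre)
  have \<delta>\<beta>: "com \<delta> (points X) (com \<beta> (primes B) s) = s" if "s \<in> carrier (sec (Spec B) (primes B))" for s
  proof -
    have "com (comp_mor X \<beta> \<delta>) (primes B) s = com id_mor (primes B) s"
      using \<beta>\<delta> opB that unfolding mor_eq_def by blast
    then show ?thesis by (simp add: comp_mor_def id_mor_def pre)
  qed
  let ?\<Gamma> = "sec X (points X)"
  interpret e: ring_hom_cring ?\<Gamma> ?L "\<lambda>s. com \<delta> (points X) s Q"
    by (intro ring_hom_cring.intro ring_hom_cring_axioms.intro Q.localization_is_cring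
        locally_ringed_space_cring[OF X openin_topspace] evaluation_hom[OF \<delta>hom QB])
  let ?e = "\<lambda>s. com \<delta> (points X) s Q"
  \<comment> \<open>The global section b/1. Moved to X by \<beta> it satisfies an integral equation;
    moved back by \<delta> and evaluated at Q, it is again b/1 in the local ring.\<close>
  let ?\<sigma> = "\<lambda>Q\<in>primes B. fraction B Q b \<one>\<^bsub>B\<^esub>"
  have \<sigma>: "?\<sigma> \<in> carrier (sec (Spec B) (primes B))"
    using b \<phi>.S.one_notin_prime by (intro \<phi>.S.fraction_section \<phi>.S.openin_primes) auto
  let ?t = "com \<beta> (primes B) ?\<sigma>"
  have t: "?t \<in> carrier ?\<Gamma>" by (rule ring_hom_closed[OF \<beta>hom \<sigma>])
  have et: "?e ?t = fraction B Q b \<one>\<^bsub>B\<^esub>" using \<delta>\<beta>[OF \<sigma>] QB by simp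
  obtain n c where c: "\<forall>i<(n :: nat). c i \<in> carrier (sec Y (points Y))"
    and rel: "?t [^]\<^bsub>?\<Gamma>\<^esub> n \<oplus>\<^bsub>?\<Gamma>\<^esub>
      (\<Oplus>\<^bsub>?\<Gamma>\<^esub>i\<in>{..<n}. com f (points Y) (c i) \<otimes>\<^bsub>?\<Gamma>\<^esub> ?t [^]\<^bsub>?\<Gamma>\<^esub> i) = \<zero>\<^bsub>?\<Gamma>\<^esub>"
    using int t unfolding integral_hom_def by blast
  define d where "d i = com \<gamma> (points Y) (c i)" for i
  have d: "d i \<in> carrier (sec (Spec A) (primes A))" if "i < n" for i
    unfolding d_def using ring_hom_closed[OF \<gamma>hom] c that by blast
  have "\<exists>a s. a \<in> carrier A \<and> s \<in> carrier A - P \<and>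
      ?e (com f (points Y) (c i)) = fraction B Q (\<phi> a) (\<phi> s)" if i: "i < n" for i
  proof -
    let ?z = "com (Spec_map A B \<phi>) (primes A) (d i)"
    have "com (comp_mor (Spec A) \<gamma> \<alpha>) (points Y) (c i) = com id_mor (points Y) (c i)"
      using \<gamma>\<alpha> c i openin_topspace[of "top_of Y"] unfolding mor_eq_def by blast
    then have ci: "com \<alpha> (primes A) (d i) = c i"
      by (simp add: comp_mor_def id_mor_def pre d_def)
    have "com (comp_mor Y \<alpha> f) (primes A) (d i) =
        com (comp_mor (Spec B) (Spec_map A B \<phi>) \<beta>) (primes A) (d i)"
      using eq opA d[OF i] unfolding mor_eq_def by blast
    then have "com f (points Y) (com \<alpha> (primes A) (d i)) = com \<beta> (primes B) ?z"
      by (simp add: comp_mor_def pre preS)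
    then have "?e (com f (points Y) (c i)) = ?z Q"
      using \<delta>\<beta>[OF \<phi>.Spec_map_section(1)[OF d[OF i]]] by (simp add: ci)
    also have "\<dots> = localization_map A B \<phi> Q (d i (contract A \<phi> Q))"
      by (rule \<phi>.Spec_map_section(2)[OF d[OF i] QB])
    finally have ez: "?e (com f (points Y) (c i)) = localization_map A B \<phi> Q (d i (contract A \<phi> Q))" .
    \<comment> \<open>The fraction is chosen near P, not merely near the contraction of Q. The
      contraction is the smaller prime and so lies in the same open set; in this way the equation at
      Q acquires denominators outside P.\<close>
    obtain V a s where V: "openin (zariski A) V" "P \<in> V" "V \<subseteq> primes A" "a \<in> carrier A" "s \<in> carrier A"
      "\<And>P'. P' \<in> V \<Longrightarrow> s \<notin> P' \<and> d i P' = fraction A P' a s"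
      using sec_Spec_local[OF d[OF i] PA] by metis
    have QV: "contract A \<phi> Q \<in> V"
      by (rule \<phi>.R.open_generization_closed[OF V(1,2) \<phi>.contract_prime[OF QB] QP])
    then have "d i (contract A \<phi> Q) = fraction A (contract A \<phi> Q) a s" and "\<phi> s \<notin> Q"
      using V(5) V(6)[OF QV] by (auto simp: contract_def)
    then have "?e (com f (points Y) (c i)) = fraction B Q (\<phi> a) (\<phi> s)"
      using ez \<phi>.localization_map_fraction[OF Q V(4,5)] by simp
    then show ?thesis using V(2,4,5) V(6)[of P] by blast
  qed
  then have "\<forall>i\<in>{..<n}. \<exists>p. fst p \<in> carrier A \<and> snd p \<in> carrier A - P \<and>
      ?e (com f (points Y) (c i)) = fraction B Q (\<phi> (fst p)) (\<phi> (snd p))"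
    by simp
  from bchoice[OF this] obtain p where p: "\<forall>i\<in>{..<n}. fst (p i) \<in> carrier A \<and> snd (p i) \<in> carrier A - P \<and>
      ?e (com f (points Y) (c i)) = fraction B Q (\<phi> (fst (p i))) (\<phi> (snd (p i)))" by (rule exE)
  let ?T = "\<lambda>i. com f (points Y) (c i) \<otimes>\<^bsub>?\<Gamma>\<^esub> ?t [^]\<^bsub>?\<Gamma>\<^esub> i"
  have fc: "com f (points Y) (c i) \<in> carrier ?\<Gamma>" if "i < n" for i
    using ring_hom_closed[OF fhom] c that by blast
  have T: "?T \<in> {..<n} \<rightarrow> carrier ?\<Gamma>" using fc t by auto
  let ?G = "\<lambda>i. fraction B Q (\<phi> (fst (p i))) (\<phi> (snd (p i))) \<otimes>\<^bsub>?L\<^esub> (fraction B Q b \<one>\<^bsub>B\<^esub>) [^]\<^bsub>?L\<^esub> i"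
  have eT: "?e (?T i) = ?G i" if i: "i < n" for i
    using fc[OF i] t p i by (simp add: e.ring.hom_nat_pow et)
  have "\<zero>\<^bsub>?L\<^esub> = ?e (?t [^]\<^bsub>?\<Gamma>\<^esub> n \<oplus>\<^bsub>?\<Gamma>\<^esub> (\<Oplus>\<^bsub>?\<Gamma>\<^esub>i\<in>{..<n}. ?T i))"
    unfolding rel by simp
  also have "\<dots> = ?e (?t [^]\<^bsub>?\<Gamma>\<^esub> n) \<oplus>\<^bsub>?L\<^esub> ?e (\<Oplus>\<^bsub>?\<Gamma>\<^esub>i\<in>{..<n}. ?T i)"
    using t T by (intro e.hom_add) auto
  also have "?e (?t [^]\<^bsub>?\<Gamma>\<^esub> n) = (fraction B Q b \<one>\<^bsub>B\<^esub>) [^]\<^bsub>?L\<^esub> n"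
    using t by (simp add: e.ring.hom_nat_pow et)
  also have "?e (\<Oplus>\<^bsub>?\<Gamma>\<^esub>i\<in>{..<n}. ?T i) = (\<Oplus>\<^bsub>?L\<^esub>i\<in>{..<n}. ?G i)"
    unfolding e.hom_finsum[OF T]
  proof (rule e.S.finsum_cong')
    show "?G \<in> {..<n} \<rightarrow> carrier ?L"
    proof
      fix i assume "i \<in> {..<n}"
      then have "i < n" by simp
      from eT[OF this] show "?G i \<in> carrier ?L" using T \<open>i < n\<close> e.hom_closed[of "?T i"] by auto
    qed
    show "(?e \<circ> ?T) i = ?G i" if "i \<in> {..<n}" for i using eT that by simp
  qed simp
  finally have "(fraction B Q b \<one>\<^bsub>B\<^esub>) [^]\<^bsub>?L\<^esub> n \<oplus>\<^bsub>?L\<^esub> (\<Oplus>\<^bsub>?L\<^esub>i\<in>{..<n}. ?G i) = \<zero>\<^bsub>?L\<^esub>" by simp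
  then show ?thesis
    using p by (intro \<phi>.relation_clear_denominators[OF Q P QP b,
        where a = "\<lambda>i. fst (p i)" and s = "\<lambda>i. snd (p i)" and n = n]) auto
qed

section \<open>Preimages of basic open sets\<close>

lemma restrict_eq_iff: "restrict s W = restrict t W \<longleftrightarrow> (\<forall>y \<in> W. s y = t y)"
  by (metis restrict_apply' restrict_ext)

lemma germ_Spec:
  "germ (Spec R) x U s = {(V, t). openin (zariski R) V \<and> x \<in> V \<and> t \<in> carrier (sec (Spec R) V) \<and>
     (\<exists>W. openin (zariski R) W \<and> x \<in> W \<and> W \<subseteq> U \<inter> V \<and> (\<forall>y \<in> W. s y = t y))}"
  by (simp add: germ_def res_Spec restrict_eq_iff)

lemma germ_Spec_eqI:
  assumes W: "openin (zariski R) W" "x \<in> W" "W \<subseteq> U" "W \<subseteq> V" and st: "\<And>y. y \<in> W \<Longrightarrow> s y = t y"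
  shows "germ (Spec R) x U s = germ (Spec R) x V t"
proof -
  have sub: "germ (Spec R) x U s \<subseteq> germ (Spec R) x V t" if "W \<subseteq> U" "W \<subseteq> V" "\<And>y. y \<in> W \<Longrightarrow> s y = t y"
    for U V s t
    unfolding germ_Spec
  proof clarify
    fix V' t' W' assume *: "openin (zariski R) W'" "x \<in> W'" "W' \<subseteq> U \<inter> V'" "\<forall>y\<in>W'. s y = t' y"
    have "\<forall>y \<in> W \<inter> W'. t y = t' y"
      using *(4) that(3) by (metis IntD1 IntD2)
    then show "\<exists>W. openin (zariski R) W \<and> x \<in> W \<and> W \<subseteq> V \<inter> V' \<and> (\<forall>y\<in>W. t y = t' y)"
      using * W(1,2) that(2) by (intro exI[of _ "W \<inter> W'"]) (auto intro: openin_Int)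
  qed
  show ?thesis
  proof
    show "germ (Spec R) x U s \<subseteq> germ (Spec R) x V t" by (rule sub[OF W(3,4)]) (rule st)
    show "germ (Spec R) x V t \<subseteq> germ (Spec R) x U s" by (rule sub[OF W(4,3)]) (rule st[symmetric])
  qed
qed

lemma germ_Spec_eqD:
  assumes "germ (Spec R) x U s = germ (Spec R) x V t"
    and "openin (zariski R) V" "x \<in> V" "t \<in> carrier (sec (Spec R) V)"
  obtains W where "openin (zariski R) W" "x \<in> W" "W \<subseteq> U" "W \<subseteq> V" "\<forall>y \<in> W. s y = t y"
proof -
  have "(V, t) \<in> germ (Spec R) x V t" using assms(2-4) unfolding germ_Spec by blast
  then have "(V, t) \<in> germ (Spec R) x U s" using assms(1) by simp
  then show thesis using that unfolding germ_Spec by blast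
qed

text \<open>Two choices of representatives agree on a common smaller neighbourhood, and products of
  sections are pointwise, so the description in \<open>germ_op\<close> determines a single
  germ.\<close>

lemma stalk_mult_germ:
  assumes U: "openin (zariski R) U" "x \<in> U"
    and s: "s \<in> carrier (sec (Spec R) U)" and t: "t \<in> carrier (sec (Spec R) U)"
  shows "germ (Spec R) x U s \<otimes>\<^bsub>stalk (Spec R) x\<^esub> germ (Spec R) x U t =
    germ (Spec R) x U (s \<otimes>\<^bsub>sec (Spec R) U\<^esub> t)"
proof -
  have "germ_op (\<lambda>U. mult (sec (Spec R) U)) (Spec R) x (germ (Spec R) x U s) (germ (Spec R) x U t) =
      germ (Spec R) x U (s \<otimes>\<^bsub>sec (Spec R) U\<^esub> t)"
    unfolding germ_op_def
  proof (rule the_equality)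
    show "\<exists>U' s' t'. open_of (Spec R) U' \<and> x \<in> U' \<and> s' \<in> carrier (sec (Spec R) U') \<and>
        t' \<in> carrier (sec (Spec R) U') \<and> germ (Spec R) x U s = germ (Spec R) x U' s' \<and>
        germ (Spec R) x U t = germ (Spec R) x U' t' \<and>
        germ (Spec R) x U (s \<otimes>\<^bsub>sec (Spec R) U\<^esub> t) = germ (Spec R) x U' (s' \<otimes>\<^bsub>sec (Spec R) U'\<^esub> t')"
      using U s t by (intro exI[of _ U] exI[of _ s] exI[of _ t]) simp
    fix g assume "\<exists>U' s' t'. open_of (Spec R) U' \<and> x \<in> U' \<and> s' \<in> carrier (sec (Spec R) U') \<and>
        t' \<in> carrier (sec (Spec R) U') \<and> germ (Spec R) x U s = germ (Spec R) x U' s' \<and>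
        germ (Spec R) x U t = germ (Spec R) x U' t' \<and> g = germ (Spec R) x U' (s' \<otimes>\<^bsub>sec (Spec R) U'\<^esub> t')"
    then obtain U' s' t' where U': "openin (zariski R) U'" "x \<in> U'" "s' \<in> carrier (sec (Spec R) U')"
      "t' \<in> carrier (sec (Spec R) U')" and gs: "germ (Spec R) x U s = germ (Spec R) x U' s'"
      and gt: "germ (Spec R) x U t = germ (Spec R) x U' t'"
      and g: "g = germ (Spec R) x U' (s' \<otimes>\<^bsub>sec (Spec R) U'\<^esub> t')" by auto
    obtain W where W: "openin (zariski R) W" "x \<in> W" "W \<subseteq> U" "W \<subseteq> U'" "\<forall>y \<in> W. s y = s' y"
      by (rule germ_Spec_eqD[OF gs U'(1,2,3)])
    obtain W' where W': "openin (zariski R) W'" "x \<in> W'" "W' \<subseteq> U" "W' \<subseteq> U'" "\<forall>y \<in> W'. t y = t' y"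
      by (rule germ_Spec_eqD[OF gt U'(1,2,4)])
    show "g = germ (Spec R) x U (s \<otimes>\<^bsub>sec (Spec R) U\<^esub> t)"
      unfolding g
    proof (rule germ_Spec_eqI)
      show "openin (zariski R) (W \<inter> W')" using W(1) W'(1) by (rule openin_Int)
      show "(s' \<otimes>\<^bsub>sec (Spec R) U'\<^esub> t') y = (s \<otimes>\<^bsub>sec (Spec R) U\<^esub> t) y" if "y \<in> W \<inter> W'" for y
      proof -
        have "y \<in> U" "y \<in> U'" "s y = s' y" "t y = t' y" using that W W' by auto
        then show ?thesis by (simp add: mult_sec_Spec)
      qed
    qed (use W W' in auto)
  qed
  then show ?thesis by (simp add: stalk_def)
qed

lemma stalk_carrier:
  "carrier (stalk X x) = {germ X x U s | U s. open_of X U \<and> x \<in> U \<and> s \<in> carrier (sec X U)}"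
  by (simp add: stalk_def)

lemma (in cring) stalk_one: "\<one>\<^bsub>stalk (Spec R) x\<^esub> = germ (Spec R) x (primes R) \<one>\<^bsub>sec (Spec R) (primes R)\<^esub>"
  by (simp add: stalk_def topspace_zariski)

lemma (in cring) one_section: "\<one>\<^bsub>sec (Spec R) (primes R)\<^esub> \<in> carrier (sec (Spec R) (primes R))"
proof -
  have "\<one>\<^bsub>sec (Spec R) (primes R)\<^esub> = (\<lambda>P\<in>primes R. fraction R P \<one> \<one>)"
    unfolding one_sec_Spec
    by (rule restrict_ext) (simp add: primeideal.localization_one primes_primeideal)
  then show ?thesis
    using fraction_section[OF openin_primes one_closed one_closed one_notin_prime] by simp
qed

text \<open>If x were in I, clearing denominators in the equation would equate an element of I with
  a product of elements outside I.\<close>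

lemma (in primeideal) frac_mult_eq_one:
  assumes x: "x \<in> carrier R" "y \<in> carrier R - I" and z: "z \<in> carrier (localization R I)"
    and one: "frac x y \<otimes>\<^bsub>localization R I\<^esub> z = \<one>\<^bsub>localization R I\<^esub>"
  shows "x \<notin> I"
proof
  assume xI: "x \<in> I"
  obtain c t where c: "c \<in> carrier R" "t \<in> carrier R - I" "z = frac c t" using z by (rule localizationE)
  have "frac (x \<otimes> c) (y \<otimes> t) = frac \<one> \<one>"
    using one x c by (simp add: frac_mult localization_one)
  then obtain u where u: "u \<in> carrier R - I" "u \<otimes> (\<one> \<otimes> (x \<otimes> c)) = u \<otimes> (y \<otimes> t \<otimes> \<one>)"
    using frac_eq_iff[of "x \<otimes> c" "y \<otimes> t" \<one> \<one>] x c nonmemb_mult one_nonmemb by auto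
  have "u \<otimes> (\<one> \<otimes> (x \<otimes> c)) \<in> I"
    by (rule I_l_closed[OF I_l_closed[OF I_r_closed[OF xI c(1)] one_closed]]) (use u(1) in blast)
  moreover have "u \<otimes> (y \<otimes> t \<otimes> \<one>) \<in> carrier R - I"
    using u(1) x c by (intro nonmemb_mult one_nonmemb)
  ultimately show False using u(2) by simp
qed

text \<open>Compatibility of the morphism with restriction makes the germ of the image independent
  of the chosen representative.\<close>

lemma stalk_map_germ:
  assumes f: "morphism (Spec B) (Spec A) f" and x: "x \<in> points (Spec B)"
    and U: "openin (zariski A) U" "pt f x \<in> U" "s \<in> carrier (sec (Spec A) U)"
  shows "stalk_map (Spec B) (Spec A) f x (germ (Spec A) (pt f x) U s) =
    germ (Spec B) x (preim (Spec B) f U) (com f U s)"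
  unfolding stalk_map_def
proof (rule the_equality)
  show "\<exists>V t. open_of (Spec A) V \<and> pt f x \<in> V \<and> t \<in> carrier (sec (Spec A) V) \<and>
      germ (Spec A) (pt f x) U s = germ (Spec A) (pt f x) V t \<and>
      germ (Spec B) x (preim (Spec B) f U) (com f U s) = germ (Spec B) x (preim (Spec B) f V) (com f V t)"
    using U by (intro exI[of _ U] exI[of _ s]) simp
  fix c assume "\<exists>V t. open_of (Spec A) V \<and> pt f x \<in> V \<and> t \<in> carrier (sec (Spec A) V) \<and>
      germ (Spec A) (pt f x) U s = germ (Spec A) (pt f x) V t \<and>
      c = germ (Spec B) x (preim (Spec B) f V) (com f V t)"
  then obtain V t where V: "openin (zariski A) V" "pt f x \<in> V" "t \<in> carrier (sec (Spec A) V)"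
    and eq: "germ (Spec A) (pt f x) U s = germ (Spec A) (pt f x) V t"
    and c: "c = germ (Spec B) x (preim (Spec B) f V) (com f V t)" by auto
  obtain W where W: "openin (zariski A) W" "pt f x \<in> W" "W \<subseteq> U" "W \<subseteq> V" "\<forall>y \<in> W. s y = t y"
    by (rule germ_Spec_eqD[OF eq V])
  have "restrict s W = restrict t W" using W(5) by (simp add: restrict_eq_iff)
  then have eqW: "restrict (com f U s) (preim (Spec B) f W) = restrict (com f V t) (preim (Spec B) f W)"
    using morphism_res[OF f, of U W s] morphism_res[OF f, of V W t] U V W by (simp add: res_Spec)
  show "c = germ (Spec B) x (preim (Spec B) f U) (com f U s)"
    unfolding c
  proof (rule germ_Spec_eqI)
    show "openin (zariski B) (preim (Spec B) f W)" using open_preim[OF f, of W] W(1) by simp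
    show "x \<in> preim (Spec B) f W" using x W(2) by (simp add: preim_def)
    show "preim (Spec B) f W \<subseteq> preim (Spec B) f V" "preim (Spec B) f W \<subseteq> preim (Spec B) f U"
      using W(3,4) by (auto simp: preim_def)
    show "com f V t y = com f U s y" if "y \<in> preim (Spec B) f W" for y
      using eqW that by (simp add: restrict_eq_iff)
  qed
qed

text \<open>Over a neighbourhood of \<open>Q\<close> on which the pulled back section \<open>a\<close> is \<open>b/s\<close>, the preimage of
  \<open>basic_open A a\<close> is \<open>basic_open B b\<close>: both describe where the section is invertible, by
  functoriality in one direction and by locality of the maps on stalks in the other.\<close>

lemma morphism_preim_basic_open_local:
  assumes A: "cring A" and B: "cring B" and f: "morphism (Spec B) (Spec A) f"
    and a: "a \<in> carrier A"
    and V: "openin (zariski B) V" "Q \<in> V" and b: "b \<in> carrier B" "s \<in> carrier B"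
    and loc: "\<And>Q'. Q' \<in> V \<Longrightarrow> s \<notin> Q' \<and>
      com f (primes A) (\<lambda>P\<in>primes A. fraction A P a \<one>\<^bsub>A\<^esub>) Q' = fraction B Q' b s"
  shows "a \<notin> pt f Q \<longleftrightarrow> b \<notin> Q"
proof -
  interpret A: cring A by (rule A)
  interpret B: cring B by (rule B)
  let ?\<sigma> = "\<lambda>P\<in>primes A. fraction A P a \<one>\<^bsub>A\<^esub>"
  let ?\<tau> = "com f (primes A) ?\<sigma>"
  have QB: "Q \<in> primes B" using V B.openin_zariski_subset by blast
  then have PA: "pt f Q \<in> primes A"
    using continuous_map_image_subset_topspace[OF morphism_continuous[OF f]]
    by (auto simp: A.topspace_zariski B.topspace_zariski)
  have pre: "preim (Spec B) f (primes A) = primes B"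
    using preim_points[OF f] by (simp add: A.topspace_zariski B.topspace_zariski)
  interpret Q: primeideal Q B by (rule B.primes_primeideal[OF QB])
  interpret P: primeideal "pt f Q" A by (rule A.primes_primeideal[OF PA])
  have \<sigma>: "?\<sigma> \<in> carrier (sec (Spec A) (primes A))"
    using a A.one_notin_prime by (intro A.fraction_section A.openin_primes) auto
  have comA: "com f (primes A) \<in> ring_hom (sec (Spec A) (primes A)) (sec (Spec B) (primes B))"
    using morphism_com[OF f, of "primes A"] A.openin_primes by (simp add: pre)
  have \<tau>: "?\<tau> \<in> carrier (sec (Spec B) (primes B))" by (rule ring_hom_closed[OF comA \<sigma>])
  have \<tau>Q: "?\<tau> Q = fraction B Q b s" and sQ: "s \<in> carrier B - Q" using loc[OF V(2)] b by auto
  show ?thesis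
  proof
    assume aP: "a \<notin> pt f Q"
    let ?U = "basic_open A a"
    have U: "openin (zariski A) ?U" by (rule A.openin_basic_open[OF a])
    have UA: "?U \<subseteq> primes A" by (auto simp: basic_open_def)
    \<comment> \<open>The inverse of the section a on \<open>basic_open A a\<close>; its image
      inverts the pulled back section over the preimage, in particular at Q.\<close>
    let ?\<epsilon> = "\<lambda>P\<in>?U. fraction A P \<one>\<^bsub>A\<^esub> a"
    have \<epsilon>: "?\<epsilon> \<in> carrier (sec (Spec A) ?U)"
      using a U by (intro A.fraction_section) (auto simp: basic_open_def)
    have \<sigma>U: "restrict ?\<sigma> ?U \<in> carrier (sec (Spec A) ?U)" by (rule sec_Spec_restrict[OF \<sigma> U UA])
    have "restrict ?\<sigma> ?U \<otimes>\<^bsub>sec (Spec A) ?U\<^esub> ?\<epsilon> = \<one>\<^bsub>sec (Spec A) ?U\<^esub>"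
      unfolding mult_sec_Spec one_sec_Spec
    proof (rule restrict_ext)
      fix P assume P: "P \<in> ?U"
      then have PA: "P \<in> primes A" using UA by blast
      interpret P': primeideal P A by (rule A.primes_primeideal[OF PA])
      show "restrict ?\<sigma> ?U P \<otimes>\<^bsub>localization A P\<^esub> ?\<epsilon> P = \<one>\<^bsub>localization A P\<^esub>"
        using P PA a P'.frac_inverse[of a] by (simp add: basic_open_def)
    qed
    moreover have comU: "com f ?U \<in> ring_hom (sec (Spec A) ?U) (sec (Spec B) (preim (Spec B) f ?U))"
      using morphism_com[OF f, of ?U] U by simp
    ultimately have one: "com f ?U (restrict ?\<sigma> ?U) \<otimes>\<^bsub>sec (Spec B) (preim (Spec B) f ?U)\<^esub> com f ?U ?\<epsilon> =
        \<one>\<^bsub>sec (Spec B) (preim (Spec B) f ?U)\<^esub>"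
      using ring_hom_mult[OF comU \<sigma>U \<epsilon>] ring_hom_one[OF comU] by simp
    have res: "com f ?U (restrict ?\<sigma> ?U) = restrict ?\<tau> (preim (Spec B) f ?U)"
      using morphism_res[OF f, of "primes A" ?U ?\<sigma>] A.openin_primes U UA \<sigma> by (simp add: res_Spec pre)
    have Qpre: "Q \<in> preim (Spec B) f ?U"
      using QB PA aP by (simp add: preim_def B.topspace_zariski basic_open_def)
    have "?\<tau> Q \<otimes>\<^bsub>localization B Q\<^esub> com f ?U ?\<epsilon> Q = \<one>\<^bsub>localization B Q\<^esub>"
      using fun_cong[OF one, of Q] Qpre unfolding mult_sec_Spec one_sec_Spec res by simp
    moreover have "com f ?U ?\<epsilon> Q \<in> carrier (localization B Q)"
      by (rule sec_Spec_value[OF ring_hom_closed[OF comU \<epsilon>] Qpre])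
    ultimately show "b \<notin> Q" using \<tau>Q b sQ by (intro Q.frac_mult_eq_one[OF _ sQ]) auto
  next
    assume bQ: "b \<notin> Q"
    let ?V = "V \<inter> basic_open B b"
    have V': "openin (zariski B) ?V" using V(1) B.openin_basic_open[OF b(1)] by (rule openin_Int)
    have QV: "Q \<in> ?V" using V(2) QB bQ by (simp add: basic_open_def)
    have VB: "?V \<subseteq> primes B" by (auto simp: basic_open_def)
    \<comment> \<open>The inverse s/b of the pulled back section near Q. It makes the germ at Q a
      unit, and the local homomorphism on stalks reflects units.\<close>
    let ?\<kappa> = "\<lambda>Q\<in>?V. fraction B Q s b"
    have \<kappa>: "?\<kappa> \<in> carrier (sec (Spec B) ?V)"
      using V' b by (intro B.fraction_section) (auto simp: basic_open_def)
    have \<tau>V: "restrict ?\<tau> ?V \<in> carrier (sec (Spec B) ?V)" by (rule sec_Spec_restrict[OF \<tau> V' VB])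
    let ?S = "stalk (Spec B) Q"
    have g\<tau>: "germ (Spec B) Q (primes B) ?\<tau> = germ (Spec B) Q ?V (restrict ?\<tau> ?V)"
      by (rule germ_Spec_eqI[OF V' QV VB]) auto
    have prod: "?\<kappa> Q' \<otimes>\<^bsub>localization B Q'\<^esub> ?\<tau> Q' = \<one>\<^bsub>localization B Q'\<^esub>"
      "?\<tau> Q' \<otimes>\<^bsub>localization B Q'\<^esub> ?\<kappa> Q' = \<one>\<^bsub>localization B Q'\<^esub>" if Q': "Q' \<in> ?V" for Q'
    proof -
      interpret Q': primeideal Q' B by (rule B.primes_primeideal) (use Q' VB in blast)
      have m: "s \<in> carrier B - Q'" "b \<in> carrier B - Q'" "?\<tau> Q' = fraction B Q' b s"
        using loc[of Q'] Q' b by (auto simp: basic_open_def)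
      have "fraction B Q' (s \<otimes>\<^bsub>B\<^esub> b) (b \<otimes>\<^bsub>B\<^esub> s) = fraction B Q' \<one>\<^bsub>B\<^esub> \<one>\<^bsub>B\<^esub>"
        "fraction B Q' (b \<otimes>\<^bsub>B\<^esub> s) (s \<otimes>\<^bsub>B\<^esub> b) = fraction B Q' \<one>\<^bsub>B\<^esub> \<one>\<^bsub>B\<^esub>"
        by (rule Q'.frac_eqI; use m b Q'.nonmemb_mult[OF m(1,2)] Q'.nonmemb_mult[OF m(2,1)]
          Q'.one_nonmemb in \<open>simp add: B.m_comm\<close>)+
      then show "?\<kappa> Q' \<otimes>\<^bsub>localization B Q'\<^esub> ?\<tau> Q' = \<one>\<^bsub>localization B Q'\<^esub>"
        "?\<tau> Q' \<otimes>\<^bsub>localization B Q'\<^esub> ?\<kappa> Q' = \<one>\<^bsub>localization B Q'\<^esub>"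
        using Q' m b by (simp_all add: Q'.frac_mult Q'.localization_one)
    qed
    have "germ (Spec B) Q ?V ?\<kappa> \<otimes>\<^bsub>?S\<^esub> germ (Spec B) Q ?V (restrict ?\<tau> ?V) = \<one>\<^bsub>?S\<^esub>"
      unfolding stalk_mult_germ[OF V' QV \<kappa> \<tau>V] B.stalk_one
      using prod(1) VB by (intro germ_Spec_eqI[OF V' QV order_refl VB]) (auto simp: mult_sec_Spec one_sec_Spec)
    moreover have "germ (Spec B) Q ?V (restrict ?\<tau> ?V) \<otimes>\<^bsub>?S\<^esub> germ (Spec B) Q ?V ?\<kappa> = \<one>\<^bsub>?S\<^esub>"
      unfolding stalk_mult_germ[OF V' QV \<tau>V \<kappa>] B.stalk_one
      using prod(2) VB by (intro germ_Spec_eqI[OF V' QV order_refl VB]) (auto simp: mult_sec_Spec one_sec_Spec)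
    moreover have "germ (Spec B) Q ?V ?\<kappa> \<in> carrier ?S" "germ (Spec B) Q ?V (restrict ?\<tau> ?V) \<in> carrier ?S"
      unfolding stalk_carrier using V' QV \<kappa> \<tau>V by auto
    ultimately have unit: "germ (Spec B) Q (primes B) ?\<tau> \<in> Units ?S"
      unfolding g\<tau> Units_def by blast
    let ?T = "stalk (Spec A) (pt f Q)"
    let ?g = "germ (Spec A) (pt f Q) (primes A) ?\<sigma>"
    have "stalk_map (Spec B) (Spec A) f Q ?g = germ (Spec B) Q (primes B) ?\<tau>"
      using stalk_map_germ[OF f _ A.openin_primes PA \<sigma>] QB by (simp add: B.topspace_zariski pre)
    moreover have "local_hom ?T ?S (stalk_map (Spec B) (Spec A) f Q)"
      using f QB unfolding morphism_def by (simp add: B.topspace_zariski)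
    moreover have "?g \<in> carrier ?T"
      unfolding stalk_carrier using A.openin_primes PA \<sigma> by auto
    ultimately have "?g \<in> Units ?T" using unit unfolding local_hom_def by auto
    then obtain k where k: "k \<in> carrier ?T" "?g \<otimes>\<^bsub>?T\<^esub> k = \<one>\<^bsub>?T\<^esub>" unfolding Units_def by blast
    then obtain U \<rho> where U: "openin (zariski A) U" "pt f Q \<in> U" and \<rho>: "\<rho> \<in> carrier (sec (Spec A) U)"
      and k\<rho>: "k = germ (Spec A) (pt f Q) U \<rho>" unfolding stalk_carrier by auto
    have UA: "U \<subseteq> primes A" by (rule A.openin_zariski_subset[OF U(1)])
    have \<sigma>U: "restrict ?\<sigma> U \<in> carrier (sec (Spec A) U)" by (rule sec_Spec_restrict[OF \<sigma> U(1) UA])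
    have "?g = germ (Spec A) (pt f Q) U (restrict ?\<sigma> U)"
      by (rule germ_Spec_eqI[OF U UA]) auto
    then have "germ (Spec A) (pt f Q) U (restrict ?\<sigma> U \<otimes>\<^bsub>sec (Spec A) U\<^esub> \<rho>) =
        germ (Spec A) (pt f Q) (primes A) \<one>\<^bsub>sec (Spec A) (primes A)\<^esub>"
      using k(2) unfolding k\<rho> A.stalk_one[symmetric] by (simp only: stalk_mult_germ[OF U \<sigma>U \<rho>])
    \<comment> \<open>The equality of germs is evaluated at the point itself, where it becomes an
      equation in the localization; this replaces an isomorphism of the stalk with the
      localization.\<close>
    then obtain W where "pt f Q \<in> W"
      "\<forall>y \<in> W. (restrict ?\<sigma> U \<otimes>\<^bsub>sec (Spec A) U\<^esub> \<rho>) y = \<one>\<^bsub>sec (Spec A) (primes A)\<^esub> y"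
      by (rule germ_Spec_eqD[OF _ A.openin_primes PA A.one_section])
    then have "(restrict ?\<sigma> U \<otimes>\<^bsub>sec (Spec A) U\<^esub> \<rho>) (pt f Q) = \<one>\<^bsub>sec (Spec A) (primes A)\<^esub> (pt f Q)"
      by blast
    then have "fraction A (pt f Q) a \<one>\<^bsub>A\<^esub> \<otimes>\<^bsub>localization A (pt f Q)\<^esub> \<rho> (pt f Q) =
        \<one>\<^bsub>localization A (pt f Q)\<^esub>"
      using U(2) PA by (simp add: mult_sec_Spec one_sec_Spec)
    then show "a \<notin> pt f Q"
      by (rule P.frac_mult_eq_one[OF a P.one_nonmemb sec_Spec_value[OF \<rho> U(2)]])
  qed
qed

text \<open>Without a ring homomorphism inducing f, the preimage is not known to be a basic open
  set. It is one locally, and quasi-compactness of the whole spectrum reduces to finitely many local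
  pieces.\<close>

lemma compactin_preim_basic_open:
  assumes A: "cring A" and B: "cring B" and f: "morphism (Spec B) (Spec A) f"
    and a: "a \<in> carrier A"
  shows "compactin (zariski B) {Q \<in> primes B. a \<notin> pt f Q}"
proof -
  interpret A: cring A by (rule A)
  interpret B: cring B by (rule B)
  let ?W = "{Q \<in> primes B. a \<notin> pt f Q}"
  let ?\<sigma> = "\<lambda>P\<in>primes A. fraction A P a \<one>\<^bsub>A\<^esub>"
  let ?\<tau> = "com f (primes A) ?\<sigma>"
  have pre: "preim (Spec B) f (primes A) = primes B"
    using preim_points[OF f] by (simp add: A.topspace_zariski B.topspace_zariski)
  have \<sigma>: "?\<sigma> \<in> carrier (sec (Spec A) (primes A))"
    using a A.one_notin_prime by (intro A.fraction_section A.openin_primes) auto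
  have "com f (primes A) \<in> ring_hom (sec (Spec A) (primes A)) (sec (Spec B) (primes B))"
    using morphism_com[OF f, of "primes A"] A.openin_primes by (simp add: pre)
  then have \<tau>: "?\<tau> \<in> carrier (sec (Spec B) (primes B))" by (rule ring_hom_closed[OF _ \<sigma>])
  have "\<exists>U. openin (zariski B) U \<and> Q \<in> U \<and> compactin (zariski B) (?W \<inter> U)"
    if Q: "Q \<in> topspace (zariski B)" for Q
  proof -
    have QB: "Q \<in> primes B" using Q by (simp add: B.topspace_zariski)
    obtain V b s where V: "openin (zariski B) V" "Q \<in> V" and b: "b \<in> carrier B" "s \<in> carrier B"
      and loc: "\<And>Q'. Q' \<in> V \<Longrightarrow> s \<notin> Q' \<and> ?\<tau> Q' = fraction B Q' b s"
      using sec_Spec_local[OF \<tau> QB] by metis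
    \<comment> \<open>Shrinking the neighbourhood to a basic open set makes the local piece of the
      preimage basic, hence quasi-compact.\<close>
    obtain t where t: "t \<in> carrier B" "Q \<in> basic_open B t" "basic_open B t \<subseteq> V"
      by (rule B.open_contains_basic_open[OF V])
    have "a \<notin> pt f Q' \<longleftrightarrow> b \<notin> Q'" if "Q' \<in> V" for Q'
      by (rule morphism_preim_basic_open_local[OF A B f a V(1) that b loc])
    then have "?W \<inter> basic_open B t = basic_open B b \<inter> basic_open B t"
      using t(3) unfolding basic_open_def by blast
    also have "\<dots> = basic_open B (b \<otimes>\<^bsub>B\<^esub> t)" by (rule B.basic_open_mult[OF b(1) t(1), symmetric])
    finally have "compactin (zariski B) (?W \<inter> basic_open B t)"
      using B.compactin_basic_open[of "b \<otimes>\<^bsub>B\<^esub> t"] b(1) t(1) by simp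
    then show ?thesis using B.openin_basic_open[OF t(1)] t(2) by blast
  qed
  from compact_space_finite_cover[OF B.compact_space_zariski this] obtain \<F> where
    \<F>: "finite \<F>" "topspace (zariski B) \<subseteq> \<Union>\<F>" "\<And>U. U \<in> \<F> \<Longrightarrow> compactin (zariski B) (?W \<inter> U)" by blast
  have "?W = (\<Union>U\<in>\<F>. ?W \<inter> U)" using \<F>(2) by (auto simp: B.topspace_zariski)
  moreover have "compactin (zariski B) (\<Union>U\<in>\<F>. ?W \<inter> U)"
    using \<F> by (intro compactin_Union) auto
  ultimately show ?thesis by simp
qed

section \<open>Reduction of the four conditions to topology\<close>

section \<open>The quotient of the spectrum by the group\<close>

lemma open_sub_points: "open_sub Y (points Y) = Y"
  by (simp add: open_sub_def subtopology_topspace)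

lemma iso_morE:
  assumes "iso_mor X Y f"
  obtains g where "morphism X Y f" "morphism Y X g"
    "\<And>x. x \<in> points X \<Longrightarrow> pt g (pt f x) = x" "\<And>y. y \<in> points Y \<Longrightarrow> pt f (pt g y) = y"
proof -
  from assms obtain g where g: "morphism X Y f" "morphism Y X g"
    "mor_eq X X (comp_mor Y g f) id_mor" "mor_eq Y Y (comp_mor X f g) id_mor"
    unfolding iso_mor_def by blast
  show thesis
    by (rule that[OF g(1,2)]) (use g(3,4) in \<open>simp_all add: mor_eq_def comp_mor_def id_mor_def\<close>)
qed

lemma morphism_pt: "morphism X Y f \<Longrightarrow> x \<in> points X \<Longrightarrow> pt f x \<in> points Y"
  using continuous_map_image_subset_topspace[OF morphism_continuous] by blast

lemma mor_eq_pt: "mor_eq X Y f g \<Longrightarrow> x \<in> points X \<Longrightarrow> pt f x = pt g x"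
  by (simp add: mor_eq_def)

text \<open>On points, the fibre products with the constant group become sets of pairs and triples,
  so the identities between morphisms turn into the axioms of an ordinary group action.\<close>

lemma const_group_actionD:
  assumes "const_group_action \<Gamma> X Y f \<rho>" and "group \<Gamma>"
  shows "g \<in> carrier \<Gamma> \<Longrightarrow> continuous_map (top_of X) (top_of X) (\<lambda>x. pt \<rho> (g, x))"
    and "g \<in> carrier \<Gamma> \<Longrightarrow> x \<in> points X \<Longrightarrow> pt f (pt \<rho> (g, x)) = pt f x"
    and "x \<in> points X \<Longrightarrow> pt \<rho> (\<one>\<^bsub>\<Gamma>\<^esub>, x) = x"
    and "\<lbrakk>g \<in> carrier \<Gamma>; k \<in> carrier \<Gamma>; x \<in> points X\<rbrakk> \<Longrightarrow> pt \<rho> (g, pt \<rho> (k, x)) = pt \<rho> (g \<otimes>\<^bsub>\<Gamma>\<^esub> k, x)"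
proof -
  have a: "morphism (times_const \<Gamma> X) X \<rho>"
    "mor_eq (times_const \<Gamma> X) Y (comp_mor X f \<rho>) (comp_mor X f (proj_X \<Gamma>))"
    "mor_eq X X (comp_mor (times_const \<Gamma> X) \<rho> (unit_times_X \<Gamma>)) id_mor"
    "mor_eq (times_const \<Gamma> (times_const \<Gamma> X)) X
       (comp_mor (times_const \<Gamma> X) \<rho> (id_times_act \<Gamma> X \<rho>))
       (comp_mor (times_const \<Gamma> X) \<rho> (mult_times_X \<Gamma>))"
    using assms(1) unfolding const_group_action_def by simp_all
  have pts: "points (times_const \<Gamma> X) = carrier \<Gamma> \<times> points X"
    by (simp add: copies_def topspace_sum_topology)
  have pts2: "points (times_const \<Gamma> (times_const \<Gamma> X)) = carrier \<Gamma> \<times> carrier \<Gamma> \<times> points X"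
    by (simp add: copies_def topspace_sum_topology)
  show "continuous_map (top_of X) (top_of X) (\<lambda>x. pt \<rho> (g, x))" if g: "g \<in> carrier \<Gamma>"
  proof -
    have "continuous_map (sum_topology (\<lambda>i. top_of X) (carrier \<Gamma>)) (top_of X) (pt \<rho>)"
      using morphism_continuous[OF a(1)] by (simp add: copies_def)
    from continuous_map_compose[OF continuous_map_component_injection[OF g] this]
    show ?thesis by (simp add: o_def)
  qed
  from mor_eq_pt[OF a(2), of "(g, x)"] show "pt f (pt \<rho> (g, x)) = pt f x" if "g \<in> carrier \<Gamma>" "x \<in> points X"
    using that unfolding pts by (simp add: comp_mor_def proj_X_def copair_def id_mor_def)
  from mor_eq_pt[OF a(3), of x] show "pt \<rho> (\<one>\<^bsub>\<Gamma>\<^esub>, x) = x" if "x \<in> points X"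
    using that by (simp add: comp_mor_def unit_times_X_def incl_mor_def id_mor_def)
  from mor_eq_pt[OF a(4), of "(g, k, x)"] show "pt \<rho> (g, pt \<rho> (k, x)) = pt \<rho> (g \<otimes>\<^bsub>\<Gamma>\<^esub> k, x)"
    if "g \<in> carrier \<Gamma>" "k \<in> carrier \<Gamma>" "x \<in> points X"
    using that unfolding pts2
    by (simp add: comp_mor_def id_times_act_def mult_times_X_def copair_def incl_mor_def)
qed

text \<open>The action is transported from X to the spectrum of B along \<beta> and its inverse. Two
  primes with the same contraction lift to a prime of the tensor product, and a preimage of that
  prime under the surjection consists of a group element carrying one to the other and a
  point.\<close>

lemma spectrum_finite_group_quotient:
  fixes X :: "('p, 's) ringed_space" and Y :: "('q, 't) ringed_space" and \<Gamma> :: "'g monoid"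
  assumes X: "affine_scheme X" and Y: "affine_scheme Y" and f: "morphism X Y f"
    and int: "integral_mor X Y f" and surj: "surjective_mor X Y f"
    and \<Gamma>: "group \<Gamma>" "finite (carrier \<Gamma>)" and \<rho>: "const_group_action \<Gamma> X Y f \<rho>"
    and orbits: "act_proj_surjective \<Gamma> X Y f \<rho>"
  obtains A :: "'t ring" and B :: "'s ring" and \<phi> act \<alpha> \<beta> where "cring A" "cring B"
    "iso_mor Y (Spec A) \<alpha>" "iso_mor X (Spec B) \<beta>"
    "finite_group_quotient \<Gamma> (zariski B) (zariski A) (contract A \<phi>) act"
proof -
  from orbits obtain A :: "'t ring" and B :: "'s ring" and \<phi> \<alpha> \<beta> h where
    A: "cring A" and B: "cring B" and \<phi>: "\<phi> \<in> ring_hom A B"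
    and \<alpha>: "iso_mor Y (Spec A) \<alpha>" and \<beta>: "iso_mor X (Spec B) \<beta>"
    and eq: "mor_eq X (Spec A) (comp_mor Y \<alpha> f) (comp_mor (Spec B) (Spec_map A B \<phi>) \<beta>)"
    and h1: "mor_eq (times_const \<Gamma> X) (Spec B) (comp_mor (Spec (tensor_ring A B B \<phi> \<phi>))
        (Spec_map B (tensor_ring A B B \<phi> \<phi>) (\<lambda>b. tensor_elt A B B \<phi> \<phi> b \<one>\<^bsub>B\<^esub>)) h) (comp_mor X \<beta> \<rho>)"
    and h2: "mor_eq (times_const \<Gamma> X) (Spec B) (comp_mor (Spec (tensor_ring A B B \<phi> \<phi>))
        (Spec_map B (tensor_ring A B B \<phi> \<phi>) (\<lambda>b. tensor_elt A B B \<phi> \<phi> \<one>\<^bsub>B\<^esub> b)) h)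
        (comp_mor X \<beta> (proj_X \<Gamma>))"
    and h: "surjective_mor (times_const \<Gamma> X) (Spec (tensor_ring A B B \<phi> \<phi>)) h"
    unfolding act_proj_surjective_def Let_def by blast
  interpret A: cring A by (rule A)
  interpret B: cring B by (rule B)
  interpret \<phi>: ring_hom_cring A B \<phi>
    by (intro ring_hom_cring.intro ring_hom_cring_axioms.intro A B \<phi>)
  let ?T = "tensor_ring A B B \<phi> \<phi>"
  obtain \<gamma> where \<alpha>m: "morphism Y (Spec A) \<alpha>" and \<gamma>m: "morphism (Spec A) Y \<gamma>"
    and \<alpha>\<gamma>: "\<And>P. P \<in> points (Spec A) \<Longrightarrow> pt \<alpha> (pt \<gamma> P) = P"
    using iso_morE[OF \<alpha>] by metis
  obtain \<delta> where \<beta>m: "morphism X (Spec B) \<beta>" and \<delta>m: "morphism (Spec B) X \<delta>"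
    and \<delta>\<beta>: "\<And>x. x \<in> points X \<Longrightarrow> pt \<delta> (pt \<beta> x) = x"
    and \<beta>\<delta>: "\<And>Q. Q \<in> points (Spec B) \<Longrightarrow> pt \<beta> (pt \<delta> Q) = Q"
    using iso_morE[OF \<beta>] by metis
  have ptA: "points (Spec A) = primes A" and ptB: "points (Spec B) = primes B"
    by (simp_all add: A.topspace_zariski B.topspace_zariski)
  have pts: "points (times_const \<Gamma> X) = carrier \<Gamma> \<times> points X"
    by (simp add: copies_def topspace_sum_topology)
  note act = const_group_actionD[OF \<rho> \<Gamma>(1)]
  have actX: "pt \<rho> (g, x) \<in> points X" if "g \<in> carrier \<Gamma>" "x \<in> points X" for g x
    using continuous_map_image_subset_topspace[OF act(1)[OF that(1)]] that(2) by blast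
  have \<delta>X: "pt \<delta> Q \<in> points X" if "Q \<in> primes B" for Q
    using morphism_pt[OF \<delta>m] that by (simp only: ptB)
  have \<alpha>f: "pt \<alpha> (pt f x) = contract A \<phi> (pt \<beta> x)" if "x \<in> points X" for x
    using mor_eq_pt[OF eq that] by (simp add: comp_mor_def Spec_map_def)
  let ?act = "\<lambda>g Q. pt \<beta> (pt \<rho> (g, pt \<delta> Q))"
  have fibre: "contract A \<phi> Q = contract A \<phi> Q' \<longleftrightarrow> (\<exists>g \<in> carrier \<Gamma>. Q = ?act g Q')"
    if QQ: "Q \<in> primes B" "Q' \<in> primes B" for Q Q'
  proof
    assume "contract A \<phi> Q = contract A \<phi> Q'"
    then obtain N where N: "primeideal N ?T"
      "contract B (\<lambda>b. tensor_elt A B B \<phi> \<phi> b \<one>\<^bsub>B\<^esub>) N = Q"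
      "contract B (\<lambda>b. tensor_elt A B B \<phi> \<phi> \<one>\<^bsub>B\<^esub> b) N = Q'"
      using tensor_prime_exists[OF \<phi>.ring_hom_cring_axioms \<phi>.ring_hom_cring_axioms
          B.primes_primeideal[OF QQ(1)] B.primes_primeideal[OF QQ(2)]] by metis
    have "N \<in> points (Spec ?T)"
      using N(1) cring.topspace_zariski[of ?T] by (simp add: primes_def primeideal_def)
    then obtain g x where gx: "g \<in> carrier \<Gamma>" "x \<in> points X" and hN: "pt h (g, x) = N"
    proof -
      from \<open>N \<in> points (Spec ?T)\<close> have "N \<in> pt h ` (carrier \<Gamma> \<times> points X)"
        using h unfolding surjective_mor_def pts by (simp only:)
      then show thesis using that by (elim imageE SigmaE) simp
    qed
    have "(g, x) \<in> points (times_const \<Gamma> X)" using gx by (simp add: pts)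
    from mor_eq_pt[OF h1 this] mor_eq_pt[OF h2 this] have "Q = pt \<beta> (pt \<rho> (g, x))" "Q' = pt \<beta> x"
      using N(2,3) hN gx(1) by (simp_all add: comp_mor_def Spec_map_def proj_X_def copair_def id_mor_def)
    then have "Q = ?act g Q'" using \<delta>\<beta>[OF gx(2)] by simp
    then show "\<exists>g \<in> carrier \<Gamma>. Q = ?act g Q'" using gx(1) by blast
  next
    assume "\<exists>g \<in> carrier \<Gamma>. Q = ?act g Q'"
    then obtain g where g: "g \<in> carrier \<Gamma>" "Q = ?act g Q'" by blast
    have "contract A \<phi> Q = pt \<alpha> (pt f (pt \<rho> (g, pt \<delta> Q')))"
      using \<alpha>f[OF actX[OF g(1) \<delta>X[OF QQ(2)]]] g(2) by simp
    also have "\<dots> = pt \<alpha> (pt f (pt \<delta> Q'))" using act(2)[OF g(1) \<delta>X[OF QQ(2)]] by simp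
    also have "\<dots> = contract A \<phi> Q'"
      using \<alpha>f[OF \<delta>X[OF QQ(2)]] \<beta>\<delta>[of Q'] QQ(2) by (simp only: ptB)
    finally show "contract A \<phi> Q = contract A \<phi> Q'" .
  qed
  have "finite_group_quotient \<Gamma> (zariski B) (zariski A) (contract A \<phi>) ?act"
  proof (intro finite_group_quotient.intro \<Gamma>)
    fix g assume g: "g \<in> carrier \<Gamma>"
    show "continuous_map (zariski B) (zariski B) (?act g)"
      using continuous_map_compose[OF continuous_map_compose[OF morphism_continuous[OF \<delta>m] act(1)[OF g]]
          morphism_continuous[OF \<beta>m]] by (simp add: o_def)
  next
    fix Q assume "Q \<in> topspace (zariski B)"
    then have "Q \<in> primes B" by (simp add: B.topspace_zariski)
    then show "?act \<one>\<^bsub>\<Gamma>\<^esub> Q = Q" using act(3)[OF \<delta>X] \<beta>\<delta> by (simp only: ptB)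
  next
    fix g k Q assume gk: "g \<in> carrier \<Gamma>" "k \<in> carrier \<Gamma>" and "Q \<in> topspace (zariski B)"
    then have Q: "Q \<in> primes B" by (simp add: B.topspace_zariski)
    show "?act g (?act k Q) = ?act (g \<otimes>\<^bsub>\<Gamma>\<^esub> k) Q"
      using \<delta>\<beta>[OF actX[OF gk(2) \<delta>X[OF Q]]] act(4)[OF gk \<delta>X[OF Q]] by simp
  next
    show "continuous_map (zariski B) (zariski A) (contract A \<phi>)" by (rule \<phi>.continuous_map_contract)
    \<comment> \<open>Y is itself affine, so integrality may be read off on global sections.\<close>
    have "integral_hom (sec Y (points Y)) (sec X (points X)) (com f (points Y))"
      using int Y openin_topspace[of "top_of Y"] preim_points[OF f]
      unfolding integral_mor_def by (metis open_sub_points)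
    then show "closed_map (zariski B) (zariski A) (contract A \<phi>)"
      using X by (intro \<phi>.closed_map_contract
          integral_mor_relation[OF \<phi>.ring_hom_cring_axioms _ f \<alpha> \<beta> eq]) (auto simp: affine_scheme_def)
    show "contract A \<phi> ` topspace (zariski B) = topspace (zariski A)"
      unfolding A.topspace_zariski B.topspace_zariski
    proof
      show "contract A \<phi> ` primes B \<subseteq> primes A" using \<phi>.contract_prime by blast
      show "primes A \<subseteq> contract A \<phi> ` primes B"
      proof
        fix P assume P: "P \<in> primes A"
        then have "pt \<gamma> P \<in> points Y" using morphism_pt[OF \<gamma>m] by (simp only: ptA)
        then obtain x where x: "x \<in> points X" "pt f x = pt \<gamma> P"
          using surj unfolding surjective_mor_def by (metis imageE)
        have "contract A \<phi> (pt \<beta> x) = P" using \<alpha>f[OF x(1)] x(2) \<alpha>\<gamma>[of P] P by (simp only: ptA)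
        moreover have "pt \<beta> x \<in> primes B" using morphism_pt[OF \<beta>m x(1)] by (simp only: ptB)
        ultimately show "P \<in> contract A \<phi> ` primes B" by blast
      qed
    qed
  next
    fix Q Q' assume "Q \<in> topspace (zariski B)" "Q' \<in> topspace (zariski B)"
    then show "contract A \<phi> Q = contract A \<phi> Q' \<longleftrightarrow> (\<exists>g \<in> carrier \<Gamma>. Q = ?act g Q')"
      unfolding B.topspace_zariski by (rule fibre)
  qed
  then show thesis using that A B \<alpha> \<beta> by blast
qed

section \<open>The four conditions\<close>

lemma iso_mor_surj:
  assumes "iso_mor X Y f"
  obtains g where "morphism X Y f" "morphism Y X g" "pt f ` points X = points Y" "pt g ` points Y = points X"
    "top_of X homeomorphic_space top_of Y"
proof -
  obtain g where g: "morphism X Y f" "morphism Y X g"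
    "\<And>x. x \<in> points X \<Longrightarrow> pt g (pt f x) = x" "\<And>y. y \<in> points Y \<Longrightarrow> pt f (pt g y) = y"
    using iso_morE[OF assms] by metis
  show thesis
  proof (rule that[OF g(1,2)])
    show "pt f ` points X = points Y"
    proof (intro equalityI subsetI)
      fix y assume "y \<in> points Y"
      then show "y \<in> pt f ` points X" using morphism_pt[OF g(2)] g(4)[of y] by (metis imageI)
    qed (use morphism_pt[OF g(1)] in blast)
    show "pt g ` points Y = points X"
    proof (intro equalityI subsetI)
      fix x assume "x \<in> points X"
      then show "x \<in> pt g ` points Y" using morphism_pt[OF g(1)] g(3)[of x] by (metis imageI)
    qed (use morphism_pt[OF g(2)] in blast)
    show "top_of X homeomorphic_space top_of Y"
      unfolding homeomorphic_space_def homeomorphic_maps_def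
      using g(3,4) morphism_continuous[OF g(1)] morphism_continuous[OF g(2)]
      by (intro exI[of _ "pt f"] exI[of _ "pt g"]) simp
  qed
qed

text \<open>The spaces X and Y and the spectra isomorphic to them have points of different types, so
  a property enters at four types, and its transport along the isomorphisms becomes a
  hypothesis.\<close>

lemma dagger_i_transfer:
  fixes PX :: "'p topology \<Rightarrow> bool" and PY :: "'q topology \<Rightarrow> bool"
    and PA :: "'t set topology \<Rightarrow> bool" and PB :: "'s set topology \<Rightarrow> bool"
  assumes toA: "\<And>(A :: 't ring) (Y :: ('q, 't) ringed_space) \<alpha>.
      \<lbrakk>cring A; iso_mor Y (Spec A) \<alpha>; PY (top_of Y)\<rbrakk> \<Longrightarrow> PA (zariski A)"
    and fromB: "\<And>(B :: 's ring) (X :: ('p, 's) ringed_space) \<beta>.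
      \<lbrakk>cring B; iso_mor X (Spec B) \<beta>; PB (zariski B)\<rbrakk> \<Longrightarrow> PX (top_of X)"
    and quot: "\<And>(A :: 't ring) (B :: 's ring) f (\<Gamma> :: 'g monoid) act.
      \<lbrakk>cring A; cring B; finite_group_quotient \<Gamma> (zariski B) (zariski A) f act; PA (zariski A)\<rbrakk> \<Longrightarrow>
      PB (zariski B)"
  shows "dagger_i TYPE('g) (\<lambda>X :: ('p, 's) ringed_space. PX (top_of X))
    (\<lambda>Y :: ('q, 't) ringed_space. PY (top_of Y))"
  unfolding dagger_i_def
proof (intro allI impI, elim conjE)
  fix X :: "('p, 's) ringed_space" and Y :: "('q, 't) ringed_space" and f \<rho> and \<Gamma> :: "'g monoid"
  assume *: "affine_scheme X" "affine_scheme Y" "morphism X Y f" "integral_mor X Y f"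
    "surjective_mor X Y f" "group \<Gamma>" "finite (carrier \<Gamma>)" "const_group_action \<Gamma> X Y f \<rho>"
    "act_proj_surjective \<Gamma> X Y f \<rho>" and Y: "PY (top_of Y)"
  obtain A :: "'t ring" and B :: "'s ring" and \<phi> act \<alpha> \<beta> where "cring A" "cring B"
    "iso_mor Y (Spec A) \<alpha>" "iso_mor X (Spec B) \<beta>"
    "finite_group_quotient \<Gamma> (zariski B) (zariski A) (contract A \<phi>) act"
    by (rule spectrum_finite_group_quotient[OF *])
  then show "PX (top_of X)" using toA fromB quot Y by metis
qed

lemma compact_space_iso_Spec:
  assumes "cring A" "iso_mor Y (Spec A) \<alpha>"
  shows "compact_space (top_of Y)"
proof -
  obtain g where "top_of Y homeomorphic_space zariski A"
    using iso_mor_surj[OF assms(2)] by (metis top_of_Spec)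
  then show ?thesis using cring.compact_space_zariski[OF assms(1)] homeomorphic_compact_space by blast
qed

lemma locally_connected_zariskiI:
  assumes R: "cring R" and spl: "\<And>a. a \<in> carrier R \<Longrightarrow> splits_boundedly (zariski R) (basic_open R a)"
  shows "locally_connected_space (zariski R)"
  unfolding locally_connected_space
proof (intro allI impI, elim conjE)
  interpret cring R by (rule R)
  fix V P assume V: "openin (zariski R) V" "P \<in> V"
  obtain a where a: "a \<in> carrier R" "P \<in> basic_open R a" "basic_open R a \<subseteq> V"
    by (rule open_contains_basic_open[OF V])
  obtain C where "openin (zariski R) C" "connectedin (zariski R) C" "P \<in> C" "C \<subseteq> basic_open R a"
    by (rule splits_boundedly_open_connected_nbhd[OF spl[OF a(1)] openin_basic_open[OF a(1)] a(2)])
  then show "\<exists>U. openin (zariski R) U \<and> connectedin (zariski R) U \<and> P \<in> U \<and> U \<subseteq> V"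
    using a(3) by blast
qed

lemma dagger_i_locally_connected:
  "dagger_i TYPE('g) locally_connected_scheme locally_connected_scheme"
  unfolding locally_connected_scheme_def
proof (rule dagger_i_transfer[where PA = locally_connected_space and PB = locally_connected_space])
  show "locally_connected_space (zariski A)"
    if "iso_mor Y (Spec A) \<alpha>" "locally_connected_space (top_of Y)" for A :: "'t ring" and Y :: "('q, 't) ringed_space" and \<alpha>
    using iso_mor_surj[OF that(1)] that(2) homeomorphic_locally_connected_space by (metis top_of_Spec)
  show "locally_connected_space (top_of X)"
    if "iso_mor X (Spec B) \<beta>" "locally_connected_space (zariski B)" for B :: "'s ring" and X :: "('p, 's) ringed_space" and \<beta>
    using iso_mor_surj[OF that(1)] that(2) homeomorphic_locally_connected_space by (metis top_of_Spec)
  fix A :: "'t ring" and B :: "'s ring" and f and \<Gamma> :: "'g monoid" and act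
  assume B: "cring B" and q: "finite_group_quotient \<Gamma> (zariski B) (zariski A) f act"
    and A: "locally_connected_space (zariski A)"
  interpret B: cring B by (rule B)
  show "locally_connected_space (zariski B)"
  proof (rule finite_group_quotient.locally_connected_source[OF q A])
    show "\<exists>W. openin (zariski B) W \<and> compactin (zariski B) W \<and> x \<in> W \<and> W \<subseteq> U"
      if "openin (zariski B) U" "x \<in> U" for U x
      using B.open_contains_basic_open[OF that] B.openin_basic_open B.compactin_basic_open by metis
  qed (rule B.compactin_Int_open)
qed

text \<open>Transport along the isomorphisms needs no separate invariance lemma: each direction of
  an isomorphism is a continuous surjection, and the spaces involved are quasi-compact.\<close>

lemma dagger_i_loc_fin_many_irred_components:
  "dagger_i TYPE('g) loc_fin_many_irred_components_scheme loc_fin_many_irred_components_scheme"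
  unfolding loc_fin_many_irred_components_scheme_def
proof (rule dagger_i_transfer[where PA = loc_fin_many_irred_components and PB = loc_fin_many_irred_components])
  show "loc_fin_many_irred_components (zariski A)"
    if "cring A" "iso_mor Y (Spec A) \<alpha>" "loc_fin_many_irred_components (top_of Y)"
    for A :: "'t ring" and Y :: "('q, 't) ringed_space" and \<alpha>
    using iso_mor_surj[OF that(2)] loc_fin_many_irred_components_image[OF _ _ that(3)]
      compact_space_iso_Spec[OF that(1,2)] morphism_continuous by (metis top_of_Spec)
  show "loc_fin_many_irred_components (top_of X)"
    if "cring B" "iso_mor X (Spec B) \<beta>" "loc_fin_many_irred_components (zariski B)"
    for B :: "'s ring" and X :: "('p, 's) ringed_space" and \<beta>
    using iso_mor_surj[OF that(2)] loc_fin_many_irred_components_image[OF _ _ that(3)]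
      cring.compact_space_zariski[OF that(1)] morphism_continuous by (metis top_of_Spec)
qed (rule finite_group_quotient.loc_fin_many_irred_components_source)

lemma dagger_i_locally_noetherian:
  "dagger_i TYPE('g) locally_top_noetherian_scheme locally_top_noetherian_scheme"
  unfolding locally_top_noetherian_scheme_def
proof (rule dagger_i_transfer[where PA = locally_noetherian_top and PB = locally_noetherian_top])
  show "locally_noetherian_top (zariski A)"
    if "cring A" "iso_mor Y (Spec A) \<alpha>" "locally_noetherian_top (top_of Y)"
    for A :: "'t ring" and Y :: "('q, 't) ringed_space" and \<alpha>
    using iso_mor_surj[OF that(2)] locally_noetherian_top_image[OF _ _ that(3)]
      compact_space_iso_Spec[OF that(1,2)] morphism_continuous by (metis top_of_Spec)
  show "locally_noetherian_top (top_of X)"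
    if "cring B" "iso_mor X (Spec B) \<beta>" "locally_noetherian_top (zariski B)"
    for B :: "'s ring" and X :: "('p, 's) ringed_space" and \<beta>
    using iso_mor_surj[OF that(2)] locally_noetherian_top_image[OF _ _ that(3)]
      cring.compact_space_zariski[OF that(1)] morphism_continuous by (metis top_of_Spec)
qed (rule finite_group_quotient.locally_noetherian_top_source)

text \<open>The preimage of a basic open set is open and quasi-compact, so its partitions are
  bounded by local connectedness of the source. The bound descends to the basic open set, and these
  sets form a base.\<close>

lemma dagger_ii_locally_connected:
  "dagger_ii locally_connected_scheme locally_connected_scheme"
  unfolding dagger_ii_def locally_connected_scheme_def top_of_Spec
proof (intro allI impI, elim conjE)
  fix A :: "'a ring" and B :: "'b ring" and f
  assume A: "cring A" and B: "cring B" and f: "morphism (Spec B) (Spec A) f"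
    and surj: "surjective_mor (Spec B) (Spec A) f" and lc: "locally_connected_space (zariski B)"
  interpret A: cring A by (rule A)
  interpret B: cring B by (rule B)
  have im: "pt f ` primes B = primes A"
    using surj by (simp add: surjective_mor_def A.topspace_zariski B.topspace_zariski)
  have cont: "continuous_map (zariski B) (zariski A) (pt f)" using morphism_continuous[OF f] by simp
  show "locally_connected_space (zariski A)"
  proof (rule locally_connected_zariskiI[OF A])
    fix a assume a: "a \<in> carrier A"
    let ?W = "{Q \<in> primes B. a \<notin> pt f Q}"
    have eq: "?W = {Q \<in> topspace (zariski B). pt f Q \<in> basic_open A a}"
      using im by (auto simp: basic_open_def B.topspace_zariski)
    have W: "openin (zariski B) ?W"
      unfolding eq by (rule openin_continuous_map_preimage[OF cont A.openin_basic_open[OF a]])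
    have "pt f ` ?W = basic_open A a"
      unfolding basic_open_def im[symmetric] by blast
    then show "splits_boundedly (zariski A) (basic_open A a)"
      by (rule splits_boundedly_image[OF cont W _ splits_boundedly_if_locally_connected[OF lc
            compactin_preim_basic_open[OF A B f a] W]])
  qed
qed

text \<open>Serves the two properties that descend along any continuous surjection from a
  quasi-compact space.\<close>

lemma dagger_ii_image:
  assumes "\<And>(A :: 'a ring) (B :: 'b ring) f. \<lbrakk>continuous_map (zariski B) (zariski A) f;
      f ` topspace (zariski B) = topspace (zariski A); PB (zariski B); compact_space (zariski B)\<rbrakk> \<Longrightarrow>
      PA (zariski A)"
  shows "dagger_ii (\<lambda>X :: ('a set, 'a set \<Rightarrow> ('a \<times> 'a) set) ringed_space. PA (top_of X))
    (\<lambda>X :: ('b set, 'b set \<Rightarrow> ('b \<times> 'b) set) ringed_space. PB (top_of X))"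
  unfolding dagger_ii_def top_of_Spec
proof (intro allI impI, elim conjE)
  fix A :: "'a ring" and B :: "'b ring" and f
  assume "cring A" "cring B" "morphism (Spec B) (Spec A) f"
    "surjective_mor (Spec B) (Spec A) f" "PB (zariski B)"
  then show "PA (zariski A)"
    using assms[of B A "pt f"] morphism_continuous[of "Spec B" "Spec A" f] cring.compact_space_zariski[of B]
    by (simp add: surjective_mor_def)
qed

lemma dagger_iii_open_subset:
  assumes "\<And>T U. P T \<Longrightarrow> openin T U \<Longrightarrow> P (subtopology T U)"
  shows "dagger_iii (\<lambda>X. P (top_of X))"
  unfolding dagger_iii_def using assms by (simp add: open_sub_def)

lemma dagger_iv_cover:
  assumes "\<And>T \<U>. \<Union>\<U> = topspace T \<Longrightarrow>
      (\<And>U. U \<in> \<U> \<Longrightarrow> openin T U \<and> P (subtopology T U)) \<Longrightarrow> P T"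
  shows "dagger_iv (\<lambda>X :: ('p, 's) ringed_space. P (top_of X))"
  unfolding dagger_iv_def
proof (intro allI impI, elim conjE)
  fix X :: "('p, 's) ringed_space" and \<U>
  assume "\<forall>U \<in> \<U>. open_of X U \<and> P (top_of (open_sub X U))" "\<Union>\<U> = points X"
  then show "P (top_of X)" by (intro assms[of \<U>]) (auto simp: open_sub_def)
qed

theorem proposition1:
  shows "satisfies_dagger TYPE('g)
           locally_connected_scheme locally_connected_scheme
           locally_connected_scheme locally_connected_scheme \<and>
         satisfies_dagger TYPE('g)
           loc_fin_many_irred_components_scheme loc_fin_many_irred_components_scheme
           loc_fin_many_irred_components_scheme loc_fin_many_irred_components_scheme \<and>
         satisfies_dagger TYPE('g)
           locally_top_noetherian_scheme locally_top_noetherian_scheme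
           locally_top_noetherian_scheme locally_top_noetherian_scheme"
  unfolding satisfies_dagger_def
proof (intro conjI)
  show "dagger_i TYPE('g) locally_connected_scheme locally_connected_scheme"
    by (rule dagger_i_locally_connected)
  show "dagger_ii locally_connected_scheme locally_connected_scheme"
    by (rule dagger_ii_locally_connected)
  show "dagger_iii locally_connected_scheme"
    unfolding locally_connected_scheme_def
    by (rule dagger_iii_open_subset[where P = locally_connected_space, OF locally_connected_space_open_subset])
  show "dagger_iv locally_connected_scheme"
    unfolding locally_connected_scheme_def
    by (rule dagger_iv_cover[where P = locally_connected_space, OF locally_connected_space_cover])
  show "dagger_i TYPE('g) loc_fin_many_irred_components_scheme loc_fin_many_irred_components_scheme"
    by (rule dagger_i_loc_fin_many_irred_components)
  show "dagger_ii loc_fin_many_irred_components_scheme loc_fin_many_irred_components_scheme"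
    unfolding loc_fin_many_irred_components_scheme_def
    by (rule dagger_ii_image[where PA = loc_fin_many_irred_components and PB = loc_fin_many_irred_components, OF loc_fin_many_irred_components_image])
  show "dagger_iii loc_fin_many_irred_components_scheme"
    unfolding loc_fin_many_irred_components_scheme_def
    by (rule dagger_iii_open_subset[where P = loc_fin_many_irred_components, OF loc_fin_many_irred_components_open_subset])
  show "dagger_iv loc_fin_many_irred_components_scheme"
    unfolding loc_fin_many_irred_components_scheme_def
    by (rule dagger_iv_cover[where P = loc_fin_many_irred_components, OF loc_fin_many_irred_components_cover])
  show "dagger_i TYPE('g) locally_top_noetherian_scheme locally_top_noetherian_scheme"
    by (rule dagger_i_locally_noetherian)
  show "dagger_ii locally_top_noetherian_scheme locally_top_noetherian_scheme"
    unfolding locally_top_noetherian_scheme_def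
    by (rule dagger_ii_image[where PA = locally_noetherian_top and PB = locally_noetherian_top, OF locally_noetherian_top_image])
  show "dagger_iii locally_top_noetherian_scheme"
    unfolding locally_top_noetherian_scheme_def
    by (rule dagger_iii_open_subset[where P = locally_noetherian_top, OF locally_noetherian_top_open_subset])
  show "dagger_iv locally_top_noetherian_scheme"
    unfolding locally_top_noetherian_scheme_def
    by (rule dagger_iv_cover[where P = locally_noetherian_top, OF locally_noetherian_top_cover])
qed

end
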